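(* Let $E_n(x)$ denote the Euler polynomials. Let $BC$ be the arc $$BC=\Big\{x\in\mathbb{C}: |x|\le \tfrac1\pi,\ \operatorname{Im}x\le 0,\ \operatorname{Re}x\ge 0,\ \big|\pi i x\,e^{1-\pi i x}\big|=1\Big\}$$ with endpoints $B=-i/\pi$ and $C=\frac{1}{\pi e}$. Put $z=\pi i x$ and $\zeta=\zeta(x)=ze^{1-z}$; this map carries $BC$ to the circular arc $B''C''=\{e^{i\phi}:0\le\phi\le\frac{\pi}{2}-\frac1e\}$. Then the images in the $\zeta$-plane of the zeros of $E_n(nx)$ along the arc $BC$ are uniformly distributed along $B''C''$; that is, for all $0\le\alpha<\beta\le\frac{\pi}{2}-\frac1e$ and all sufficiently small $\varepsilon>0$, $$\lim_{n\to\infty}\frac1n\,\#\big\{x: E_n(nx)=0,\ \operatorname{dist}(x,BC)<\varepsilon,\ \alpha\le\arg\zeta(x)\le\beta\big\}=\frac{\beta-\alpha}{2\pi}.$$ As a consequence, the fraction of zeros of $E_n(nx)$ residing in a neighborhood of the arc $BC$ is $$\frac{\pi/2-1/e}{2\pi}=\frac14-\frac1{2\pi e},$$ in the sense that, with $\nu_n(\varepsilon)=\#\{x:E_n(nx)=0,\ \operatorname{dist}(x,BC)<\varepsilon\}$, $$\lim_{\varepsilon\to0^+}\limsup_{n\to\infty}\frac{\nu_n(\varepsilon)}{n}=\lim_{\varepsilon\to0^+}\liminf_{n\to\infty}\frac{\nu_n(\varepsilon)}{n}=\frac14-\frac1{2\pi e}.$$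
   Context: The Euler polynomials $E_n(x)$ are defined by $\dfrac{2e^{\xi x}}{e^{\xi}+1}=\sum_{n\ge 0}E_n(x)\dfrac{\xi^n}{n!}$; $E_n(nx)$ is regarded as a polynomial in $x$ of degree $n$. Zeros are counted with multiplicity. $\arg$ is the principal argument, and $\operatorname{dist}(x,BC)$ is the Euclidean distance from $x$ to the set $BC$. *)

theory Defs
  imports "HOL-Analysis.Analysis"
begin

text \<open>
  \<open>n!\<close> times the \<open>n\<close>-th coefficient in \<open>\<xi>\<close> of \<open>2 e^(\<xi> x) / (e^\<xi> + 1)\<close>, a formal power
  series over the polynomial ring in \<open>x\<close>: the first factor below is \<open>e^(\<xi> x)\<close>, the second is
  \<open>2 / (e^\<xi> + 1)\<close> with its scalar coefficients embedded as constant polynomials.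
\<close>

definition euler_poly :: "nat \<Rightarrow> complex poly" where
  "euler_poly n = smult (fact n)
     (fps_nth (Abs_fps (\<lambda>k. monom (1 / fact k) k) *
               Abs_fps (\<lambda>k. [: fps_nth (2 / (fps_exp 1 + 1) :: complex fps) k :])) n)"

lemma poly_euler_poly:
  "poly (euler_poly n) x = fact n * fps_nth (2 * fps_exp x / (fps_exp 1 + 1)) n"
proof -
  have nz: "fps_nth (fps_exp 1 + 1 :: complex fps) 0 \<noteq> 0"
    by simp
  have "2 * fps_exp x / (fps_exp 1 + 1) = fps_exp x * (2 / (fps_exp 1 + 1))"
    using nz by (simp add: fps_divide_unit mult_ac)
  thus ?thesis
    by (simp add: euler_poly_def fps_mult_nth poly_sum poly_monom mult_ac)
qed

lemma euler_poly_generating_function: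
  "Abs_fps (\<lambda>n. poly (euler_poly n) x / fact n) = 2 * fps_exp x / (fps_exp 1 + 1)"
  by (simp add: fps_eq_iff poly_euler_poly)

lemma coeff_euler_poly_top: "coeff (euler_poly n) n = 1"
proof -
  let ?g = "\<lambda>k. fps_nth (2 / (fps_exp 1 + 1) :: complex fps) k"
  have g0: "?g 0 = 1"
    by (simp add: fps_divide_unit)
  have "coeff (euler_poly n) n
      = fact n * (\<Sum>i=0..n. coeff (monom (1 / fact i) i * [: ?g (n - i) :]) n)"
    by (simp add: euler_poly_def fps_mult_nth coeff_sum)
  also have "(\<Sum>i=0..n. coeff (monom (1 / fact i) i * [: ?g (n - i) :]) n)
      = (\<Sum>i=0..n. if i = n then 1 / fact n else 0)"
    using g0 by (intro sum.cong) auto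
  finally show ?thesis
    by simp
qed

lemma degree_euler_poly: "degree (euler_poly n) = n"
proof (rule antisym)
  have "degree (monom (1 / fact i) i * [: c :]) \<le> n" if "i \<le> n" for i and c :: complex
    using that by (auto intro: order_trans[OF degree_smult_le] order_trans[OF degree_monom_le])
  thus "degree (euler_poly n) \<le> n"
    unfolding euler_poly_def fps_mult_nth
    by (intro order_trans[OF degree_smult_le] degree_sum_le) auto
  show "n \<le> degree (euler_poly n)"
    by (rule le_degree) (simp add: coeff_euler_poly_top)
qed

definition euler_poly_scaled :: "nat \<Rightarrow> complex poly" where
  "euler_poly_scaled n = pcompose (euler_poly n) [:0, of_nat n:]"

lemma poly_euler_poly_scaled:
  "poly (euler_poly_scaled n) x = poly (euler_poly n) (of_nat n * x)"
  by (simp add: euler_poly_scaled_def poly_pcompose mult.commute)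

lemma degree_euler_poly_scaled: "degree (euler_poly_scaled n) = n"
  by (cases "n = 0") (auto simp: euler_poly_scaled_def degree_pcompose degree_euler_poly)

lemma euler_poly_scaled_nonzero: "euler_poly_scaled n \<noteq> 0"
proof (cases "n = 0")
  case True
  have "poly (euler_poly_scaled n) 0 = 1"
    unfolding True poly_euler_poly_scaled
    using coeff_euler_poly_top[of 0] by (simp add: poly_0_coeff_0)
  thus ?thesis
    by auto
next
  case False
  thus ?thesis
    using degree_euler_poly_scaled[of n] by auto
qed

definition zeta_map :: "complex \<Rightarrow> complex" where
  "zeta_map x = (let z = of_real pi * \<i> * x in z * exp (1 - z))"

definition BC :: "complex set" where
  "BC = {x. norm x \<le> 1 / pi \<and> Im x \<le> 0 \<and> Re x \<ge> 0 \<and> norm (zeta_map x) = 1}"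

text \<open>The number of zeros of \<open>E\<^sub>n(nx)\<close> satisfying \<open>P\<close>, counted with multiplicity.\<close>

definition zero_count :: "nat \<Rightarrow> (complex \<Rightarrow> bool) \<Rightarrow> nat" where
  "zero_count n P = size (filter_mset P (proots (euler_poly_scaled n)))"

end

theory Submission
  imports Defs "HOL-Complex_Analysis.Complex_Analysis" "HOL-Real_Asymp.Real_Asymp"
    "HOL-Computational_Algebra.Fundamental_Theorem_Algebra"
begin

text \<open>
  Splitting off the poles \<open>\<plusminus>\<pi>\<i>\<close> of \<open>2 / (e^\<xi> + 1)\<close> writes \<open>E\<^sub>n(nx)\<close> through the exponentials
  \<open>e^(nz)\<close>, \<open>e^(-nz)\<close> (with \<open>z = \<pi>\<i>x\<close>), tails of the exponential series and a power series converging
  for \<open>\<bar>\<xi>\<bar> < 3\<pi>\<close>. By dominated convergence, for \<open>1/e < \<bar>z\<bar> < 1\<close> and \<open>Re z > 0\<close>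
  vanishing means \<open>1 + c\<^sub>n \<zeta>^n H\<^sub>n = 0\<close> with \<open>c\<^sub>n^(1/n) \<longlonglongrightarrow> 1\<close> and \<open>H\<^sub>n\<close> tending to a zero-free limit.
  In the coordinate \<open>u = ln z\<close>, where \<open>\<zeta> = exp (u + 1 - e^u)\<close>, the zeros therefore solve
  \<open>L\<^sub>n u = \<i>\<phi>\<close> with \<open>e^(\<i>n\<phi>) = -1\<close> and \<open>L\<^sub>n\<close> tending to \<open>u + 1 - e^u\<close>, and Hurwitz' theorem supplies
  one zero near the curve for every such \<open>\<phi>\<close>.

  Only lower bounds are needed: applied to \<open>BC\<close>, to its three mirror images and, through sign
  changes, to the real segment \<open>\<bar>x\<bar> < 1/(\<pi>e)\<close>, they give fractions of the \<open>n\<close> zeros adding up to \<open>1\<close>,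
  so each of them is attained and no other set can carry a positive fraction.
\<close>

subsection \<open>Removing the two nearest poles\<close>

text \<open>Two poles suffice because \<open>e < 3\<close>: the remaining series is evaluated at
  \<open>1/x = \<pi>\<i>/z\<close>, and \<open>\<bar>z\<bar> > 1/e\<close> puts this point inside
  the circle of radius \<open>\<pi>e < 3\<pi>\<close>, which the next poles do not reach. At the
  ends of the arc the approximation degenerates: at \<open>z = 1\<close> (the point B) the
  derivative of \<open>u + 1 - e^u\<close> vanishes and the tails blow up, and at
  \<open>z = \<i>/e\<close> (the point C) the exponential of the second pole is no longer
  negligible. Hence phases are cut off by some \<open>\<eta>\<close> at both ends, at the cost of a
  fraction O(\<open>\<eta>\<close>) of the zeros. A neighbourhood of the arc, however small, also
  meets the adjoining mirror arcs and the real segment. In the sector count their zeros are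
  recognised by the value of \<open>arg \<zeta>\<close>, so the limit holds for each fixed small
  \<open>\<epsilon>\<close>; in the plain count they disappear only as \<open>\<epsilon>\<close>
  tends to 0. The lower bounds count distinct zeros while the total \<open>n\<close> counts
  multiplicity, which settles multiplicities at the same time.\<close>

lemma exp_plus_one_zero_iff:
  "exp z + 1 = (0::complex) \<longleftrightarrow> (\<exists>k::int. z = of_real ((2 * of_int k + 1) * pi) * \<i>)"
proof -
  have "exp z + 1 = 0 \<longleftrightarrow> exp z = exp (of_real pi * \<i>)"
    by (simp add: eq_neg_iff_add_eq_0[symmetric])
  also have "\<dots> \<longleftrightarrow> (\<exists>k::int. z = of_real ((2 * of_int k + 1) * pi) * \<i>)"
    by (subst exp_eq) (auto simp: algebra_simps)
  finally show ?thesis .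
qed

lemma exp_plus_one_nonzero:
  fixes z :: complex
  assumes "norm z < 3 * pi" "z \<noteq> of_real pi * \<i>" "z \<noteq> - (of_real pi * \<i>)"
  shows "exp z + 1 \<noteq> 0"
proof
  assume "exp z + 1 = 0"
  then obtain k :: int where k: "z = of_real ((2 * of_int k + 1) * pi) * \<i>"
    using exp_plus_one_zero_iff by blast
  have "norm z = \<bar>2 * of_int k + 1\<bar> * pi"
    unfolding k by (simp add: norm_mult abs_mult del: of_real_mult of_real_add)
  with assms(1) have "\<bar>2 * of_int k + 1\<bar> < (3::real)"
    by (metis mult_less_cancel_right_pos pi_gt_zero)
  hence "\<bar>2 * k + 1\<bar> < 3" by linarith
  hence "k = 0 \<or> k = -1" by presburger
  thus False using k assms(2,3) by auto
qed

text \<open>The residue of \<open>2 / (e^\<xi> + 1)\<close> at either pole \<open>a\<close> is -2,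
  so the principal parts are \<open>2 / (a - \<xi>)\<close>; the two subtracted series are their
  expansions at 0.\<close>

definition euler_remainder :: "complex fps" where
  "euler_remainder = 2 / (fps_exp 1 + 1)
     - Abs_fps (\<lambda>k. 2 / (of_real pi * \<i>) ^ Suc k) - Abs_fps (\<lambda>k. 2 / (- (of_real pi * \<i>)) ^ Suc k)"

lemma has_fps_expansion_simple_pole:
  fixes a :: complex
  assumes "a \<noteq> 0"
  shows "(\<lambda>z. 2 / (a - z)) has_fps_expansion Abs_fps (\<lambda>k. 2 / a ^ Suc k)"
proof -
  have "Abs_fps (\<lambda>k. 2 / a ^ Suc k) * (fps_const a - fps_X) = 2"
  proof (rule fps_ext)
    fix n show "fps_nth (Abs_fps (\<lambda>k. 2 / a ^ Suc k) * (fps_const a - fps_X)) n = fps_nth 2 n"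
      using assms by (cases n) (simp_all add: algebra_simps fps_numeral_nth)
  qed
  hence "Abs_fps (\<lambda>k. 2 / a ^ Suc k) = 2 / (fps_const a - fps_X)"
  proof -
    have "fps_nth (fps_const a - fps_X) 0 \<noteq> 0" using assms by simp
    hence "fps_const a - fps_X \<noteq> 0" by (metis fps_zero_nth)
    thus ?thesis by (metis nonzero_mult_div_cancel_right \<open>_ * _ = 2\<close>)
  qed
  moreover have "(\<lambda>z. 2 / (a - z)) has_fps_expansion 2 / (fps_const a - fps_X)"
    using assms by (intro fps_expansion_intros) auto
  ultimately show ?thesis by simp
qed

text \<open>All singularities are removed by divided differences: \<open>N2\<close> is
  \<open>e^z + 1\<close> with both zeros divided out, zero-free on the disc, and \<open>G\<close> is
  the remainder itself, obtained by dividing \<open>Q\<close> by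
  \<open>(z - a) (z + a)\<close>.\<close>

lemma euler_remainder:
  shows conv_radius_euler_remainder: "fps_conv_radius euler_remainder \<ge> ereal (3 * pi)"
    and eval_euler_remainder:
      "\<And>z. norm z < 3 * pi \<Longrightarrow> z \<noteq> of_real pi * \<i> \<Longrightarrow> z \<noteq> - (of_real pi * \<i>) \<Longrightarrow>
         eval_fps euler_remainder z
           = 2 / (exp z + 1) - 2 / (of_real pi * \<i> - z) - 2 / (- (of_real pi * \<i>) - z)"
proof -
  define a :: complex where "a = of_real pi * \<i>"
  define S where "S = ball (0::complex) (3 * pi)"
  define N where "N = (\<lambda>z::complex. exp z + 1)"
  define N1 where "N1 = (\<lambda>z. if z = a then deriv N a else (N z - N a) / (z - a))"
  define N2 where "N2 = (\<lambda>z. if z = -a then deriv N1 (-a) else (N1 z - N1 (-a)) / (z - (-a)))"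
  \<comment> \<open>The principal parts add up to \<open>-4z / ((z - a) (z + a))\<close>, so
    \<open>Q\<close> is the numerator of the remainder over this common denominator. It vanishes at
    both poles since \<open>2 / N2\<close> equals \<open>-4a\<close> at \<open>a\<close> and
    \<open>4a\<close> at \<open>-a\<close>.\<close>
  define Q where "Q = (\<lambda>z. 2 / N2 z + 4 * z)"
  define Q1 where "Q1 = (\<lambda>z. if z = a then deriv Q a else (Q z - Q a) / (z - a))"
  define G where "G = (\<lambda>z. if z = -a then deriv Q1 (-a) else (Q1 z - Q1 (-a)) / (z - (-a)))"
  have a0: "a \<noteq> 0" "a \<noteq> -a" by (auto simp: a_def complex_eq_iff)
  have aS: "a \<in> S" "-a \<in> S" "open S" by (auto simp: a_def S_def norm_mult)
  have dN: "(N has_field_derivative exp z) (at z)" for z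
    unfolding N_def by (auto intro!: derivative_eq_intros)
  have Na: "N a = 0" "N (-a) = 0"
    by (simp_all add: N_def a_def exp_minus)
  have dNa: "deriv N a = -1" "(N has_field_derivative -1) (at (-a))"
    using dN[of a, THEN DERIV_imp_deriv] dN[of "-a"] Na
    by (simp_all add: N_def eq_neg_iff_add_eq_0[symmetric])
  have hN: "N holomorphic_on S" unfolding N_def by (intro holomorphic_intros)
  have hN1: "N1 holomorphic_on S" unfolding N1_def by (intro pole_lemma_open hN aS)
  hence hN2: "N2 holomorphic_on S" unfolding N2_def by (intro pole_lemma_open aS)
  have N1a: "N1 (-a) = 0" using Na a0 by (simp add: N1_def)
  have dN1: "(N1 has_field_derivative 1 / (2 * a)) (at (-a))"
  proof -
    have "((\<lambda>z. N z / (z - a)) has_field_derivative 1 / (2 * a)) (at (-a))"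
      using dNa(2) a0 Na by (auto intro!: derivative_eq_intros simp: field_simps)
    thus ?thesis
      by (rule has_field_derivative_transform_within_open[of _ _ _ "- {a}"])
         (use a0 Na in \<open>auto simp: N1_def\<close>)
  qed
  have N2: "N z = N2 z * (z - a) * (z + a)" for z
    using N1a Na a0 by (auto simp: N2_def N1_def eq_neg_iff_add_eq_0[symmetric])
  have N2a: "N2 a = - 1 / (2 * a)" "N2 (-a) = 1 / (2 * a)"
    using DERIV_imp_deriv[OF dN1] a0 N1a dNa(1) by (auto simp: N2_def N1_def)
  have N2nz: "N2 z \<noteq> 0" if "z \<in> S" for z
  proof (cases "z = a \<or> z = -a")
    case True thus ?thesis using N2a a0 by auto
  next
    case False
    hence "N z \<noteq> 0" unfolding N_def
      using that by (intro exp_plus_one_nonzero) (auto simp: S_def a_def)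
    thus ?thesis using N2[of z] by auto
  qed
  have hQ: "Q holomorphic_on S" unfolding Q_def using N2nz
    by (intro holomorphic_intros hN2) auto
  have hQ1: "Q1 holomorphic_on S" unfolding Q1_def by (intro pole_lemma_open hQ aS)
  hence hG: "G holomorphic_on S" unfolding G_def by (intro pole_lemma_open aS)
  have Qa: "Q a = 0" "Q (-a) = 0" using N2a a0 by (auto simp: Q_def)
  hence Q1a: "Q1 (-a) = 0" using a0 by (simp add: Q1_def)
  have Geq: "G z = 2 / N z - 2 / (a - z) - 2 / (- a - z)" if "z \<noteq> a" "z \<noteq> -a" "z \<in> S" for z
  proof -
    have nz: "z - a \<noteq> 0" "z + a \<noteq> 0" "N2 z \<noteq> 0" "a - z \<noteq> 0" "-a-z \<noteq> 0"
      using that N2nz by (auto simp: add_eq_0_iff)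
    have "G z = Q z / ((z - a) * (z + a))"
      using that Qa Q1a by (simp add: G_def Q1_def)
    also have "\<dots> = 2 / N z + 4 * z / ((z - a) * (z + a))"
      using nz by (simp add: Q_def N2 add_divide_distrib)
    also have "4 * z / ((z - a) * (z + a)) = 2 / (z - a) + 2 / (z + a)"
      using nz by (simp add: field_simps)
    also have "\<dots> = - 2 / (a - z) - 2 / (- a - z)"
    proof -
      have "2 / (z - a) = - 2 / (a - z)"
        using nz by (simp add: divide_simps)
      moreover have "2 / (z + a) = - (2 / (- a - z))"
        using nz by (simp add: divide_simps)
      ultimately show ?thesis by simp
    qed
    finally show ?thesis by simp
  qed
  have "(\<lambda>z. 2 / N z - 2 / (a - z) - 2 / (- a - z)) has_fps_expansion euler_remainder"
    unfolding euler_remainder_def a_def[symmetric] N_def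
    by (intro fps_expansion_intros has_fps_expansion_simple_pole)
       (use a0 in auto)
  moreover have "eventually (\<lambda>z. 2 / N z - 2 / (a - z) - 2 / (- a - z) = G z) (nhds 0)"
  proof -
    have "eventually (\<lambda>z. z \<in> S - {a, -a}) (nhds 0)"
      using a0 by (intro eventually_nhds_in_open) (auto simp: S_def)
    thus ?thesis by eventually_elim (use Geq in auto)
  qed
  ultimately have exG: "G has_fps_expansion euler_remainder"
    by (subst (asm) has_fps_expansion_cong) auto
  hence eq: "fps_expansion G 0 = euler_remainder"
    by (rule fps_expansion_eqI)
  have hG': "G holomorphic_on eball 0 (ereal (3 * pi))"
    using hG by (simp add: S_def)
  show "fps_conv_radius euler_remainder \<ge> ereal (3 * pi)"
    using conv_radius_fps_expansion[OF hG'] eq by simp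
  fix z :: complex
  assume z: "norm z < 3 * pi" "z \<noteq> of_real pi * \<i>" "z \<noteq> - (of_real pi * \<i>)"
  have "eval_fps (fps_expansion G 0) z = G (0 + z)"
    by (rule eval_fps_expansion'[OF hG']) (use z in auto)
  thus "eval_fps euler_remainder z
           = 2 / (exp z + 1) - 2 / (of_real pi * \<i> - z) - 2 / (- (of_real pi * \<i>) - z)"
    using Geq[of z] z eq by (simp add: a_def S_def N_def)
qed

definition exp_tail :: "nat \<Rightarrow> complex \<Rightarrow> complex" where
  "exp_tail n w = exp w - (\<Sum>k\<le>n. w ^ k / fact k)"

text \<open>In the Cauchy product with \<open>e^(\<xi> y)\<close>, \<open>y = n x\<close>, a pole at
  \<open>b\<close> contributes a multiple of the truncated exponential sum of \<open>b y\<close>,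
  that is, \<open>exp (b y)\<close> minus its tail. The pole \<open>-a\<close> differs from
  \<open>a\<close> by the sign \<open>(-1)^(n+1)\<close>.\<close>

lemma poly_euler_decomposition:
  fixes n :: nat and x :: complex
  defines "a \<equiv> of_real pi * \<i>"
  defines "z \<equiv> a * x"
  shows "poly (euler_poly_scaled n) x / fact n * a ^ Suc n / 2
       = exp (of_nat n * z) + (-1) ^ Suc n * exp (- (of_nat n * z))
         - exp_tail n (of_nat n * z) - (-1) ^ Suc n * exp_tail n (- (of_nat n * z))
         + a ^ Suc n / 2 * (\<Sum>k\<le>n. fps_nth euler_remainder k * (of_nat n * x) ^ (n - k) / fact (n - k))"
proof -
  define y where "y = of_nat n * x"
  have a0: "a \<noteq> 0" by (simp add: a_def)
  let ?D = "2 / (fps_exp 1 + 1) :: complex fps"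
  have D: "fps_nth ?D k = fps_nth euler_remainder k + 2 / a ^ Suc k + 2 / (-a) ^ Suc k" for k
    by (simp add: euler_remainder_def a_def)
  have pole: "(\<Sum>k\<le>n. 2 / b ^ Suc k * (y ^ (n - k) / fact (n - k)))
      = 2 / b ^ Suc n * (exp (b * y) - exp_tail n (b * y))" if "b \<noteq> 0" for b
  proof -
    have "(\<Sum>k\<le>n. 2 / b ^ Suc k * (y ^ (n - k) / fact (n - k)))
        = (\<Sum>k\<le>n. 2 / b ^ Suc (n - k) * (y ^ k / fact k))"
      by (rule sum.reindex_bij_witness[of _ "\<lambda>k. n - k" "\<lambda>k. n - k"]) auto
    also have "\<dots> = (\<Sum>k\<le>n. 2 / b ^ Suc n * ((b * y) ^ k / fact k))"
    proof (rule sum.cong, goal_cases)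
      case (2 k)
      hence "b ^ Suc n = b ^ Suc (n - k) * b ^ k"
        by (simp flip: power_add)
      thus ?case using that by (simp add: power_mult_distrib field_simps)
    qed auto
    also have "\<dots> = 2 / b ^ Suc n * (exp (b * y) - exp_tail n (b * y))"
      by (simp add: exp_tail_def sum_distrib_left)
    finally show ?thesis .
  qed
  have nz: "fps_nth (fps_exp 1 + 1 :: complex fps) 0 \<noteq> 0" by simp
  have "2 * fps_exp y / (fps_exp 1 + 1) = ?D * fps_exp y"
    using nz by (simp add: fps_divide_unit mult_ac)
  hence "poly (euler_poly_scaled n) x / fact n = fps_nth (?D * fps_exp y) n"
    by (simp add: poly_euler_poly_scaled poly_euler_poly y_def)
  also have "\<dots> = (\<Sum>k\<le>n. fps_nth ?D k * (y ^ (n - k) / fact (n - k)))"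
    by (simp add: fps_mult_nth atMost_atLeast0)
  also have "\<dots> = (\<Sum>k\<le>n. fps_nth euler_remainder k * (y ^ (n - k) / fact (n - k)))
      + 2 / a ^ Suc n * (exp (a * y) - exp_tail n (a * y))
      + 2 / (-a) ^ Suc n * (exp (-a * y) - exp_tail n (-a * y))"
    unfolding D distrib_right sum.distrib using pole[of a] pole[of "-a"] a0 by simp
  finally have E: "poly (euler_poly_scaled n) x / fact n = \<dots>" .
  have sg: "2 / (-a) ^ Suc n = (-1) ^ Suc n * (2 / a ^ Suc n)"
    by (cases "even n") (simp_all add: power_minus_odd power_minus_even)
  have "poly (euler_poly_scaled n) x / fact n * a ^ Suc n / 2
     = a ^ Suc n / 2 * (\<Sum>k\<le>n. fps_nth euler_remainder k * (y ^ (n - k) / fact (n - k)))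
      + (exp (a * y) - exp_tail n (a * y))
      + (-1) ^ Suc n * (exp (-a * y) - exp_tail n (-a * y))"
    unfolding E sg using a0 by (simp add: field_simps)
  also have "a * y = of_nat n * z"
    by (simp add: y_def z_def)
  also have "- a * y = - (of_nat n * z)"
    by (simp add: y_def z_def)
  finally show ?thesis
    by (simp add: algebra_simps y_def)
qed

section \<open>Term ratios of the exponential series and dominated convergence\<close>

definition rise_ratio :: "nat \<Rightarrow> nat \<Rightarrow> real" where
  "rise_ratio n j = (\<Prod>i<j. real n / real (n + i + 1))"

text \<open>\<open>rise_ratio\<close> and \<open>fall_ratio\<close> compare the terms of index
  \<open>n + j\<close> and \<open>n - k\<close> in the series of \<open>e^n\<close> with the
  \<open>n\<close>-th one; near that index the terms are almost equal. The truncated subtraction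
  makes \<open>fall_ratio n k\<close> vanish for \<open>k > n\<close>, so that a sum over
  \<open>k \<le> n\<close> becomes an infinite series.\<close>

definition fall_ratio :: "nat \<Rightarrow> nat \<Rightarrow> real" where
  "fall_ratio n k = (\<Prod>i<k. real (n - i) / real n)"

lemma rise_ratio_bounds: "0 \<le> rise_ratio n j" "rise_ratio n j \<le> 1"
  unfolding rise_ratio_def by (auto intro!: prod_nonneg prod_le_1)

lemma fall_ratio_bounds: "0 \<le> fall_ratio n k" "fall_ratio n k \<le> 1"
  unfolding fall_ratio_def by (auto intro!: prod_nonneg prod_le_1 simp: divide_simps)

lemma rise_ratio_tendsto: "(\<lambda>n. rise_ratio n j) \<longlonglongrightarrow> 1"
proof -
  have "(\<lambda>n. \<Prod>i<j. real n / real (n + i + 1)) \<longlonglongrightarrow> (\<Prod>i<j. 1)"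
  proof (rule tendsto_prod)
    fix i show "(\<lambda>n. real n / real (n + i + 1)) \<longlonglongrightarrow> 1" by real_asymp
  qed
  thus ?thesis by (simp add: rise_ratio_def)
qed

lemma fall_ratio_tendsto: "(\<lambda>n. fall_ratio n k) \<longlonglongrightarrow> 1"
proof -
  have "(\<lambda>n. \<Prod>i<k. real (n - i) / real n) \<longlonglongrightarrow> (\<Prod>i<k. 1)"
  proof (rule tendsto_prod)
    fix i
    have "(\<lambda>n. (real n - real i) / real n) \<longlonglongrightarrow> 1" by real_asymp
    moreover have "eventually (\<lambda>n. (real n - real i) / real n = real (n - i) / real n) sequentially"
      using eventually_ge_at_top[of i] by eventually_elim (simp add: of_nat_diff)
    ultimately show "(\<lambda>n. real (n - i) / real n) \<longlonglongrightarrow> 1"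
      by (rule Lim_transform_eventually)
  qed
  thus ?thesis by (simp add: fall_ratio_def)
qed

lemma rise_ratio_altdef: "rise_ratio n j = real n ^ j * fact n / fact (n + j)"
proof (induction j)
  case (Suc j)
  have "rise_ratio n (Suc j) = rise_ratio n j * (real n / real (n + j + 1))"
    by (simp add: rise_ratio_def)
  also have "\<dots> = real n ^ Suc j * fact n / (real (n + j + 1) * fact (n + j))"
    unfolding Suc by (simp add: mult_ac)
  also have "real (n + j + 1) * fact (n + j) = fact (n + Suc j)" by simp
  finally show ?case .
qed (simp add: rise_ratio_def)

lemma fall_ratio_altdef:
  assumes "k \<le> n"
  shows "fall_ratio n k = fact n / (fact (n - k) * real n ^ k)"
  using assms
proof (induction k)
  case (Suc k)
  have "fall_ratio n (Suc k) = fall_ratio n k * (real (n - k) / real n)"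
    by (simp add: fall_ratio_def)
  also have "fall_ratio n k = fact n / (fact (n - k) * real n ^ k)"
    using Suc by simp
  also have "n - k = Suc (n - Suc k)" using Suc by simp
  hence "(fact (n - k) :: real) = real (n - k) * fact (n - Suc k)"
    by (metis fact_Suc)
  finally show ?case using Suc.prems by simp
qed (simp add: fall_ratio_def)

lemma fall_ratio_eq_0: "k > n \<Longrightarrow> fall_ratio n k = 0"
  unfolding fall_ratio_def by (auto intro!: bexI[of _ n])

lemma tannery_tendsto_0:
  fixes f :: "nat \<Rightarrow> nat \<Rightarrow> real" and M :: "nat \<Rightarrow> real"
  assumes "\<And>k. (\<lambda>n. f n k) \<longlonglongrightarrow> 1" "\<And>n k. 0 \<le> f n k" "\<And>n k. f n k \<le> 1"
    and "summable M" "\<And>k. M k \<ge> 0"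
  shows "(\<lambda>n. \<Sum>k. M k * (1 - f n k)) \<longlonglongrightarrow> 0"
proof -
  have "((\<lambda>n. \<Sum>k. M k * (1 - f n k)) \<longlonglongrightarrow> (\<Sum>k. M k * (1 - 1)))"
  proof (rule tannerys_theorem[THEN conjunct2, THEN conjunct2])
    show "(\<lambda>n. M k * (1 - f n k)) \<longlonglongrightarrow> M k * (1 - 1)" for k
      by (intro tendsto_intros assms)
    have "norm (M k * (1 - f n k)) \<le> M k" for k n
      using assms(2)[of n k] assms(3)[of n k] assms(5)[of k]
      by (auto simp: abs_mult intro!: mult_left_le)
    thus "\<forall>\<^sub>F (k, n) in sequentially \<times>\<^sub>F sequentially. norm (M k * (1 - f n k)) \<le> M k"
      by (simp add: case_prod_unfold)
  qed (use assms in auto)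
  thus ?thesis by simp
qed

text \<open>The bound involves only the majorant \<open>M\<close>, not the coefficients. For power
  series majorised on a disc it is therefore uniform in the variable, and
  \<open>tannery_tendsto_0\<close> sends it to 0.\<close>

lemma weighted_series_error:
  fixes c :: "nat \<Rightarrow> complex"
  assumes "\<And>k. norm (c k) \<le> M k" "summable M" "\<And>k. 0 \<le> f k" "\<And>k. f k \<le> 1"
  shows "norm ((\<Sum>k. c k * of_real (f k)) - (\<Sum>k. c k)) \<le> (\<Sum>k. M k * (1 - f k))"
proof -
  have M: "M k \<ge> 0" for k using assms(1)[of k] norm_ge_zero order_trans by blast
  have s1: "summable c"
    by (rule summable_comparison_test'[OF assms(2)]) (use assms in auto)
  have s2: "summable (\<lambda>k. c k * of_real (f k))"
  proof (rule summable_comparison_test'[OF assms(2), of 0])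
    fix k show "norm (c k * of_real (f k)) \<le> M k"
      using assms(1,3,4)[of k] mult_left_le[of "f k" "norm (c k)"] by (simp add: norm_mult)
  qed
  have b: "norm (c k * of_real (f k) - c k) \<le> M k * (1 - f k)" for k
  proof -
    have "c k * of_real (f k) - c k = c k * of_real (f k - 1)" by (simp add: algebra_simps)
    also have "norm \<dots> = norm (c k) * (1 - f k)"
      using assms(4)[of k] by (simp add: norm_mult del: of_real_diff)
    finally show ?thesis using assms(1)[of k] assms(4)[of k] by (simp add: mult_right_mono)
  qed
  have s3: "summable (\<lambda>k. M k * (1 - f k))"
    by (rule summable_comparison_test'[OF assms(2), of 0])
       (use assms M in \<open>auto simp: abs_mult intro!: mult_left_le\<close>)
  have s4: "summable (\<lambda>k. norm (c k * of_real (f k) - c k))"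
    by (rule summable_comparison_test'[OF s3, of 0]) (use b in auto)
  have "(\<Sum>k. c k * of_real (f k)) - (\<Sum>k. c k) = (\<Sum>k. c k * of_real (f k) - c k)"
    by (rule suminf_diff[OF s2 s1])
  also have "norm \<dots> \<le> (\<Sum>k. norm (c k * of_real (f k) - c k))"
    by (rule summable_norm[OF s4])
  also have "\<dots> \<le> (\<Sum>k. M k * (1 - f k))"
    by (rule suminf_le[OF b s4 s3])
  finally show ?thesis .
qed

definition tail_series :: "nat \<Rightarrow> complex \<Rightarrow> complex" where
  "tail_series n z = (\<Sum>j. z ^ Suc j * of_real (rise_ratio n (Suc j)))"

lemma exp_tail_eq:
  "exp_tail n (of_nat n * z) = (of_nat n * z) ^ n / fact n * tail_series n z"
proof -
  let ?w = "of_nat n * z :: complex"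
  have eq: "?w ^ (n + m) / fact (n + m) = ?w ^ n / fact n * (z ^ m * of_real (rise_ratio n m))" for m
    by (simp add: rise_ratio_altdef power_add power_mult_distrib)
  have "(\<lambda>k. ?w ^ k / fact k) sums exp ?w"
    using exp_converges[of ?w] by (simp add: scaleR_conv_of_real field_simps)
  hence "(\<lambda>j. ?w ^ (j + Suc n) / fact (j + Suc n)) sums exp_tail n ?w"
    by (drule_tac sums_split_initial_segment[of _ _ "Suc n"])
       (simp add: exp_tail_def lessThan_Suc_atMost)
  hence "(\<lambda>j. ?w ^ (n + Suc j) / fact (n + Suc j)) sums exp_tail n ?w"
    by (simp add: add.commute)
  hence sums: "(\<lambda>j. ?w ^ n / fact n * (z ^ Suc j * of_real (rise_ratio n (Suc j)))) sums exp_tail n ?w"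
    unfolding eq .
  show ?thesis
  \<comment> \<open>A nonzero prefactor can be cancelled to give summability of
    \<open>tail_series\<close>; if it is zero, both sides are 0.\<close>
  proof (cases "?w ^ n / fact n = 0")
    case False
    hence "summable (\<lambda>j. z ^ Suc j * complex_of_real (rise_ratio n (Suc j)))"
      using sums_summable[OF sums] summable_cmult_iff[of "?w ^ n / fact n" "\<lambda>j. z ^ Suc j * complex_of_real (rise_ratio n (Suc j))"] by blast
    hence "(\<lambda>j. ?w ^ n / fact n * (z ^ Suc j * of_real (rise_ratio n (Suc j))))
             sums (?w ^ n / fact n * tail_series n z)"
      unfolding tail_series_def by (intro sums_mult summable_sums)
    with sums show ?thesis by (rule sums_unique2)
  next
    case True
    have "exp_tail n ?w = 0"
      using sums_unique2[OF sums[unfolded True mult_zero_left] sums_zero] .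
    thus ?thesis unfolding True mult_zero_left .
  qed
qed

lemma tail_series_approx:
  assumes "norm z \<le> r" "r < 1"
  shows "norm (tail_series n z - z / (1 - z)) \<le> (\<Sum>j. r ^ Suc j * (1 - rise_ratio n (Suc j)))"
proof -
  have r: "0 \<le> r" using assms(1) norm_ge_zero order_trans by blast
  have "(\<lambda>j. z ^ Suc j) sums (z * (1 / (1 - z)))"
    using geometric_sums[of z, THEN sums_mult, of z] assms by simp
  hence "z / (1 - z) = (\<Sum>j. z ^ Suc j)" by (simp add: sums_iff)
  moreover have "norm (z ^ Suc j) \<le> r ^ Suc j" for j
    unfolding norm_power using assms by (intro power_mono) auto
  moreover have "summable (\<lambda>j. r ^ Suc j)"
    using assms r by (auto simp: summable_geometric intro!: summable_mult)
  ultimately show ?thesis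
    unfolding tail_series_def 
    by (simp only:) (rule weighted_series_error, auto simp: rise_ratio_bounds)
qed

lemma tail_error_tendsto:
  assumes "0 \<le> r" "r < 1"
  shows "(\<lambda>n. \<Sum>j. r ^ Suc j * (1 - rise_ratio n (Suc j))) \<longlonglongrightarrow> 0"
  using assms
  by (intro tannery_tendsto_0)
     (auto simp: rise_ratio_bounds summable_geometric intro: rise_ratio_tendsto summable_mult)

lemma tail_series_bound:
  assumes "norm z < 1"
  shows "norm (tail_series n z) \<le> norm z / (1 - norm z)"
proof -
  have s: "(\<lambda>j. norm z ^ Suc j) sums (norm z * (1 / (1 - norm z)))"
    using geometric_sums[of "norm z", THEN sums_mult, of "norm z"] assms by simp
  have b: "norm (z ^ Suc j * of_real (rise_ratio n (Suc j))) \<le> norm z ^ Suc j" for j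
    using mult_left_le[of "rise_ratio n (Suc j)" "norm (z ^ Suc j)"] rise_ratio_bounds[of n "Suc j"]
    by (simp add: norm_mult norm_power)
  have "norm (tail_series n z) \<le> (\<Sum>j. norm z ^ Suc j)"
    unfolding tail_series_def
    by (intro norm_suminf_le b sums_summable[OF s])
  thus ?thesis using s by (simp add: sums_iff)
qed

text \<open>The point \<open>1 / x\<close> is the saddle point of
  \<open>e^(n x \<xi>) / \<xi>^n\<close>. Up to the weights \<open>fall_ratio\<close>, the
  coefficient extraction evaluates the power series there.\<close>

lemma remainder_sum_eq:
  assumes "x \<noteq> 0" "n > 0"
  shows "(\<Sum>k\<le>n. fps_nth F k * (of_nat n * x) ^ (n - k) / fact (n - k))
    = (of_nat n * x) ^ n / fact n * (\<Sum>k. fps_nth F k * (1 / x) ^ k * complex_of_real (fall_ratio n k))"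
proof -
  have "(\<Sum>k. fps_nth F k * (1 / x) ^ k * complex_of_real (fall_ratio n k))
     = (\<Sum>k\<le>n. fps_nth F k * (1 / x) ^ k * complex_of_real (fall_ratio n k))"
    by (rule suminf_finite) (auto simp: fall_ratio_eq_0)
  also have "(of_nat n * x) ^ n / fact n * \<dots> = 
     (\<Sum>k\<le>n. fps_nth F k * (of_nat n * x) ^ (n - k) / fact (n - k))"
    unfolding sum_distrib_left
  proof (intro sum.cong refl)
    fix k assume "k \<in> {..n}"
    hence "(of_nat n * x) ^ n = (of_nat n * x) ^ (n - k) * (of_nat n * x) ^ k"
      by (simp flip: power_add)
    thus "(of_nat n * x) ^ n / fact n * (fps_nth F k * (1 / x) ^ k * complex_of_real (fall_ratio n k))
      = fps_nth F k * (of_nat n * x) ^ (n - k) / fact (n - k)"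
      using \<open>k \<in> {..n}\<close> assms
      by (simp add: fall_ratio_altdef power_mult_distrib) (simp add: field_simps)
  qed
  finally show ?thesis by simp
qed

lemma remainder_coeffs_summable:
  assumes "0 \<le> R" "R < 3 * pi"
  shows "summable (\<lambda>k. norm (fps_nth euler_remainder k) * R ^ k)"
proof -
  have "ereal (norm (complex_of_real R)) < fps_conv_radius euler_remainder"
    by (rule less_le_trans[OF _ conv_radius_euler_remainder]) (use assms in auto)
  hence "summable (\<lambda>n. norm (fps_nth euler_remainder n * complex_of_real R ^ n))"
    unfolding fps_conv_radius_def by (rule abs_summable_in_conv_radius)
  thus ?thesis using assms by (simp add: norm_mult norm_power)
qed

lemma remainder_series_approx:
  assumes "norm w \<le> R" "R < 3 * pi"
  shows "norm ((\<Sum>k. fps_nth euler_remainder k * w ^ k * complex_of_real (fall_ratio n k))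
            - eval_fps euler_remainder w)
          \<le> (\<Sum>k. norm (fps_nth euler_remainder k) * R ^ k * (1 - fall_ratio n k))"
  unfolding eval_fps_def
proof (rule weighted_series_error)
  have R: "0 \<le> R" using assms(1) norm_ge_zero order_trans by blast
  show "summable (\<lambda>k. norm (fps_nth euler_remainder k) * R ^ k)"
    using remainder_coeffs_summable assms R by blast
  show "norm (fps_nth euler_remainder k * w ^ k) \<le> norm (fps_nth euler_remainder k) * R ^ k" for k
    using assms R by (auto simp: norm_mult norm_power intro!: mult_left_mono power_mono)
qed (auto simp: fall_ratio_bounds)

lemma remainder_error_tendsto:
  assumes "0 \<le> R" "R < 3 * pi"
  shows "(\<lambda>n. \<Sum>k. norm (fps_nth euler_remainder k) * R ^ k * (1 - fall_ratio n k)) \<longlonglongrightarrow> 0"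
  using assms
  by (intro tannery_tendsto_0 remainder_coeffs_summable)
     (auto simp: fall_ratio_bounds intro: fall_ratio_tendsto)

text \<open>\<open>z = \<pi>\<i>x\<close>: \<open>E\<^sub>n(nx)\<close> normalised so that the pole \<open>\<pi>\<i>\<close> of the generating function
  contributes \<open>exp (n z)\<close>.\<close>
definition euler_norm :: "nat \<Rightarrow> complex \<Rightarrow> complex" where
  "euler_norm n z = poly (euler_poly_scaled n) (z / (of_real pi * \<i>)) / fact n
      * (of_real pi * \<i>) ^ Suc n / 2"

text \<open>The contribution of the saddle point: what is left of \<open>euler_norm\<close> without
  its two exponentials, in units of \<open>(n z)^n / n!\<close>, the \<open>n\<close>-th term of the
  series of \<open>exp (n z)\<close>.\<close>

definition saddle_coeff :: "nat \<Rightarrow> complex \<Rightarrow> complex" where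
  "saddle_coeff n z = fact n / (of_nat n * z) ^ n
      * (euler_norm n z - exp (of_nat n * z) - (-1) ^ Suc n * exp (- (of_nat n * z)))"

text \<open>The tails tend to geometric series, and these are precisely the principal parts that
  \<open>euler_remainder\<close> lacks, evaluated at \<open>w = \<pi>\<i>/z\<close>. In the limit
  they restore the full generating function at \<open>w\<close>. The bound
  \<open>pi / R \<le> norm z\<close> keeps \<open>w\<close> in the disc of convergence,
  \<open>norm z \<le> r < 1\<close> serves the geometric series.\<close>

lemma saddle_coeff_approx:
  assumes "0 \<le> r" "r < 1" "0 \<le> R" "R < 3 * pi" "pi < R"
  obtains err :: "nat \<Rightarrow> real" where "err \<longlonglongrightarrow> 0"
    "\<And>n z. n > 0 \<Longrightarrow> pi / R \<le> norm z \<Longrightarrow> norm z \<le> r \<Longrightarrow>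
       norm (saddle_coeff n z - of_real pi * \<i> / (exp (of_real pi * \<i> / z) + 1)) \<le> err n"
proof -
  define a :: complex where "a = of_real pi * \<i>"
  define e1 where "e1 = (\<lambda>n. \<Sum>j. r ^ Suc j * (1 - rise_ratio n (Suc j)))"
  define e2 where "e2 = (\<lambda>n. \<Sum>k. norm (fps_nth euler_remainder k) * R ^ k * (1 - fall_ratio n k))"
  have a0: "a \<noteq> 0" "norm a = pi" by (auto simp: a_def norm_mult)
  have lim: "(\<lambda>n. 2 * e1 n + pi / 2 * e2 n) \<longlonglongrightarrow> 2 * 0 + pi / 2 * 0"
    unfolding e1_def e2_def
    by (intro tendsto_intros tail_error_tendsto remainder_error_tendsto assms)
  show ?thesis
  proof (rule that[of "\<lambda>n. 2 * e1 n + pi / 2 * e2 n"])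
    show "(\<lambda>n. 2 * e1 n + pi / 2 * e2 n) \<longlonglongrightarrow> 0" using lim by simp
    fix n :: nat and z :: complex
    assume n: "n > 0" and z: "pi / R \<le> norm z" "norm z \<le> r"
    have R: "R > 0" using assms pi_gt_zero by linarith
    have "pi / R > 0" using R by simp
    hence nz: "norm z > 0" using z by linarith
    hence z0: "z \<noteq> 0" by auto
    \<comment> \<open>This is \<open>1 / x\<close>; because of \<open>\<bar>z\<bar> < 1\<close> it
      lies outside the circle through the two poles.\<close>
    define w where "w = a / z"
    have nw: "norm w \<le> R" using z nz R by (simp add: w_def norm_divide a0 field_simps)
    have "norm w = pi / norm z" by (simp add: w_def norm_divide a0)
    also have "\<dots> > pi" using z assms nz by (simp add: field_simps)
    finally have w1: "w \<noteq> a" "w \<noteq> -a" using a0 by auto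
    have en: "exp w + 1 \<noteq> 0"
      using exp_plus_one_nonzero[of w] nw assms w1 by (auto simp: a_def)
    define G where "G = (\<Sum>k. fps_nth euler_remainder k * w ^ k * complex_of_real (fall_ratio n k))"
    have "euler_norm n z = exp (of_nat n * z) + (-1) ^ Suc n * exp (- (of_nat n * z))
         - exp_tail n (of_nat n * z) - (-1) ^ Suc n * exp_tail n (- (of_nat n * z))
         + a ^ Suc n / 2 * (\<Sum>k\<le>n. fps_nth euler_remainder k * (of_nat n * (z / a)) ^ (n - k) / fact (n - k))"
      using poly_euler_decomposition[of n "z / a"] a0 
      by (simp add: euler_norm_def a_def)
    also have "- (of_nat n * z) = of_nat n * (- z)" by simp
    also have "(\<Sum>k\<le>n. fps_nth euler_remainder k * (of_nat n * (z / a)) ^ (n - k) / fact (n - k))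
        = (of_nat n * (z / a)) ^ n / fact n * G"
      using z0 a0 n by (subst remainder_sum_eq) (auto simp: G_def w_def)
    finally have E: "euler_norm n z = exp (of_nat n * z) + (-1) ^ Suc n * exp (of_nat n * (-z))
         - (of_nat n * z) ^ n / fact n * tail_series n z
         - (-1) ^ Suc n * ((of_nat n * (-z)) ^ n / fact n * tail_series n (-z))
         + a ^ Suc n / 2 * ((of_nat n * (z / a)) ^ n / fact n * G)"
      unfolding exp_tail_eq .
    \<comment> \<open>The sign of the second pole combines with \<open>(-z)^n\<close>, so the parity
      of \<open>n\<close> drops out.\<close>
    have p1: "(-1) ^ Suc n * ((of_nat n * (-z)) ^ n / fact n * tail_series n (-z))
       = - ((of_nat n * z) ^ n / fact n * tail_series n (-z))"
      by (cases "even n") simp_all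
    have p2: "a ^ Suc n / 2 * ((of_nat n * (z / a)) ^ n / fact n * G)
       = (of_nat n * z) ^ n / fact n * (a / 2 * G)"
      using a0 by (simp add: power_mult_distrib power_divide mult_ac)
    have "saddle_coeff n z = fact n / (of_nat n * z) ^ n *
       ((of_nat n * z) ^ n / fact n * (- tail_series n z + tail_series n (-z) + a / 2 * G))"
      unfolding saddle_coeff_def E p1 p2 by (simp add: algebra_simps)
    also have "\<dots> = - tail_series n z + tail_series n (-z) + a / 2 * G"
      using z0 n by simp
    finally have S: "saddle_coeff n z = - tail_series n z + tail_series n (-z) + a / 2 * G" .
    have z1: "1 - z \<noteq> 0" "1 + z \<noteq> 0"
      using z assms by (auto simp: add_eq_0_iff)
    have q1: "a / (a - w) = - (z / (1 - z))" and q2: "a / (- a - w) = - (z / (1 + z))"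
    proof -
      have "a - w = - (a * (1 - z) / z)" "- a - w = - (a * (1 + z) / z)"
        using z0 by (simp_all add: w_def field_simps)
      thus "a / (a - w) = - (z / (1 - z))" "a / (- a - w) = - (z / (1 + z))"
        using a0 by simp_all
    qed
    have solve: "X = X + P + Q - P + - Q" for X P Q :: complex
      by simp
    have tri: "norm (- A + B + C) \<le> norm A + norm B + norm C" for A B C :: complex
      using norm_triangle_ineq[of "- A + B" C] norm_triangle_ineq[of "- A" B] by simp
    have half: "a / 2 * (2 / X - 2 / Y - 2 / Z) = a / X - a / Y - a / Z" for X Y Z
      by (simp add: right_diff_distrib)
    have "eval_fps euler_remainder w = 2 / (exp w + 1) - 2 / (a - w) - 2 / (- a - w)"
      using eval_euler_remainder[of w] nw assms w1 by (simp add: a_def)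
    hence "a / 2 * eval_fps euler_remainder w = a / (exp w + 1) - a / (a - w) - a / (- a - w)"
      by (simp only: half)
    hence "a / (exp w + 1) = a / 2 * eval_fps euler_remainder w - z / (1 - z) + (- (z / (1 + z)))"
      unfolding q1 q2 by (simp only: diff_minus_eq_add) (rule solve)
    moreover have "- (z / (1 + z)) = (-z) / (1 - (-z))" by simp
    ultimately have M: "a / (exp w + 1)
        = a / 2 * eval_fps euler_remainder w - z / (1 - z) + (-z) / (1 - (-z))"
      by (simp only:)
    have "norm (saddle_coeff n z - a / (exp w + 1)) 
       = norm (- (tail_series n z - z / (1 - z)) + (tail_series n (-z) - (-z) / (1 - (-z)))
           + a / 2 * (G - eval_fps euler_remainder w))"
      unfolding S M right_diff_distrib by (rule arg_cong[of _ _ norm]) simp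
    also have "\<dots> \<le> norm (tail_series n z - z / (1 - z)) + norm (tail_series n (-z) - (-z) / (1 - (-z)))
           + norm (a / 2 * (G - eval_fps euler_remainder w))"
      by (rule tri)
    also have "\<dots> \<le> e1 n + e1 n + pi / 2 * e2 n"
      unfolding e1_def e2_def norm_mult norm_divide a0 G_def
      by (intro add_mono mult_mono tail_series_approx remainder_series_approx)
         (use z nw assms in auto)
    finally show "norm (saddle_coeff n z - of_real pi * \<i> / (exp (of_real pi * \<i> / z) + 1))
       \<le> 2 * e1 n + pi / 2 * e2 n"
      by (simp add: a_def w_def)
  qed
qed

subsection \<open>The Stirling ratio and a uniform Hurwitz theorem\<close>

lemma one_plus_inverse_power_bounds:
  assumes "n > 0"
  shows "(1 + 1 / real n) ^ n \<le> exp 1" "exp 1 \<le> (1 + 1 / real n) ^ Suc n"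
proof -
  have "(1 + 1 / real n) ^ n \<le> exp (1 / real n) ^ n"
    by (intro power_mono exp_ge_add_one_self) auto
  thus "(1 + 1 / real n) ^ n \<le> exp 1"
    using assms by (simp flip: exp_of_nat_mult)
  have "1 + (- 1 / (real n + 1)) \<le> exp (- 1 / (real n + 1))" by (rule exp_ge_add_one_self)
  hence "1 / (1 + 1 / real n) \<le> exp (- (1 / (real n + 1)))"
    using assms by (simp add: field_simps)
  hence "exp (1 / (real n + 1)) \<le> 1 + 1 / real n"
    by (simp add: exp_minus field_simps add_pos_nonneg)
  hence "exp (1 / (real n + 1)) ^ Suc n \<le> (1 + 1 / real n) ^ Suc n"
    by (intro power_mono) auto
  moreover have "exp (1 / (real n + 1)) ^ Suc n = exp 1"
    by (subst exp_of_nat_mult[symmetric]) (simp add: add_ac)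
  ultimately show "exp 1 \<le> (1 + 1 / real n) ^ Suc n" by simp
qed

definition stirling_ratio :: "nat \<Rightarrow> real" where
  "stirling_ratio n = real n ^ n * exp (- real n) / fact n"

text \<open>Weaker than Stirling's formula, but only the \<open>n\<close>-th root matters.
  Consecutive values have quotient \<open>(1 + 1/n)^n / e \<le> 1\<close>; for \<open>n\<close>
  times the ratio the quotient is \<open>(1 + 1/n)^(n+1) / e \<ge> 1\<close>.\<close>

lemma stirling_ratio_bounds:
  assumes "n > 0"
  shows "0 < stirling_ratio n" "stirling_ratio n \<le> 1" "1 \<le> exp 1 * real n * stirling_ratio n"
proof -
  have p: "0 < stirling_ratio m" if "m > 0" for m using that by (simp add: stirling_ratio_def)
  show "0 < stirling_ratio n" by (rule p[OF assms])
  have step: "stirling_ratio (Suc m) = stirling_ratio m * ((1 + 1 / real m) ^ m * exp (-1))" 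
    if "m > 0" for m
  proof -
    have "real (Suc m) ^ Suc m = real (Suc m) * (real m ^ m * (1 + 1 / real m) ^ m)"
      using that by (simp flip: power_mult_distrib add: field_simps)
    moreover have "exp (- real (Suc m)) = exp (- real m) * exp (-1)" by (simp flip: exp_add)
    ultimately show ?thesis
      using that by (simp add: stirling_ratio_def del: of_nat_Suc power_Suc)
  qed
  have "stirling_ratio n \<le> 1 \<and> 1 \<le> exp 1 * real n * stirling_ratio n"
    using assms
  proof (induction n rule: nat_induct_non_zero)
    case 1
    have "exp (-1) \<le> (1::real)" by simp
    thus ?case by (simp add: stirling_ratio_def flip: exp_add)
  next
    case (Suc n)
    note b = one_plus_inverse_power_bounds[OF \<open>n > 0\<close>]
    have e: "exp (-1) * exp 1 = (1::real)" by (simp flip: exp_add)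
    have q: "(1 + 1 / real n) ^ n * exp (-1) \<le> 1"
      using mult_right_mono[OF b(1), of "exp (-1)"] unfolding mult.commute[of "exp 1" "exp (-1)"] e by simp
    have 1: "stirling_ratio (Suc n) \<le> 1"
      unfolding step[OF \<open>n > 0\<close>] by (rule mult_le_one[OF _ _ q]) (use Suc in auto)
    have "1 \<le> (1 + 1 / real n) ^ Suc n * exp (-1)"
      using mult_right_mono[OF b(2), of "exp (-1)"] unfolding mult.commute[of "exp 1" "exp (-1)"] e by simp
    also have "\<dots> = (real (Suc n) / real n) * ((1 + 1 / real n) ^ n * exp (-1))"
      using \<open>n > 0\<close> by (simp add: field_simps)
    finally have "1 * 1 \<le> (exp 1 * real n * stirling_ratio n) * 
       ((real (Suc n) / real n) * ((1 + 1 / real n) ^ n * exp (-1)))"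
      using Suc by (intro mult_mono) auto
    also have "\<dots> = exp 1 * real (Suc n) * stirling_ratio (Suc n)"
      unfolding step[OF \<open>n > 0\<close>] using \<open>n > 0\<close> by (simp del: of_nat_Suc)
    finally show ?case using 1 by simp
  qed
  thus "stirling_ratio n \<le> 1" "1 \<le> exp 1 * real n * stirling_ratio n" by auto
qed

lemma ln_stirling_ratio_tendsto: "(\<lambda>n. ln (stirling_ratio n) / real n) \<longlonglongrightarrow> 0"
proof (rule tendsto_sandwich)
  show "\<forall>\<^sub>F n in sequentially. - (1 + ln (real n)) / real n \<le> ln (stirling_ratio n) / real n"
    using eventually_gt_at_top[of 0]
  proof eventually_elim
    case (elim n)
    have "0 \<le> ln (exp 1 * real n * stirling_ratio n)"
      using stirling_ratio_bounds[OF elim] by (intro ln_ge_zero)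
    also have "\<dots> = 1 + ln (real n) + ln (stirling_ratio n)"
      using elim stirling_ratio_bounds[OF elim] by (simp add: ln_mult_pos)
    finally show ?case using elim by (intro divide_right_mono) auto
  qed
  show "\<forall>\<^sub>F n in sequentially. ln (stirling_ratio n) / real n \<le> 0"
    using eventually_gt_at_top[of 0]
  proof eventually_elim
    case (elim n)
    thus ?case using stirling_ratio_bounds[OF elim] by (auto intro!: divide_nonpos_pos)
  qed
  show "(\<lambda>n. - (1 + ln (real n)) / real n) \<longlonglongrightarrow> 0" by real_asymp
qed auto

text \<open>If infinitely many \<open>n\<close> had a bad target, Hurwitz' theorem would fail at a limit point of these.\<close>
lemma eventually_solvable_near:
  fixes L :: "complex \<Rightarrow> complex" and Ln :: "nat \<Rightarrow> complex \<Rightarrow> complex"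
  assumes V: "open V" and K: "compact K" "K \<subseteq> V" and d: "d > 0"
    and hol: "\<forall>\<^sub>F n in sequentially. Ln n holomorphic_on V" and holL: "L holomorphic_on V"
    and lim: "uniform_limit V Ln L sequentially"
    and nonconst: "\<And>u r. u \<in> V \<Longrightarrow> r > 0 \<Longrightarrow> \<not> L constant_on ball u r"
  shows "\<forall>\<^sub>F n in sequentially. \<forall>u\<in>K. \<exists>v\<in>V. dist v u < d \<and> Ln n v = L u"
proof (rule ccontr)
  define bad where "bad = (\<lambda>n. Ln n holomorphic_on V \<and>
      (\<exists>u\<in>K. \<forall>v\<in>V. dist v u < d \<longrightarrow> Ln n v \<noteq> L u))"
  assume "\<not> (\<forall>\<^sub>F n in sequentially. \<forall>u\<in>K. \<exists>v\<in>V. dist v u < d \<and> Ln n v = L u)"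
  hence "\<exists>\<^sub>F n in sequentially. \<not> (\<forall>u\<in>K. \<exists>v\<in>V. dist v u < d \<and> Ln n v = L u)"
    by (simp add: not_eventually)
  hence "\<exists>\<^sub>F n in sequentially. bad n"
    by (rule frequently_rev_mp) (use hol in \<open>eventually_elim, auto simp: bad_def\<close>)
  hence "infinite {n. bad n}"
    by (simp add: INFM_iff_infinite cofinite_eq_sequentially[symmetric])
  then obtain s :: "nat \<Rightarrow> nat" where s: "strict_mono s" "\<And>k. bad (s k)"
    using infinite_enumerate[of "{n. bad n}"] by auto
  from s(2) have "\<exists>u\<in>K. \<forall>v\<in>V. dist v u < d \<longrightarrow> Ln (s k) v \<noteq> L u" for k
    unfolding bad_def by blast
  then obtain u where u: "\<And>k. u k \<in> K" "\<And>k v. v \<in> V \<Longrightarrow> dist v (u k) < d \<Longrightarrow> Ln (s k) v \<noteq> L (u k)"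
    by metis
  obtain w t where t: "w \<in> K" "strict_mono t" "(u \<circ> t) \<longlonglongrightarrow> w"
    using K(1) u(1) unfolding compact_def by blast
  obtain r where r: "r > 0" "ball w r \<subseteq> V" "r \<le> d / 2"
  proof -
    obtain r0 where "r0 > 0" "ball w r0 \<subseteq> V" using V t(1) K(2) openE by blast
    thus ?thesis using d by (intro that[of "min r0 (d / 2)"]) auto
  qed
  have "\<forall>\<^sub>F k in sequentially. dist (u (t k)) w < d / 2"
    using tendstoD[OF t(3), of "d / 2"] d by (simp add: o_def)
  then obtain N where N: "\<And>k. k \<ge> N \<Longrightarrow> dist (u (t k)) w < d / 2"
    by (auto simp: eventually_sequentially)
  \<comment> \<open>The shift by \<open>N\<close> and the choice \<open>r \<le> d / 2\<close> put
    all of \<open>ball w r\<close> within distance \<open>d\<close> of each remaining target, so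
    that every \<open>F k\<close> is zero-free there, not just those with large
    \<open>k\<close>.\<close>
  define F where "F = (\<lambda>k v. Ln (s (t (k + N))) v - L (u (t (k + N))))"
  have contL: "continuous_on V L" using holL by (rule holomorphic_on_imp_continuous_on)
  have shift: "(\<lambda>k. u (t (k + N))) \<longlonglongrightarrow> w"
    using LIMSEQ_ignore_initial_segment[OF t(3), of N] by (simp add: o_def)
  have "isCont L w" using contL V t(1) K(2) by (auto simp: continuous_on_eq_continuous_at)
  hence Lu: "(\<lambda>k. L (u (t (k + N)))) \<longlonglongrightarrow> L w"
    using shift by (rule isCont_tendsto_compose)
  have fl: "filterlim (\<lambda>k. s (t (k + N))) sequentially sequentially"
  proof (rule filterlim_subseq)
    show "strict_mono (\<lambda>k. s (t (k + N)))"
      using s(1) t(2) by (auto simp: strict_mono_def)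
  qed
  \<comment> \<open>Hurwitz' theorem makes the limit \<open>L v - L w\<close> zero-free on the ball,
    which is absurd at its centre.\<close>
  have "L w - L w \<noteq> 0"
  proof (rule Hurwitz_no_zeros[where S = "ball w r" and \<F> = F and g = "\<lambda>v. L v - L w" and ?z0.0 = w])
    show "F k holomorphic_on ball w r" for k
    proof -
      have "Ln (s (t (k + N))) holomorphic_on ball w r"
        using s(2)[of "t (k + N)"] r(2) unfolding bad_def by (blast intro: holomorphic_on_subset)
      thus ?thesis unfolding F_def by (intro holomorphic_intros)
    qed
    show "(\<lambda>v. L v - L w) holomorphic_on ball w r"
      using holL r(2) by (intro holomorphic_intros) (blast intro: holomorphic_on_subset)
    show "uniform_limit K' F (\<lambda>v. L v - L w) sequentially" if "compact K'" "K' \<subseteq> ball w r" for K'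
    proof -
      have "uniform_limit K' Ln L sequentially"
        using lim by (rule uniform_limit_on_subset) (use that r in blast)
      hence "uniform_limit K' (\<lambda>k. Ln (s (t (k + N)))) L sequentially"
        using fl by (rule filterlim_compose)
      moreover have "uniform_limit K' (\<lambda>k v. L (u (t (k + N)))) (\<lambda>v. L w) sequentially"
        unfolding uniform_limit_iff using tendstoD[OF Lu] by (auto elim: eventually_mono)
      ultimately show ?thesis unfolding F_def by (intro uniform_limit_intros)
    qed
    show "\<not> (\<lambda>v. L v - L w) constant_on ball w r"
    proof
      assume "(\<lambda>v. L v - L w) constant_on ball w r"
      then obtain c where "\<And>v. v \<in> ball w r \<Longrightarrow> L v - L w = c" by (auto simp: constant_on_def)
      hence "L constant_on ball w r"
        unfolding constant_on_def by (intro exI[of _ "c + L w"]) (metis diff_eq_eq)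
      thus False using nonconst[of w r] t(1) K(2) r by blast
    qed
    show "F k v \<noteq> 0" if "v \<in> ball w r" for k v
    proof -
      have "dist v (u (t (k + N))) \<le> dist v w + dist (u (t (k + N))) w"
        by (rule dist_triangle2)
      also have "\<dots> < d" using N[of "k + N"] that r by (simp add: dist_commute)
      finally show ?thesis using u(2)[of v "t (k + N)"] that r by (auto simp: F_def)
    qed
  qed (use r in auto)
  thus False by simp
qed

subsection \<open>Zeros in the logarithmic coordinate\<close>

definition szego_log :: "complex \<Rightarrow> complex" where
  "szego_log u = u + 1 - exp u"

text \<open>For \<open>\<kappa> = 0\<close> the image under \<open>Ln\<close> of the half annulus
  \<open>1/e < \<bar>z\<bar> < 1\<close>, \<open>Re z > 0\<close>; positive \<open>\<kappa>\<close>
  keeps a margin from its boundary. The exponential is injective on it, and by convexity zero-free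
  holomorphic functions have logarithms.\<close>

definition log_strip :: "real \<Rightarrow> complex set" where
  "log_strip \<kappa> = {u. -1 + \<kappa> < Re u \<and> Re u < - \<kappa> \<and> 
      \<kappa> - pi / 2 < Im u \<and> Im u < pi / 2 - \<kappa>}"

lemma open_log_strip: "open (log_strip \<kappa>)"
  unfolding log_strip_def
  by (intro open_Collect_conj open_Collect_less continuous_intros)

lemma log_strip_eq:
  "log_strip \<kappa> = {u. Re u > -1 + \<kappa>} \<inter> {u. Re u < - \<kappa>} \<inter> {u. Im u < pi / 2 - \<kappa>}
     \<inter> {u. Im u > \<kappa> - pi / 2}"
  by (auto simp: log_strip_def)

lemma convex_log_strip: "convex (log_strip \<kappa>)"
  unfolding log_strip_eq
  by (intro convex_Int convex_halfspace_Re_gt convex_halfspace_Re_lt convex_halfspace_Im_lt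
      convex_halfspace_Im_gt)

lemma compact_subset_log_strip:
  assumes "compact K" "K \<subseteq> log_strip 0"
  obtains \<kappa> where "\<kappa> > 0" "K \<subseteq> log_strip \<kappa>"
proof -
  obtain e where e: "e > 0" "(\<Union>x\<in>K. cball x e) \<subseteq> log_strip 0"
    using compact_subset_open_imp_cball_epsilon_subset[OF assms(1) open_log_strip assms(2)] by blast
  have "u \<in> log_strip e" if "u \<in> K" for u
  proof -
    have *: "v \<in> log_strip 0" if "dist u v \<le> e" for v
      using that e(2) \<open>u \<in> K\<close> by (meson UN_I mem_cball subsetD)
    have "u + of_real e \<in> log_strip 0" "u - of_real e \<in> log_strip 0"
         "u + of_real e * \<i> \<in> log_strip 0" "u - of_real e * \<i> \<in> log_strip 0"
      by (rule *, use e(1) in \<open>simp add: dist_norm norm_mult\<close>)+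
    thus ?thesis by (auto simp: log_strip_def)
  qed
  thus ?thesis using e(1) that by blast
qed

text \<open>The exponential \<open>exp (-n z)\<close> of the second pole is absorbed into the saddle
  term. Relative to \<open>\<zeta>^n\<close> and the leading exponential it has the base
  \<open>e^(-2z) / \<zeta>\<close>, smaller than 1 in modulus on the half annulus.\<close>

definition saddle_total :: "nat \<Rightarrow> complex \<Rightarrow> complex" where
  "saddle_total n z = saddle_coeff n z
     + (-1) ^ Suc n * (exp (- 2 * z) / (z * exp (1 - z))) ^ n / of_real (stirling_ratio n)"

text \<open>Everything rests on
  \<open>(n z)^n / n! * exp (-n z) = stirling_ratio n * \<zeta>^n\<close>; the identity is exact,
  with no error term.\<close>

lemma euler_norm_factor:
  assumes "n > 0" "z \<noteq> 0"
  shows "euler_norm n z * exp (- (of_nat n * z))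
    = 1 + of_real (stirling_ratio n) * (z * exp (1 - z)) ^ n * saddle_total n z"
proof -
  define s where "s = complex_of_real (stirling_ratio n)"
  define q where "q = (z * exp (1 - z)) ^ n"
  define E where "E = exp (of_nat n * z)"
  have s0: "s \<noteq> 0" using stirling_ratio_bounds(1)[OF assms(1)] by (simp add: s_def)
  have q0: "q \<noteq> 0" using assms by (simp add: q_def)
  have E0: "E \<noteq> 0" "exp (- (of_nat n * z)) = 1 / E"
    by (simp_all add: E_def exp_minus field_simps)
  have "exp (1 - z) ^ n = exp (of_nat n) * exp (- (of_nat n * z))"
    by (simp add: exp_of_nat_mult[symmetric] exp_add[symmetric] algebra_simps)
  hence q: "q = z ^ n * exp (of_nat n) / E"
    by (simp add: q_def power_mult_distrib E0)
  have s: "s = of_nat n ^ n / (exp (of_nat n) * fact n)"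
  proof -
    have "complex_of_real (exp (- real n)) = 1 / exp (of_nat n)"
      by (simp add: exp_of_real[symmetric] exp_minus field_simps)
    thus ?thesis by (simp add: s_def stirling_ratio_def)
  qed
  have sq: "s * q = (of_nat n * z) ^ n / fact n / E"
    unfolding s q using E0 by (simp add: power_mult_distrib)
  have e2: "(exp (- 2 * z)) ^ n = 1 / E / E"
    unfolding E_def by (simp add: exp_of_nat_mult[symmetric] exp_minus[symmetric] field_simps exp_add[symmetric])
  have "s * q * saddle_coeff n z = (euler_norm n z - E - (-1) ^ Suc n * (1 / E)) / E"
    unfolding sq saddle_coeff_def E_def[symmetric] E0(2) using assms by simp
  moreover have "s * q * ((-1) ^ Suc n * (exp (- 2 * z) / (z * exp (1 - z))) ^ n / s)
      = (-1) ^ Suc n * (1 / E / E)"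
    unfolding power_divide e2 q_def[symmetric] using s0 q0 by simp
  ultimately have "s * q * saddle_total n z
      = (euler_norm n z - E - (-1) ^ Suc n * (1 / E)) / E + (-1) ^ Suc n * (1 / E / E)"
    unfolding saddle_total_def s_def[symmetric] by (simp only: distrib_left)
  also have "\<dots> = euler_norm n z / E - 1"
    using E0 by (simp add: diff_divide_distrib add_divide_distrib)
  finally show ?thesis by (simp add: E0 s_def q_def)
qed

definition saddle_limit :: "complex \<Rightarrow> complex" where
  "saddle_limit z = of_real pi * \<i> / (exp (of_real pi * \<i> / z) + 1)"

lemma exp_mem_log_strip:
  assumes "u \<in> log_strip \<kappa>" "\<kappa> \<ge> 0"
  shows "exp (-1) < norm (exp u)" "norm (exp u) \<le> exp (- \<kappa>)" "norm (exp u) < 1" "Re (exp u) > 0"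
proof -
  show "exp (-1) < norm (exp u)" "norm (exp u) \<le> exp (- \<kappa>)" "norm (exp u) < 1"
    using assms by (auto simp: log_strip_def)
  have "cos (Im u) > 0" using assms by (intro cos_gt_zero_pi) (auto simp: log_strip_def)
  thus "Re (exp u) > 0" by (simp add: Re_exp)
qed

text \<open>On the strip \<open>1 < 1 / \<bar>z\<bar> < e < 3\<close>, so \<open>\<pi>\<i>/z\<close>
  lies strictly between the circles of radius \<open>\<pi>\<close> and \<open>3\<pi>\<close> that
  carry the nearest zeros of \<open>e^\<xi> + 1\<close>.\<close>

lemma exp_saddle_denom_nonzero:
  assumes "u \<in> log_strip 0"
  shows "exp (of_real pi * \<i> / exp u) + 1 \<noteq> (0::complex)"
proof (rule exp_plus_one_nonzero)
  note b = exp_mem_log_strip[OF assms order_refl]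
  have n: "norm (of_real pi * \<i> / exp u) = pi * (1 / norm (exp u))"
    by (simp add: norm_divide norm_mult del: norm_exp_eq_Re)
  have "1 / norm (exp u) < 3"
  proof -
    have "norm (exp u) * 3 \<ge> norm (exp u) * exp 1" using exp_le by (intro mult_left_mono) auto
    moreover have "norm (exp u) * exp 1 > exp (-1) * exp 1"
      using b(1) by (intro mult_strict_right_mono) auto
    moreover have "exp (-1) * exp 1 = (1::real)" by (simp flip: exp_add)
    ultimately have "norm (exp u) * 3 > 1" by linarith
    thus ?thesis using b(1) by (simp add: divide_simps del: norm_exp_eq_Re)
  qed
  hence "pi * (1 / norm (exp u)) < pi * 3" by (intro mult_strict_left_mono) auto
  thus "norm (of_real pi * \<i> / exp u) < 3 * pi" unfolding n by simp
  have "1 / norm (exp u) > 1" using b(3) by (simp add: divide_simps del: norm_exp_eq_Re)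
  hence "pi * (1 / norm (exp u)) > pi * 1" by (intro mult_strict_left_mono) auto
  hence "norm (of_real pi * \<i> / exp u) > norm (of_real pi * \<i>)"
    unfolding n by (simp add: norm_mult)
  thus "of_real pi * \<i> / exp u \<noteq> of_real pi * \<i>" "of_real pi * \<i> / exp u \<noteq> - (of_real pi * \<i>)"
    by auto
qed

lemma uniform_limit_saddle_total:
  assumes "\<kappa> > 0"
  shows "uniform_limit (log_strip \<kappa>) (\<lambda>n u. saddle_total n (exp u)) (\<lambda>u. saddle_limit (exp u)) sequentially"
proof -
  have e3: "exp 1 < (3::real)" using e_less_272 by simp
  \<comment> \<open>The radius \<open>R = e \<pi>\<close> is the one with
    \<open>pi / R = 1/e\<close>, the inner radius of the half annulus; it is admissible as
    \<open>e < 3\<close>.\<close>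
  obtain err where err: "err \<longlonglongrightarrow> 0"
    "\<And>n z. n > 0 \<Longrightarrow> pi / (exp 1 * pi) \<le> norm z \<Longrightarrow> norm z \<le> exp (- \<kappa>) \<Longrightarrow>
       norm (saddle_coeff n z - saddle_limit z) \<le> err n"
    unfolding saddle_limit_def
    by (rule saddle_coeff_approx[of "exp (- \<kappa>)" "exp 1 * pi"]) (use assms e3 in auto)
  have "(\<lambda>n. err n + exp (- \<kappa>) ^ n * (exp 1 * real n)) \<longlonglongrightarrow> 0 + 0"
  proof (intro tendsto_add err(1))
    have "(\<lambda>n. exp 1 * (real n * exp (- \<kappa>) ^ n)) \<longlonglongrightarrow> exp 1 * 0"
      by (intro tendsto_intros powser_times_n_limit_0) (use assms in auto)
    thus "(\<lambda>n. exp (- \<kappa>) ^ n * (exp 1 * real n)) \<longlonglongrightarrow> 0" by (simp add: mult_ac)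
  qed
  hence lim: "(\<lambda>n. err n + exp (- \<kappa>) ^ n * (exp 1 * real n)) \<longlonglongrightarrow> 0" by simp
  have bound: "norm (saddle_total n (exp u) - saddle_limit (exp u)) \<le> err n + exp (- \<kappa>) ^ n * (exp 1 * real n)"
    if n: "n > 0" and u: "u \<in> log_strip \<kappa>" for n u
  proof -
    note b = exp_mem_log_strip[OF u less_imp_le[OF assms]]
    \<comment> \<open>The exponent is at most \<open>-\<kappa>\<close> because
      \<open>Re u > -1 + \<kappa>\<close> and \<open>Re (e^u) > 0\<close>. This geometric decay
      beats the factor \<open>e n\<close> that bounds \<open>1 / stirling_ratio n\<close>.\<close>
    have "norm (exp (- 2 * exp u) / (exp u * exp (1 - exp u))) = exp (- (1 + Re u + Re (exp u)))"
      by (simp only: norm_divide norm_mult norm_exp_eq_Re exp_add[symmetric] exp_diff[symmetric])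
         (simp add: algebra_simps)
    also have "\<dots> \<le> exp (- \<kappa>)" using u b(4) by (simp add: log_strip_def)
    finally have "norm (exp (- 2 * exp u) / (exp u * exp (1 - exp u))) ^ n \<le> exp (- \<kappa>) ^ n"
      by (intro power_mono) auto
    moreover have "1 / stirling_ratio n \<le> exp 1 * real n"
      using stirling_ratio_bounds[OF n] by (simp add: divide_simps mult_ac)
    ultimately have "norm (exp (- 2 * exp u) / (exp u * exp (1 - exp u))) ^ n * (1 / stirling_ratio n)
        \<le> exp (- \<kappa>) ^ n * (exp 1 * real n)"
      using stirling_ratio_bounds[OF n] by (intro mult_mono) auto
    hence 1: "norm ((-1) ^ Suc n * (exp (- 2 * exp u) / (exp u * exp (1 - exp u))) ^ n / of_real (stirling_ratio n))
       \<le> exp (- \<kappa>) ^ n * (exp 1 * real n)"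
      using stirling_ratio_bounds(1)[OF n]
      by (simp add: norm_mult norm_divide norm_power del: norm_exp_eq_Re)
    have "pi / (exp 1 * pi) = exp (-1)" by (simp add: exp_minus divide_simps)
    hence 2: "norm (saddle_coeff n (exp u) - saddle_limit (exp u)) \<le> err n"
      using b by (intro err(2) n) (auto simp del: norm_exp_eq_Re)
    show ?thesis
      using norm_triangle_le[OF add_mono[OF 2 1]]
      unfolding saddle_total_def by (simp add: algebra_simps)
  qed
  show ?thesis
  proof (rule uniform_limitI)
    fix e :: real assume "e > 0"
    have "\<forall>\<^sub>F n in sequentially. err n + exp (- \<kappa>) ^ n * (exp 1 * real n) < e"
      using order_tendstoD(2)[OF lim \<open>e > 0\<close>] .
    with eventually_gt_at_top[of 0]
    show "\<forall>\<^sub>F n in sequentially. \<forall>u\<in>log_strip \<kappa>. dist (saddle_total n (exp u)) (saddle_limit (exp u)) < e"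
    proof eventually_elim
      case (elim n)
      show ?case
      proof
        fix u assume "u \<in> log_strip \<kappa>"
        from bound[OF elim(1) this] elim(2)
        show "dist (saddle_total n (exp u)) (saddle_limit (exp u)) < e"
          unfolding dist_norm by (rule le_less_trans)
      qed
    qed
  qed
qed

text \<open>A crude bound is enough, as the logarithm will be divided by \<open>n\<close>.\<close>

lemma norm_Ln_le_near_1:
  assumes "norm (w - 1) \<le> 1 / 2"
  shows "norm (Ln w) \<le> 1 + pi" "w \<notin> \<real>\<^sub>\<le>\<^sub>0"
proof -
  have w: "norm w \<ge> 1 / 2" "norm w \<le> 3 / 2"
    using assms norm_triangle_ineq2[of 1 "1 - w"] norm_triangle_ineq[of "w - 1" 1]
    by (auto simp: norm_minus_commute)
  hence w0: "w \<noteq> 0" by auto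
  have "ln (norm w) \<le> norm w - 1" using w by (intro ln_le_minus_one) linarith
  moreover have "ln (norm w) \<ge> 1 - 1 / norm w"
    using ln_le_minus_one[of "1 / norm w"] w w0 by (simp add: ln_div)
  moreover have "1 / norm w \<le> 2" using w by (simp add: divide_simps)
  ultimately have "\<bar>ln (norm w)\<bar> \<le> 1" using w by linarith
  hence "\<bar>Re (Ln w)\<bar> \<le> 1" using w0 by simp
  moreover have "\<bar>Im (Ln w)\<bar> \<le> pi"
    using mpi_less_Im_Ln[OF w0] Im_Ln_le_pi[OF w0] by linarith
  ultimately show "norm (Ln w) \<le> 1 + pi"
    using cmod_le[of "Ln w"] by linarith
  have "Re w > 0" using abs_Re_le_cmod[of "w - 1"] assms by auto
  thus "w \<notin> \<real>\<^sub>\<le>\<^sub>0" by (auto simp: complex_nonpos_Reals_iff)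
qed

lemma holomorphic_poly: "poly p holomorphic_on A" for p :: "complex poly"
proof (induction p)
  case (pCons a p)
  have "(\<lambda>z. a + z * poly p z) holomorphic_on A"
    by (intro holomorphic_intros pCons)
  thus ?case by (simp add: fun_eq_iff holomorphic_transform)
qed simp

lemma holomorphic_saddle_total:
  assumes "n > 0"
  shows "(\<lambda>u. saddle_total n (exp u)) holomorphic_on A"
proof -
  have "(\<lambda>u. poly (euler_poly_scaled n) (exp u / (of_real pi * \<i>))) holomorphic_on A"
  proof -
    have "(\<lambda>u. exp u / (of_real pi * \<i>)) holomorphic_on A"
      by (intro holomorphic_intros) simp
    hence "poly (euler_poly_scaled n) \<circ> (\<lambda>u. exp u / (of_real pi * \<i>)) holomorphic_on A"
      by (rule holomorphic_on_compose) (rule holomorphic_poly)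
    thus ?thesis by (simp add: o_def)
  qed
  thus ?thesis
    unfolding saddle_total_def saddle_coeff_def euler_norm_def
    using assms stirling_ratio_bounds(1)[OF assms]
    by (intro holomorphic_on_add holomorphic_on_mult holomorphic_on_diff holomorphic_on_divide
       holomorphic_on_power holomorphic_on_exp' holomorphic_on_const holomorphic_on_minus holomorphic_on_ident)
       simp_all
qed

text \<open>The function \<open>\<Lambda>\<close> is exported because its values tell the zeros
  apart: points \<open>v\<close> found for targets with different \<open>szego_log u\<close> are
  different, with no separation estimate.\<close>

lemma zeros_near_log_curve:
  assumes K: "compact K" "K \<subseteq> log_strip 0" and d: "d > 0"
  shows "\<forall>\<^sub>F n in sequentially. \<exists>\<Lambda>. \<forall>u\<in>K. \<exists>v\<in>log_strip 0. dist v u < d \<and> \<Lambda> v = szego_log u \<and>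
           (exp (of_nat n * szego_log u) = -1 \<longrightarrow> euler_norm n (exp v) = 0)"
proof -
  obtain \<kappa> where \<kappa>: "\<kappa> > 0" "K \<subseteq> log_strip \<kappa>" using compact_subset_log_strip[OF K] by blast
  define V where "V = log_strip \<kappa>"
  define H where "H = (\<lambda>u. saddle_limit (exp u))"
  define T where "T = (\<lambda>n u. saddle_total n (exp u))"
  have sub: "V \<subseteq> log_strip 0" using \<kappa>(1) by (auto simp: V_def log_strip_def)
  have H0: "H u \<noteq> 0" if "u \<in> log_strip 0" for u
    unfolding H_def saddle_limit_def using exp_saddle_denom_nonzero that by auto
  have holH: "H holomorphic_on log_strip 0"
    unfolding H_def saddle_limit_def using exp_saddle_denom_nonzero
    by (auto intro!: holomorphic_intros)
  have "of_real (-1/2) \<in> log_strip 0" by (simp add: log_strip_def)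
  then obtain l where l: "l holomorphic_on log_strip 0" "\<And>u. u \<in> log_strip 0 \<Longrightarrow> exp (l u) = H u"
    using holomorphic_logarithm_exists[OF convex_log_strip open_log_strip holH H0] by metis
  \<comment> \<open>The logarithm \<open>l\<close> may be unbounded on the open strip. It is bounded
    on this compact box, which contains \<open>V\<close>, and so \<open>H\<close> stays away from 0
    on \<open>V\<close>.\<close>
  define V' where "V' = cbox (Complex (-1 + \<kappa>) (- (pi / 2 - \<kappa>))) (Complex (- \<kappa>) (pi / 2 - \<kappa>))"
  have V': "compact V'" "V \<subseteq> V'" "V' \<subseteq> log_strip 0"
    using \<kappa>(1) by (auto simp: V'_def V_def log_strip_def in_cbox_complex_iff)
  have "continuous_on V' l"
    using l(1) V'(3) holomorphic_on_imp_continuous_on holomorphic_on_subset by blast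
  hence "bounded (l ` V')" using V'(1) compact_continuous_image compact_imp_bounded by blast
  then obtain B where B: "\<And>u. u \<in> V' \<Longrightarrow> norm (l u) \<le> B" unfolding bounded_iff by auto
  have Hlow: "norm (H u) \<ge> exp (- B)" if "u \<in> V" for u
  proof -
    have "- B \<le> Re (l u)" using B[of u] that V' abs_Re_le_cmod[of "l u"] by force
    thus ?thesis using l(2)[of u] that sub by (metis exp_le_cancel_iff norm_exp_eq_Re subsetD)
  qed
  \<comment> \<open>Chosen so that \<open>exp (n \<Lambda>)\<close> is the product
    \<open>stirling_ratio n * \<zeta>^n * T\<close>, which must equal -1 at a zero. The logarithm of
    \<open>T\<close> is split into \<open>l\<close> for the limit \<open>H\<close> and the principal
    logarithm of \<open>T / H\<close>, a quotient close to 1.\<close>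
  define \<Lambda> where "\<Lambda> = (\<lambda>n u. szego_log u
      + (of_real (ln (stirling_ratio n)) + l u + Ln (T n u / H u)) / of_nat n)"
  have "uniform_limit V T H sequentially"
    unfolding T_def H_def V_def by (rule uniform_limit_saddle_total[OF \<kappa>(1)])
  hence "\<forall>\<^sub>F n in sequentially. \<forall>u\<in>V. dist (T n u) (H u) < exp (- B) / 2"
    by (rule uniform_limitD) auto
  hence quot: "\<forall>\<^sub>F n in sequentially. \<forall>u\<in>V. norm (T n u / H u - 1) \<le> 1 / 2"
  proof eventually_elim
    case (elim n)
    show ?case
    proof
      fix u assume u: "u \<in> V"
      have h0: "H u \<noteq> 0" using H0 u sub by blast
      hence "T n u / H u - 1 = (T n u - H u) / H u" by (simp add: diff_divide_distrib)
      also have "norm \<dots> = dist (T n u) (H u) / norm (H u)" by (simp add: norm_divide dist_norm)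
      also have "\<dots> \<le> (exp (- B) / 2) / exp (- B)"
        using elim u Hlow[OF u] by (intro frac_le) (auto intro: less_imp_le)
      finally show "norm (T n u / H u - 1) \<le> 1 / 2" by simp
    qed
  qed
  have solv: "\<forall>\<^sub>F n in sequentially. \<forall>u\<in>K. \<exists>v\<in>V. dist v u < d \<and> \<Lambda> n v = szego_log u"
  proof (rule eventually_solvable_near)
    show "open V" unfolding V_def by (rule open_log_strip)
    show "compact K" "K \<subseteq> V" "d > 0" using K \<kappa> d by (auto simp: V_def)
    show "szego_log holomorphic_on V"
      unfolding szego_log_def by (intro holomorphic_intros)
    show "\<forall>\<^sub>F n in sequentially. \<Lambda> n holomorphic_on V"
      using quot eventually_gt_at_top[of 0]
    proof eventually_elim
      case (elim n)
      have "H u \<noteq> 0" if "u \<in> V" for u using H0 that sub by blast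
      moreover have "T n u / H u \<notin> \<real>\<^sub>\<le>\<^sub>0" if "u \<in> V" for u
        using elim(1) that norm_Ln_le_near_1 by blast
      moreover have "T n holomorphic_on V"
        unfolding T_def by (rule holomorphic_saddle_total[OF elim(2)])
      ultimately show ?case
        unfolding \<Lambda>_def szego_log_def using elim(2)
        by (intro holomorphic_intros holomorphic_on_subset[OF l(1) sub]
            holomorphic_on_subset[OF holH sub]) auto
    qed
    show "uniform_limit V \<Lambda> szego_log sequentially"
    proof (rule uniform_limitI)
      fix e :: real assume e: "e > 0"
      have "(\<lambda>n. \<bar>ln (stirling_ratio n) / real n\<bar> + (B + (1 + pi)) / real n) \<longlonglongrightarrow> \<bar>0\<bar> + 0"
        by (intro tendsto_add tendsto_rabs ln_stirling_ratio_tendsto) real_asymp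
      hence "\<forall>\<^sub>F n in sequentially. \<bar>ln (stirling_ratio n) / real n\<bar> + (B + (1 + pi)) / real n < e"
        using e order_tendstoD(2) by fastforce
      with quot eventually_gt_at_top[of 0]
      show "\<forall>\<^sub>F n in sequentially. \<forall>u\<in>V. dist (\<Lambda> n u) (szego_log u) < e"
      proof eventually_elim
        case (elim n)
        show ?case
        proof
          fix u assume u: "u \<in> V"
          have "norm (l u + Ln (T n u / H u)) \<le> B + (1 + pi)"
            by (rule norm_triangle_le, rule add_mono)
               (use u V'(2) B elim(1) norm_Ln_le_near_1 in blast)+
          hence "norm ((l u + Ln (T n u / H u)) / of_nat n) \<le> (B + (1 + pi)) / real n"
            by (simp add: norm_divide divide_right_mono)
          moreover have "norm (of_real (ln (stirling_ratio n)) / of_nat n :: complex) = \<bar>ln (stirling_ratio n) / real n\<bar>"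
            by (simp add: norm_divide)
          moreover have "\<Lambda> n u - szego_log u = of_real (ln (stirling_ratio n)) / of_nat n
             + (l u + Ln (T n u / H u)) / of_nat n"
            by (simp add: \<Lambda>_def add_divide_distrib)
          ultimately have "norm (\<Lambda> n u - szego_log u) 
              \<le> \<bar>ln (stirling_ratio n) / real n\<bar> + (B + (1 + pi)) / real n"
            by (metis norm_triangle_le add_mono order_refl)
          thus "dist (\<Lambda> n u) (szego_log u) < e" using elim(3) by (simp add: dist_norm)
        qed
      qed
    qed
    fix w :: complex and r :: real assume w: "w \<in> V" "r > 0"
    show "\<not> szego_log constant_on ball w r"
    proof
      assume "szego_log constant_on ball w r"
      then obtain c where c: "\<And>v. v \<in> ball w r \<Longrightarrow> szego_log v = c"
        by (auto simp: constant_on_def)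
      have "(szego_log has_field_derivative 1 - exp w) (at w)"
        unfolding szego_log_def by (auto intro!: derivative_eq_intros)
      moreover have "(szego_log has_field_derivative 0) (at w)"
      proof (rule has_field_derivative_transform_within_open[of "\<lambda>_. c" _ _ "ball w r"])
        show "\<And>x. x \<in> ball w r \<Longrightarrow> c = szego_log x" using c by simp
      qed (use w in auto)
      ultimately have "exp w = 1" using DERIV_unique by fastforce
      hence "norm (exp w) = 1" by simp
      thus False using exp_mem_log_strip(3)[of w \<kappa>] w \<kappa> by (auto simp: V_def)
    qed
  qed
  show ?thesis
    using solv quot eventually_gt_at_top[of 0]
  proof eventually_elim
    case (elim n)
    have "euler_norm n (exp v) = 0" 
      if v: "v \<in> V" and L: "\<Lambda> n v = szego_log u" "exp (of_nat n * szego_log u) = -1" for v u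
    proof -
      have h0: "H v \<noteq> 0" using H0 v sub by blast
      have t0: "T n v \<noteq> 0" using elim(2) v by fastforce
      have c0: "stirling_ratio n > 0" using stirling_ratio_bounds elim(3) by blast
      have "of_nat n * \<Lambda> n v = of_nat n * szego_log v + of_real (ln (stirling_ratio n)) + l v + Ln (T n v / H v)"
        using elim(3) unfolding \<Lambda>_def by (subst distrib_left) (simp add: add.assoc)
      also have "exp \<dots> = exp (szego_log v) ^ n * of_real (stirling_ratio n) * T n v"
        using c0 h0 t0 l(2)[of v] v sub 
        by (simp add: exp_add exp_of_nat_mult exp_of_real subset_iff)
      also have "exp (szego_log v) = exp v * exp (1 - exp v)"
        by (simp add: szego_log_def exp_add[symmetric] algebra_simps)
      finally have "(exp v * exp (1 - exp v)) ^ n * of_real (stirling_ratio n) * T n v = -1"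
        using L by simp
      hence "euler_norm n (exp v) * exp (- (of_nat n * exp v)) = 0"
        using elim(3) by (subst euler_norm_factor) (auto simp: T_def mult_ac)
      thus ?thesis by simp
    qed
    with elim(1) sub show ?case by (intro exI[of _ "\<Lambda> n"]) (meson subsetD)
  qed
qed

subsection \<open>Counting zeros\<close>

lemma finite_euler_roots: "finite {x. poly (euler_poly_scaled n) x = 0 \<and> P x}"
  using poly_roots_finite[OF euler_poly_scaled_nonzero] by (rule finite_subset[rotated]) auto

text \<open>On \<open>K\<close> the parametrised curve is \<open>szego_log u = \<i>\<phi>\<close>; the zeros near it correspond to the
  \<open>n\<close>-th roots of \<open>-1\<close> with argument in \<open>[a, b]\<close>.\<close>
lemma card_zeros_near_curve:
  fixes a b :: real
  assumes K: "compact K" "K \<subseteq> log_strip 0"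
    and cover: "\<And>\<phi>. a \<le> \<phi> \<Longrightarrow> \<phi> \<le> b \<Longrightarrow> \<exists>u\<in>K. szego_log u = \<i> * of_real \<phi>"
    and P: "\<And>u. u \<in> K \<Longrightarrow> \<forall>\<^sub>F x in nhds (exp u / (of_real pi * \<i>)). P x"
  shows "\<forall>\<^sub>F n in sequentially.
    real n * (b - a) / (2 * pi) - 1 \<le> real (card {x. poly (euler_poly_scaled n) x = 0 \<and> P x})"
proof -
  define X where "X = (\<lambda>u. exp u / (of_real pi * \<i>))"
  \<comment> \<open>\<open>W\<close> is open, so compactness of \<open>K\<close> yields one distance
    \<open>d\<close> that guarantees \<open>P\<close> for every zero found.\<close>
  define W where "W = {v. \<forall>\<^sub>F x in nhds (X v). P x}"
  have "open W"
  proof (subst open_subopen, intro ballI)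
    fix v assume "v \<in> W"
    then obtain S where S: "open S" "X v \<in> S" "\<And>x. x \<in> S \<Longrightarrow> P x"
      unfolding W_def eventually_nhds by blast
    have "open (X -` S)" unfolding X_def
      by (intro open_vimage S continuous_intros) simp
    moreover have "X -` S \<subseteq> W" using S unfolding W_def eventually_nhds by blast
    ultimately show "\<exists>T. open T \<and> v \<in> T \<and> T \<subseteq> W" using S(2) by blast
  qed
  moreover have "K \<subseteq> W" using P by (auto simp: W_def X_def)
  ultimately obtain d where d: "d > 0" "(\<Union>u\<in>K. ball u d) \<subseteq> W"
    using compact_subset_open_imp_ball_epsilon_subset[OF K(1)] by metis
  have PX: "P (X v)" if "u \<in> K" "dist v u < d" for u v
  proof -
    have "v \<in> W" using that d(2) by (metis UN_I dist_commute mem_ball subsetD)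
    thus ?thesis unfolding W_def by (auto dest: eventually_nhds_x_imp_x)
  qed
  show ?thesis
    using zeros_near_log_curve[OF K d(1)] eventually_gt_at_top[of 0]
  proof eventually_elim
    case (elim n)
    define \<theta> where "\<theta> = (\<lambda>k::int. (2 * real_of_int k + 1) * pi / real n)"
    \<comment> \<open>These solve \<open>\<theta> k = a\<close> and \<open>\<theta> k = b\<close>
      for real \<open>k\<close>; the admissible indices are the integers in between.\<close>
    define A B where "A = (real n * a / pi - 1) / 2" and "B = (real n * b / pi - 1) / 2"
    define I where "I = {\<lceil>A\<rceil>..\<lfloor>B\<rfloor>}"
    from elim obtain \<Lambda> where \<Lambda>: "\<And>u. u \<in> K \<Longrightarrow> \<exists>v\<in>log_strip 0. dist v u < d \<and> \<Lambda> v = szego_log u \<and>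
           (exp (of_nat n * szego_log u) = -1 \<longrightarrow> euler_norm n (exp v) = 0)" by blast
    have "\<exists>v. v \<in> log_strip 0 \<and> P (X v) \<and> \<Lambda> v = \<i> * of_real (\<theta> k) \<and> euler_norm n (exp v) = 0"
      if k: "k \<in> I" for k
    proof -
      have "A \<le> of_int k" "of_int k \<le> B" using k by (auto simp: I_def ceiling_le_iff le_floor_iff)
      hence "a \<le> \<theta> k" "\<theta> k \<le> b"
        using elim(2) by (auto simp: A_def B_def \<theta>_def field_simps)
      then obtain u where u: "u \<in> K" "szego_log u = \<i> * of_real (\<theta> k)" using cover by blast
      from \<Lambda>[OF u(1)] obtain v where v: "v \<in> log_strip 0" "dist v u < d" "\<Lambda> v = szego_log u"
        "exp (of_nat n * szego_log u) = -1 \<longrightarrow> euler_norm n (exp v) = 0" by blast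
      have "of_nat n * szego_log u = of_real ((2 * of_int k + 1) * pi) * \<i>"
        using elim(2) by (simp add: u \<theta>_def)
      hence "exp (of_nat n * szego_log u) + 1 = 0" using exp_plus_one_zero_iff by blast
      hence "exp (of_nat n * szego_log u) = -1" by (simp add: eq_neg_iff_add_eq_0)
      thus ?thesis using v u PX by auto
    qed
    then obtain v where v: "\<And>k. k \<in> I \<Longrightarrow> v k \<in> log_strip 0" "\<And>k. k \<in> I \<Longrightarrow> P (X (v k))"
      "\<And>k. k \<in> I \<Longrightarrow> \<Lambda> (v k) = \<i> * of_real (\<theta> k)" "\<And>k. k \<in> I \<Longrightarrow> euler_norm n (exp (v k)) = 0"
      by metis
    \<comment> \<open>Equal zeros come from equal points of the strip, as \<open>Ln\<close> inverts
      \<open>exp\<close> there, and the value of \<open>\<Lambda>\<close> at that point determines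
      \<open>k\<close>.\<close>
    have inj: "inj_on (\<lambda>k. X (v k)) I"
    proof (rule inj_onI)
      fix k k' assume k: "k \<in> I" "k' \<in> I" "X (v k) = X (v k')"
      hence "exp (v k) = exp (v k')" by (simp add: X_def)
      moreover have "Ln (exp (v j)) = v j" if "j \<in> I" for j
        using v(1)[OF that] pi_gt_zero by (intro Ln_exp) (auto simp: log_strip_def simp del: pi_gt_zero)
      ultimately have "v k = v k'" using k by metis
      hence "\<theta> k = \<theta> k'" using v(3) k by (metis complex_i_not_zero mult_cancel_left of_real_eq_iff)
      thus "k = k'" using elim(2) by (simp add: \<theta>_def)
    qed
    have "(\<lambda>k. X (v k)) ` I \<subseteq> {x. poly (euler_poly_scaled n) x = 0 \<and> P x}"
      using v(2,4) by (auto simp: euler_norm_def X_def)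
    from card_mono[OF finite_euler_roots this]
    have "card I \<le> card {x. poly (euler_poly_scaled n) x = 0 \<and> P x}"
      unfolding card_image[OF inj] .
    moreover have "real (card I) \<ge> B - A - 1"
      unfolding I_def by simp linarith
    moreover have "B - A = real n * (b - a) / (2 * pi)"
      by (simp add: A_def B_def field_simps)
    ultimately show ?case by linarith
  qed
qed

section \<open>Symmetry under complex conjugation\<close>

lemma fps_nth_euler_generating_real: "cnj (fps_nth (2 / (fps_exp 1 + 1)) k) = fps_nth (2 / (fps_exp 1 + 1)) k"
proof -
  let ?E = "fps_exp 1 + 1 :: complex fps" and ?D = "2 / (fps_exp 1 + 1) :: complex fps"
  have nz: "fps_nth ?E 0 \<noteq> 0" by simp
  hence DE: "?D * ?E = 2" by (simp add: fps_divide_unit mult.assoc inverse_mult_eq_1)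
  have E: "cnj (fps_nth ?E k) = fps_nth ?E k" for k by simp
  \<comment> \<open>\<open>?E\<close> has real coefficients, so conjugating those of
    \<open>?D\<close> gives another solution of \<open>D * ?E = 2\<close>, and cancelling
    \<open>?E\<close> identifies the two.\<close>
  have "Abs_fps (\<lambda>k. cnj (fps_nth ?D k)) * ?E = 2"
  proof (rule fps_ext)
    fix n
    have "fps_nth (Abs_fps (\<lambda>k. cnj (fps_nth ?D k)) * ?E) n = cnj (fps_nth (?D * ?E) n)"
      unfolding fps_mult_nth cnj_sum complex_cnj_mult E by simp
    thus "fps_nth (Abs_fps (\<lambda>k. cnj (fps_nth ?D k)) * ?E) n = fps_nth 2 n"
      unfolding DE by (simp add: fps_numeral_nth)
  qed
  hence "Abs_fps (\<lambda>k. cnj (fps_nth ?D k)) * ?E = ?D * ?E" using DE by simp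
  moreover have "?E \<noteq> 0" using nz by (metis fps_zero_nth)
  ultimately have "Abs_fps (\<lambda>k. cnj (fps_nth ?D k)) = ?D" by (metis mult_right_cancel)
  thus ?thesis by (metis fps_nth_Abs_fps)
qed

lemma poly_euler_poly_cnj: "poly (euler_poly n) (cnj x) = cnj (poly (euler_poly n) x)"
proof -
  have *: "poly (euler_poly n) x =
    fact n * (\<Sum>i=0..n. fps_nth (2 / (fps_exp 1 + 1)) i * (x ^ (n - i) / fact (n - i)))" for x
  proof -
    have nz: "fps_nth (fps_exp 1 + 1 :: complex fps) 0 \<noteq> 0" by simp
    have "2 * fps_exp x / (fps_exp 1 + 1) = (2 / (fps_exp 1 + 1)) * fps_exp x"
      using nz by (simp add: fps_divide_unit mult_ac)
    thus ?thesis by (simp add: poly_euler_poly fps_mult_nth)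
  qed
  show ?thesis unfolding * by (simp add: fps_nth_euler_generating_real)
qed

lemma poly_euler_scaled_cnj: "poly (euler_poly_scaled n) (cnj x) = cnj (poly (euler_poly_scaled n) x)"
  using poly_euler_poly_cnj[of n "of_nat n * x"] by (simp add: poly_euler_poly_scaled)

lemma card_euler_zeros_cnj:
  "card {x. poly (euler_poly_scaled n) x = 0 \<and> P (cnj x)} = card {x. poly (euler_poly_scaled n) x = 0 \<and> P x}"
proof -
  have "bij_betw cnj {x. poly (euler_poly_scaled n) x = 0 \<and> P (cnj x)} {x. poly (euler_poly_scaled n) x = 0 \<and> P x}"
    by (rule bij_betwI[of _ _ _ cnj]) (auto simp: poly_euler_scaled_cnj)
  thus ?thesis by (rule bij_betw_same_card)
qed

section \<open>Zeros on the real segment\<close>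

lemma exp_tail_bound:
  assumes "n > 0" "norm z \<le> 1 / 2"
  shows "norm (exp_tail n (of_nat n * z)) \<le> (exp 1 * norm z) ^ n"
proof -
  have 1: "norm (tail_series n z) \<le> 1"
  proof -
    have "norm (tail_series n z) \<le> norm z / (1 - norm z)" using assms by (intro tail_series_bound) auto
    also have "\<dots> \<le> 1" using assms by (simp add: divide_simps)
    finally show ?thesis .
  qed
  have "real n ^ n / fact n = stirling_ratio n * exp 1 ^ n"
    by (simp add: stirling_ratio_def exp_minus exp_of_nat_mult[symmetric] field_simps)
  also have "\<dots> \<le> 1 * exp 1 ^ n" using stirling_ratio_bounds[OF assms(1)] by (intro mult_right_mono) auto
  finally have 2: "real n ^ n / fact n \<le> exp 1 ^ n" by simp
  have "norm (exp_tail n (of_nat n * z)) = (real n ^ n / fact n) * norm z ^ n * norm (tail_series n z)"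
    by (simp add: exp_tail_eq norm_mult norm_divide norm_power power_mult_distrib)
  also have "\<dots> \<le> exp 1 ^ n * norm z ^ n * 1" using 1 2 by (intro mult_mono) auto
  finally show ?thesis by (simp add: power_mult_distrib)
qed

text \<open>Cauchy-type estimates \<open>C / R^k\<close> for the coefficients and completion of the
  exponential sum give \<open>(\<pi>/R)^n e^(R n \<bar>x\<bar>)\<close>. With
  \<open>R = e \<pi>\<close> the base is below 1 exactly for
  \<open>\<bar>x\<bar> < 1/(\<pi>e)\<close>. Unlike the saddle form, this covers
  \<open>x = 0\<close>.\<close>

lemma remainder_sum_bound:
  assumes "n > 0"
  defines "R \<equiv> exp 1 * pi"
  defines "C \<equiv> (\<Sum>k. norm (fps_nth euler_remainder k) * R ^ k)"
  shows "norm ((of_real pi * \<i>) ^ Suc n / 2 *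
     (\<Sum>k\<le>n. fps_nth euler_remainder k * (of_nat n * x) ^ (n - k) / fact (n - k)))
    \<le> pi * C / 2 * exp (exp 1 * pi * norm x - 1) ^ n"
proof -
  have R: "R > 0" "R < 3 * pi" using e_less_272 by (auto simp: R_def)
  have C0: "C \<ge> 0" unfolding C_def using R
    by (intro suminf_nonneg remainder_coeffs_summable) auto
  have g: "norm (fps_nth euler_remainder k) \<le> C / R ^ k" for k
  proof -
    have "(\<Sum>i\<in>{k}. norm (fps_nth euler_remainder i) * R ^ i) \<le> C"
      unfolding C_def using R by (intro sum_le_suminf remainder_coeffs_summable) auto
    thus ?thesis using R by (simp add: field_simps)
  qed
  define y where "y = real n * norm x"
  have y: "y \<ge> 0" by (simp add: y_def)
  have "norm (\<Sum>k\<le>n. fps_nth euler_remainder k * (of_nat n * x) ^ (n - k) / fact (n - k))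
     \<le> (\<Sum>k\<le>n. norm (fps_nth euler_remainder k) * (y ^ (n - k) / fact (n - k)))"
    by (rule order_trans[OF norm_sum])
       (simp add: norm_mult norm_divide norm_power power_mult_distrib y_def)
  also have "\<dots> \<le> (\<Sum>k\<le>n. C / R ^ k * (y ^ (n - k) / fact (n - k)))"
    using y by (intro sum_mono mult_right_mono g) auto
  also have "\<dots> = (\<Sum>k\<le>n. C / R ^ (n - k) * (y ^ k / fact k))"
    by (rule sum.reindex_bij_witness[of _ "\<lambda>k. n - k" "\<lambda>k. n - k"]) auto
  also have "\<dots> = (\<Sum>k\<le>n. C / R ^ n * ((R * y) ^ k / fact k))"
  proof (intro sum.cong refl)
    fix k assume "k \<in> {..n}"
    hence "R ^ n = R ^ (n - k) * R ^ k" by (simp flip: power_add)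
    thus "C / R ^ (n - k) * (y ^ k / fact k) = C / R ^ n * ((R * y) ^ k / fact k)"
      using R by (simp add: power_mult_distrib)
  qed
  also have "\<dots> = C / R ^ n * (\<Sum>k\<le>n. (R * y) ^ k / fact k)" by (simp add: sum_distrib_left)
  also have "\<dots> \<le> C / R ^ n * exp (R * y)"
  proof (intro mult_left_mono)
    have s: "(\<lambda>k. (R * y) ^ k / fact k) sums exp (R * y)"
      using exp_converges[of "R * y"] by (simp add: field_simps)
    show "(\<Sum>k\<le>n. (R * y) ^ k / fact k) \<le> exp (R * y)"
      using sum_le_suminf[OF sums_summable[OF s], of "{..n}"] s R y by (simp add: sums_iff)
  qed (use C0 R in auto)
  finally have main: "norm (\<Sum>k\<le>n. fps_nth euler_remainder k * (of_nat n * x) ^ (n - k) / fact (n - k))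
      \<le> C / R ^ n * exp (R * y)" .
  have "norm ((of_real pi * \<i>) ^ Suc n / 2 *
     (\<Sum>k\<le>n. fps_nth euler_remainder k * (of_nat n * x) ^ (n - k) / fact (n - k)))
    \<le> pi ^ Suc n / 2 * (C / R ^ n * exp (R * y))"
    unfolding norm_mult by (intro mult_mono main) (auto simp: norm_mult norm_divide norm_power)
  also have "\<dots> = pi * C / 2 * ((pi / R) ^ n * exp (R * y))"
    by (simp add: power_divide)
  also have "(pi / R) ^ n * exp (R * y) = exp (exp 1 * pi * norm x - 1) ^ n"
  proof -
    have "pi / R = exp (-1)" by (simp add: R_def exp_minus field_simps)
    moreover have "exp (R * y) = exp (exp 1 * pi * norm x) ^ n"
      by (simp add: R_def y_def exp_of_nat_mult[symmetric] mult_ac)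
    ultimately show ?thesis
      by (simp add: power_mult_distrib[symmetric] exp_add[symmetric])
  qed
  finally show ?thesis .
qed

text \<open>Here \<open>\<bar>z\<bar> < 1/e\<close>, and tails and remainder decay geometrically
  next to the two exponentials. The threshold 2 is the amplitude of the sum of these exponentials,
  so a smaller error cannot change its sign at an extremum.\<close>

lemma euler_norm_real_approx:
  assumes r: "0 \<le> r" "r < 1 / (pi * exp 1)"
  shows "\<forall>\<^sub>F n in sequentially. \<forall>x::real. \<bar>x\<bar> \<le> r \<longrightarrow>
    norm (euler_norm n (of_real pi * \<i> * of_real x) - exp (\<i> * of_real (pi * real n * x))
       - (-1) ^ Suc n * exp (- (\<i> * of_real (pi * real n * x)))) < 2"
proof -
  define R where "R = exp 1 * pi"
  define C where "C = (\<Sum>k. norm (fps_nth euler_remainder k) * R ^ k)"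
  define q where "q = exp 1 * (pi * r)"
  have q: "0 \<le> q" "q < 1" using r by (simp_all add: q_def field_simps)
  have half: "pi * r \<le> 1 / 2"
  proof -
    have "exp 1 \<ge> (2::real)" using exp_ge_add_one_self[of 1] by simp
    hence "2 * (pi * r) \<le> q" unfolding q_def using r by (intro mult_right_mono) auto
    thus ?thesis using q by simp
  qed
  have "(\<lambda>n. 2 * q ^ n + pi * C / 2 * exp (q - 1) ^ n) \<longlonglongrightarrow> 2 * 0 + pi * C / 2 * 0"
    using q by (intro tendsto_intros LIMSEQ_realpow_zero) auto
  hence lim: "(\<lambda>n. 2 * q ^ n + pi * C / 2 * exp (q - 1) ^ n) \<longlonglongrightarrow> 0" by simp
  have R: "R > 0" "R < 3 * pi" using e_less_272 by (auto simp: R_def)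
  have C0: "C \<ge> 0" unfolding C_def using R
    by (intro suminf_nonneg remainder_coeffs_summable) auto
  have "\<forall>\<^sub>F n in sequentially. 2 * q ^ n + pi * C / 2 * exp (q - 1) ^ n < 2"
    by (rule order_tendstoD(2)[OF lim]) simp
  with eventually_gt_at_top[of 0] show ?thesis
  proof (eventually_elim, safe)
    fix n :: nat and x :: real
    assume n: "n > 0" "2 * q ^ n + pi * C / 2 * exp (q - 1) ^ n < 2" and x: "\<bar>x\<bar> \<le> r"
    define a where "a = of_real pi * \<i>"
    define z where "z = a * of_real x"
    define S where "S = a ^ Suc n / 2 * (\<Sum>k\<le>n. fps_nth euler_remainder k * (of_nat n * of_real x) ^ (n - k) / fact (n - k))"
    have nz: "norm z = pi * \<bar>x\<bar>" by (simp add: z_def a_def norm_mult)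
    hence nz': "norm z \<le> pi * r" using x by simp
    have "euler_norm n z = poly (euler_poly_scaled n) (of_real x) / fact n * a ^ Suc n / 2"
      by (simp add: euler_norm_def z_def a_def)
    also have "\<dots> = exp (of_nat n * z) + (-1) ^ Suc n * exp (- (of_nat n * z))
         - exp_tail n (of_nat n * z) - (-1) ^ Suc n * exp_tail n (- (of_nat n * z)) + S"
      unfolding a_def z_def S_def by (rule poly_euler_decomposition)
    finally have E: "euler_norm n z - exp (of_nat n * z) - (-1) ^ Suc n * exp (- (of_nat n * z))
      = - exp_tail n (of_nat n * z) - (-1) ^ Suc n * exp_tail n (of_nat n * (-z)) + S"
      by (simp add: algebra_simps)
    have tail: "norm (exp_tail n (of_nat n * w)) \<le> q ^ n" if "norm w = norm z" for w
    proof -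
      have "norm (exp_tail n (of_nat n * w)) \<le> (exp 1 * norm w) ^ n"
        using that nz' half n by (intro exp_tail_bound) auto
      also have "\<dots> \<le> q ^ n"
        unfolding q_def using that nz' by (intro power_mono mult_left_mono) auto
      finally show ?thesis .
    qed
    have "norm S \<le> pi * C / 2 * exp (exp 1 * pi * norm (complex_of_real x) - 1) ^ n"
      unfolding S_def a_def C_def R_def by (rule remainder_sum_bound[OF n(1)])
    also have "\<dots> \<le> pi * C / 2 * exp (q - 1) ^ n"
      using x C0 by (intro mult_left_mono power_mono) (auto simp: q_def)
    finally have S: "norm S \<le> pi * C / 2 * exp (q - 1) ^ n" .
    have tri: "norm (- A - s * B + D) \<le> norm A + norm B + norm D" if "norm s = 1" for A B D s :: complex
      using norm_triangle_ineq[of "- A - s * B" D] norm_triangle_ineq4[of "- A" "s * B"] that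
      by (simp add: norm_mult)
    have "norm (euler_norm n z - exp (of_nat n * z) - (-1) ^ Suc n * exp (- (of_nat n * z)))
       \<le> norm (exp_tail n (of_nat n * z)) + norm (exp_tail n (of_nat n * (-z))) + norm S"
      unfolding E by (rule tri) (simp add: norm_power)
    also have "\<dots> < 2" using tail[of z] tail[of "-z"] S n by simp
    finally show "norm (euler_norm n (of_real pi * \<i> * of_real x) - exp (\<i> * of_real (pi * real n * x))
       - (-1) ^ Suc n * exp (- (\<i> * of_real (pi * real n * x)))) < 2"
      by (simp add: z_def a_def mult_ac)
  qed
qed

text \<open>At the points \<open>X m\<close> the cosine is \<open>(-1)^m\<close>, and the error is
  smaller than the amplitude. Hence \<open>p\<close> changes sign between neighbouring points, which
  are \<open>1/n\<close> apart.\<close>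

lemma card_real_zeros:
  assumes r: "0 < r" "r < 1 / (pi * exp 1)"
  shows "\<forall>\<^sub>F n in sequentially. 2 * r * real n - 3 \<le>
    real (card {x. poly (euler_poly_scaled n) x = 0 \<and> Im x = 0 \<and> \<bar>Re x\<bar> \<le> r})"
  using euler_norm_real_approx[OF less_imp_le[OF r(1)] r(2)] eventually_gt_at_top[of 0]
proof eventually_elim
  case (elim n)
  define p where "p = (\<lambda>x. poly (euler_poly_scaled n) (complex_of_real x))"
  \<comment> \<open>The argument of \<open>\<i>^(n+1)\<close>: rotating by \<open>cis (-s)\<close>
    makes the normalising factor real and turns the two exponentials into a cosine with phase shift
    \<open>s\<close>.\<close>
  define s where "s = real (Suc n) * pi / 2"
  define X where "X = (\<lambda>m::int. (of_int m + real (Suc n) / 2) / real n)"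
  have real: "p x = of_real (Re (p x))" for x
    using poly_euler_scaled_cnj[of n "of_real x"]
    by (simp add: p_def complex_eq_iff)
  have cis: "cis (- s) * (of_real pi * \<i>) ^ Suc n = of_real (pi ^ Suc n)"
  proof -
    have "\<i> ^ Suc n = cis s" 
      using Complex.DeMoivre[of "pi / 2" "Suc n"] by (simp add: s_def mult_ac del: power_Suc)
    thus ?thesis by (simp add: power_mult_distrib cis_mult del: power_Suc)
  qed
  have approx: "\<bar>Re (p x) * (pi ^ Suc n / (2 * fact n)) - 2 * cos (pi * real n * x - s)\<bar> < 2" if "\<bar>x\<bar> \<le> r" for x
  proof -
    define t where "t = pi * real n * x"
    have "euler_norm n (of_real pi * \<i> * of_real x) = p x / fact n * (of_real pi * \<i>) ^ Suc n / 2"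
      by (simp add: euler_norm_def p_def)
    hence 1: "cis (- s) * euler_norm n (of_real pi * \<i> * of_real x) = of_real (Re (p x) * (pi ^ Suc n / (2 * fact n)))"
      using cis by (subst (asm) real) (simp add: field_simps del: power_Suc)
    have "cis (2 * s) = cis pi ^ Suc n" unfolding Complex.DeMoivre by (simp add: s_def)
    hence m1: "(-1) ^ Suc n = cis (2 * s)" by simp
    have 2: "cis (- s) * (exp (\<i> * of_real t) + (-1) ^ Suc n * exp (- (\<i> * of_real t))) = of_real (2 * cos (t - s))"
    proof -
      have "exp (- (\<i> * of_real t)) = cis (- t)" by (simp add: cis_conv_exp)
      hence "cis (- s) * (exp (\<i> * of_real t) + (-1) ^ Suc n * exp (- (\<i> * of_real t))) = cis (t - s) + cis (s - t)"
        unfolding m1 by (simp add: cis_conv_exp[symmetric] distrib_left cis_mult algebra_simps)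
      also have "\<dots> = of_real (2 * cos (t - s))"
        using cos_minus[of "t - s"] sin_minus[of "t - s"] by (simp add: complex_eq_iff)
      finally show ?thesis .
    qed
    have "norm (cis (- s) * (euler_norm n (of_real pi * \<i> * of_real x) - exp (\<i> * of_real t)
       - (-1) ^ Suc n * exp (- (\<i> * of_real t)))) < 2"
      unfolding norm_mult using elim(1) that by (simp add: t_def)
    also have "cis (- s) * (euler_norm n (of_real pi * \<i> * of_real x) - exp (\<i> * of_real t)
       - (-1) ^ Suc n * exp (- (\<i> * of_real t)))
      = of_real (Re (p x) * (pi ^ Suc n / (2 * fact n)) - 2 * cos (t - s))"
    proof -
      have "cis (- s) * (N - A - B) = cis (- s) * N - cis (- s) * (A + B)" for N A B
        by (simp add: algebra_simps)
      thus ?thesis by (simp only: 1 2 of_real_diff)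
    qed
    finally show ?thesis by (simp only: norm_of_real t_def)
  qed
  have sign: "0 < (-1) powi m * Re (p (X m))" if "\<bar>X m\<bar> \<le> r" for m
  proof -
    have "pi * real n * X m - s = pi * of_int m"
      using elim(2) by (simp add: X_def s_def field_simps)
    hence "cos (pi * real n * X m - s) = (-1) powi m"
      by (simp only: cos_npi_int) (simp add: power_int_minus_left)
    hence a: "\<bar>Re (p (X m)) * (pi ^ Suc n / (2 * fact n)) - 2 * (-1) powi m\<bar> < 2"
      using approx[OF that] by simp
    have "(-1) powi m = (1::real) \<or> (-1) powi m = (-1::real)"
      by (cases "even m") (auto simp: power_int_minus_left)
    hence "0 < ((-1) powi m * Re (p (X m))) * (pi ^ Suc n / (2 * fact n))" using a by auto
    thus ?thesis by (rule zero_less_mult_pos2) simp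
  qed
  \<comment> \<open>The last index is dropped because \<open>X (m + 1)\<close> must stay in
    \<open>[-r, r]\<close> as well.\<close>
  define I where "I = {\<lceil>- r * real n - real (Suc n) / 2\<rceil>..\<lfloor>r * real n - real (Suc n) / 2\<rfloor> - 1}"
  have I: "\<bar>X m\<bar> \<le> r" "\<bar>X (m + 1)\<bar> \<le> r" if "m \<in> I" for m
  proof -
    have *: "\<lceil>- r * real n - real (Suc n) / 2\<rceil> \<le> m" "m + 1 \<le> \<lfloor>r * real n - real (Suc n) / 2\<rfloor>"
      using that unfolding I_def by auto
    have "- r * real n - real (Suc n) / 2 \<le> of_int m" "of_int (m + 1) \<le> r * real n - real (Suc n) / 2"
      using *(1)[unfolded ceiling_le_iff] *(2)[unfolded le_floor_iff] .
    thus "\<bar>X m\<bar> \<le> r" "\<bar>X (m + 1)\<bar> \<le> r"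
      using elim(2) by (auto simp: X_def abs_le_iff divide_simps mult.commute)
  qed
  have Xmono: "X m \<le> X m'" if "m \<le> m'" for m m'
    using that by (simp add: X_def divide_right_mono)
  have "\<exists>y. X m < y \<and> y < X (m + 1) \<and> p y = 0" if m: "m \<in> I" for m
  proof -
    define h where "h = (\<lambda>y. (-1) powi m * Re (p y))"
    have pos: "h (X m) > 0" using sign[OF I(1)[OF m]] by (simp add: h_def)
    have neg: "h (X (m + 1)) < 0"
      using sign[OF I(2)[OF m]] by (simp add: h_def power_int_add)
    have "continuous_on {X m..X (m + 1)} h"
      unfolding h_def p_def by (intro continuous_intros)
    then obtain y where y: "X m \<le> y" "y \<le> X (m + 1)" "h y = 0"
      using IVT2'[of h "X (m + 1)" 0 "X m"] pos neg Xmono[of m "m + 1"] by auto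
    have "y \<noteq> X m" "y \<noteq> X (m + 1)" using y(3) pos neg by auto
    moreover have "Re (p y) = 0" using y(3) by (simp add: h_def)
    hence "p y = 0" using real[of y] by simp
    ultimately show ?thesis using y by (intro exI[of _ y]) auto
  qed
  then obtain y where y: "\<And>m. m \<in> I \<Longrightarrow> X m < y m" "\<And>m. m \<in> I \<Longrightarrow> y m < X (m + 1)" "\<And>m. m \<in> I \<Longrightarrow> p (y m) = 0"
    by metis
  have inj: "inj_on (\<lambda>m. complex_of_real (y m)) I"
  proof (rule linorder_inj_onI')
    fix m m' assume m: "m \<in> I" "m' \<in> I" "m < m'"
    have "y m < X (m + 1)" "X (m + 1) \<le> X m'" "X m' < y m'" using m y Xmono by auto
    thus "complex_of_real (y m) \<noteq> complex_of_real (y m')" by simp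
  qed
  have "(\<lambda>m. complex_of_real (y m)) ` I \<subseteq> {x. poly (euler_poly_scaled n) x = 0 \<and> Im x = 0 \<and> \<bar>Re x\<bar> \<le> r}"
  proof safe
    fix m assume m: "m \<in> I"
    show "poly (euler_poly_scaled n) (complex_of_real (y m)) = 0" using y(3)[OF m] by (simp add: p_def)
    show "\<bar>Re (complex_of_real (y m))\<bar> \<le> r" using y(1,2)[OF m] I[OF m] by auto
  qed auto
  from card_mono[OF finite_euler_roots this]
  have "card I \<le> card {x. poly (euler_poly_scaled n) x = 0 \<and> Im x = 0 \<and> \<bar>Re x\<bar> \<le> r}"
    unfolding card_image[OF inj] .
  moreover have "real (card I) \<ge> 2 * r * real n - 3"
    unfolding I_def by simp linarith
  ultimately show ?case by linarith
qed

subsection \<open>Geometry of the arc\<close>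

text \<open>The Szego curve \<open>\<bar>z e^(1-z)\<bar> = 1\<close>, parametrised by \<open>\<rho> = \<bar>z\<bar>\<close>: there
  \<open>\<rho> cos \<theta> = Re z = 1 + ln \<rho>\<close>.\<close>
definition szego_angle :: "real \<Rightarrow> real" where
  "szego_angle \<rho> = arccos ((1 + ln \<rho>) / \<rho>)"

definition szego_point :: "real \<Rightarrow> complex" where
  "szego_point \<rho> = of_real \<rho> * cis (szego_angle \<rho>)"

text \<open>On the curve \<open>\<zeta>\<close> has modulus 1, and this is its argument
  \<open>arg z - Im z\<close>.\<close>

definition szego_phase :: "real \<Rightarrow> real" where
  "szego_phase \<rho> = szego_angle \<rho> - \<rho> * sin (szego_angle \<rho>)"

definition arc_point :: "real \<Rightarrow> complex" where
  "arc_point \<rho> = szego_point \<rho> / (of_real pi * \<i>)"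

lemma szego_ratio_bounds:
  fixes \<rho> :: real
  assumes "exp (-1) \<le> \<rho>" "\<rho> \<le> 1"
  shows "\<rho> > 0" "0 \<le> (1 + ln \<rho>) / \<rho>" "(1 + ln \<rho>) / \<rho> \<le> 1"
proof -
  show \<rho>: "\<rho> > 0" using assms(1) exp_gt_zero[of "-1::real"] by linarith
  have "ln \<rho> \<ge> -1" using assms \<rho> by (simp add: ln_ge_iff)
  thus "0 \<le> (1 + ln \<rho>) / \<rho>" using \<rho> by simp
  show "(1 + ln \<rho>) / \<rho> \<le> 1" using ln_le_minus_one[OF \<rho>] \<rho> by (simp add: divide_simps)
qed

lemma szego_ratio_strict:
  fixes \<rho> :: real
  assumes "exp (-1) < \<rho>" "\<rho> < 1"
  shows "0 < (1 + ln \<rho>) / \<rho>" "(1 + ln \<rho>) / \<rho> < 1"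
proof -
  have \<rho>: "\<rho> > 0" using assms(1) exp_gt_zero[of "-1::real"] by linarith
  have "ln (exp (-1)) < ln \<rho>" using assms(1) \<rho> by (subst ln_less_cancel_iff) auto
  thus "0 < (1 + ln \<rho>) / \<rho>" using \<rho> by simp
  have "ln \<rho> < \<rho> - 1"
    using ln_le_minus_one[OF \<rho>] ln_eq_minus_one[OF \<rho>] assms by fastforce
  thus "(1 + ln \<rho>) / \<rho> < 1" using \<rho> by (simp add: divide_simps)
qed

lemma szego_angle_props:
  assumes "exp (-1) \<le> \<rho>" "\<rho> \<le> 1"
  shows "0 \<le> szego_angle \<rho>" "szego_angle \<rho> \<le> pi / 2" "\<rho> * cos (szego_angle \<rho>) = 1 + ln \<rho>"
proof -
  note b = szego_ratio_bounds[OF assms]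
  show "szego_angle \<rho> \<le> pi / 2"
    unfolding szego_angle_def by (rule arccos_le_pi2[OF b(2,3)])
  show "0 \<le> szego_angle \<rho>"
    unfolding szego_angle_def using b by (intro arccos_lbound) auto
  show "\<rho> * cos (szego_angle \<rho>) = 1 + ln \<rho>"
    unfolding szego_angle_def using b by (subst cos_arccos) auto
qed

lemma szego_angle_strict:
  assumes "exp (-1) < \<rho>" "\<rho> < 1"
  shows "0 < szego_angle \<rho>" "szego_angle \<rho> < pi / 2"
proof -
  note b = szego_ratio_strict[OF assms]
  have "arccos 1 < arccos ((1 + ln \<rho>) / \<rho>)" "arccos ((1 + ln \<rho>) / \<rho>) < arccos 0"
    using b by (auto intro!: arccos_less_mono[THEN iffD2] simp del: arccos_0 arccos_1)
  thus "0 < szego_angle \<rho>" "szego_angle \<rho> < pi / 2" by (auto simp: szego_angle_def)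
qed

lemma szego_angle_endpoints: "szego_angle 1 = 0" "szego_angle (exp (-1)) = pi / 2"
  by (simp_all add: szego_angle_def)

lemma continuous_on_szego_angle: "continuous_on {exp (-1)..1} szego_angle"
  unfolding szego_angle_def
  using szego_ratio_bounds by (intro continuous_intros) fastforce+

lemma continuous_on_szego_point: "continuous_on {exp (-1)..1} szego_point"
  unfolding szego_point_def by (intro continuous_intros continuous_on_szego_angle)

lemma continuous_on_arc_point: "continuous_on {exp (-1)..1} arc_point"
  unfolding arc_point_def by (intro continuous_intros continuous_on_szego_point) simp

lemma continuous_on_szego_phase: "continuous_on {exp (-1)..1} szego_phase"
  unfolding szego_phase_def by (intro continuous_intros continuous_on_szego_angle)

lemma szego_point_parts:
  "Re (szego_point \<rho>) = \<rho> * cos (szego_angle \<rho>)" "Im (szego_point \<rho>) = \<rho> * sin (szego_angle \<rho>)"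
  by (simp_all add: szego_point_def)

lemma norm_szego_point: "\<rho> \<ge> 0 \<Longrightarrow> norm (szego_point \<rho>) = \<rho>"
  by (simp add: szego_point_def norm_mult)

lemma norm_arc_point: "\<rho> \<ge> 0 \<Longrightarrow> norm (arc_point \<rho>) = \<rho> / pi"
  by (simp add: arc_point_def norm_divide norm_mult norm_szego_point)

lemma arc_point_parts:
  "Re (arc_point \<rho>) = \<rho> * sin (szego_angle \<rho>) / pi" "Im (arc_point \<rho>) = - (\<rho> * cos (szego_angle \<rho>) / pi)"
  by (simp_all add: arc_point_def Re_divide Im_divide szego_point_parts power2_eq_square)

lemma zeta_map_arc_point:
  assumes "exp (-1) \<le> \<rho>" "\<rho> \<le> 1"
  shows "zeta_map (arc_point \<rho>) = cis (szego_phase \<rho>)"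
proof -
  note b = szego_ratio_bounds[OF assms] szego_angle_props[OF assms]
  have z: "of_real pi * \<i> * arc_point \<rho> = szego_point \<rho>" by (simp add: arc_point_def)
  have "exp (1 - szego_point \<rho>) = of_real (exp (1 - \<rho> * cos (szego_angle \<rho>))) * cis (- (\<rho> * sin (szego_angle \<rho>)))"
    by (simp add: exp_eq_polar szego_point_parts)
  also have "exp (1 - \<rho> * cos (szego_angle \<rho>)) = 1 / \<rho>"
    using b by (simp add: exp_minus field_simps)
  finally show ?thesis
    using b(1) unfolding zeta_map_def z Let_def
    by (simp add: szego_point_def szego_phase_def cis_mult)
qed

lemma arc_point_in_BC:
  assumes "exp (-1) \<le> \<rho>" "\<rho> \<le> 1"
  shows "arc_point \<rho> \<in> BC"
proof -
  note b = szego_ratio_bounds[OF assms] szego_angle_props[OF assms]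
  have "0 \<le> cos (szego_angle \<rho>)" using b by (intro cos_ge_zero) linarith+
  hence "0 \<le> \<rho> * cos (szego_angle \<rho>)" using b(1) by (intro mult_nonneg_nonneg) linarith+
  moreover have "0 \<le> \<rho> * sin (szego_angle \<rho>)"
    using b by (intro mult_nonneg_nonneg sin_ge_zero) linarith+
  ultimately show ?thesis
    using assms b unfolding BC_def
    by (simp add: norm_arc_point arc_point_parts zeta_map_arc_point divide_right_mono)
qed

text \<open>The condition \<open>\<bar>\<zeta>\<bar> = 1\<close> reads
  \<open>\<rho> e^(1 - Re z) = 1\<close>, so \<open>\<rho>\<close> determines
  \<open>Re z = 1 + ln \<rho>\<close>; the quadrant then fixes the sign of
  \<open>Im z\<close>.\<close>

lemma BC_subset_arc_point:
  assumes "x \<in> BC"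
  shows "exp (-1) \<le> pi * norm x" "pi * norm x \<le> 1" "x = arc_point (pi * norm x)"
proof -
  define z where "z = of_real pi * \<i> * x"
  define \<rho> where "\<rho> = pi * norm x"
  have nz: "norm z = \<rho>" by (simp add: z_def \<rho>_def norm_mult)
  have z: "Re z \<ge> 0" "Im z \<ge> 0" "norm (z * exp (1 - z)) = 1" "\<rho> \<le> 1"
    using assms by (auto simp: BC_def z_def zeta_map_def \<rho>_def field_simps mult_nonneg_nonpos)
  have eq: "\<rho> * exp (1 - Re z) = 1" using z(3) by (simp add: norm_mult nz)
  have \<rho>0: "\<rho> > 0" using eq nz by (metis mult_zero_left norm_ge_zero order_le_less zero_neq_one)
  have "exp (Re z - 1) = \<rho>" using eq by (simp add: exp_diff field_simps)
  hence re: "Re z = 1 + ln \<rho>" by (metis ln_exp diff_add_cancel add.commute)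
  show 1: "exp (-1) \<le> \<rho>" using z(1) re \<rho>0 by (simp add: ln_ge_iff[symmetric])
  show 2: "\<rho> \<le> 1" by fact
  have "Re (szego_point \<rho>) = Re z" 
    using szego_angle_props(3)[OF 1 2] re by (simp add: szego_point_parts)
  moreover have "Im (szego_point \<rho>) = Im z"
  proof -
    have "(Im (szego_point \<rho>))\<^sup>2 = (Im z)\<^sup>2"
      using norm_szego_point[of \<rho>] nz \<rho>0 cmod_power2[of z] cmod_power2[of "szego_point \<rho>"] \<open>Re (szego_point \<rho>) = Re z\<close>
      by simp
    moreover have "Im (szego_point \<rho>) \<ge> 0"
      using szego_angle_props[OF 1 2] \<rho>0 by (simp add: szego_point_parts sin_ge_zero)
    ultimately show ?thesis using z(2) power2_eq_imp_eq by blast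
  qed
  ultimately have "szego_point \<rho> = z" by (simp add: complex_eq_iff)
  thus "x = arc_point \<rho>" by (simp add: arc_point_def z_def)
qed

lemma BC_eq: "BC = arc_point ` {exp (-1)..1}"
  using arc_point_in_BC BC_subset_arc_point by (auto simp: image_iff) (metis atLeastAtMost_iff)

lemma BC_nonempty: "BC \<noteq> {}"
  unfolding BC_eq by simp

lemma szego_phase_endpoints: "szego_phase 1 = 0" "szego_phase (exp (-1)) = pi / 2 - 1 / exp 1"
  by (simp_all add: szego_phase_def szego_angle_endpoints) (simp add: exp_minus inverse_eq_divide)

section \<open>Monotonicity along the arc\<close>

lemma szego_angle_deriv:
  assumes "exp (-1) < \<rho>" "\<rho> < 1"
  shows "(szego_angle has_real_derivative ln \<rho> / (\<rho>\<^sup>2 * sin (szego_angle \<rho>))) (at \<rho>)"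
proof -
  have \<rho>: "\<rho> > 0" using assms(1) exp_gt_zero[of "-1::real"] by linarith
  note b = szego_ratio_strict[OF assms]
  have s: "sin (szego_angle \<rho>) = sqrt (1 - ((1 + ln \<rho>) / \<rho>)\<^sup>2)"
    unfolding szego_angle_def using b by (intro sin_arccos) auto
  have "((\<lambda>\<rho>. (1 + ln \<rho>) / \<rho>) has_real_derivative - ln \<rho> / \<rho>\<^sup>2) (at \<rho>)"
    using \<rho> by (auto intro!: derivative_eq_intros simp: field_simps power2_eq_square)
  moreover have "(arccos has_real_derivative inverse (- sqrt (1 - ((1 + ln \<rho>) / \<rho>)\<^sup>2))) (at ((1 + ln \<rho>) / \<rho>))"
    using b by (intro DERIV_arccos) auto
  ultimately have "((\<lambda>\<rho>. arccos ((1 + ln \<rho>) / \<rho>)) has_real_derivative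
      inverse (- sqrt (1 - ((1 + ln \<rho>) / \<rho>)\<^sup>2)) * (- ln \<rho> / \<rho>\<^sup>2)) (at \<rho>)"
    by (rule DERIV_chain2[rotated])
  thus ?thesis unfolding szego_angle_def[abs_def] s[unfolded szego_angle_def]
    by (simp add: divide_inverse mult_ac)
qed

text \<open>The derivative is \<open>D (1 - \<rho> cos \<theta>) - sin \<theta>\<close> with
  \<open>D < 0\<close> the derivative of the angle, and
  \<open>1 - \<rho> cos \<theta> = -ln \<rho>\<close> is positive.\<close>

lemma szego_phase_strict_antimono:
  assumes "exp (-1) \<le> \<rho>1" "\<rho>1 < \<rho>2" "\<rho>2 \<le> 1"
  shows "szego_phase \<rho>2 < szego_phase \<rho>1"
proof (rule DERIV_neg_imp_decreasing_open[OF assms(2)])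
  fix \<rho> assume "\<rho>1 < \<rho>" "\<rho> < \<rho>2"
  hence \<rho>: "exp (-1) < \<rho>" "\<rho> < 1" using assms by auto
  have \<rho>0: "\<rho> > 0" using \<rho>(1) exp_gt_zero[of "-1::real"] by linarith
  define \<theta> where "\<theta> = szego_angle \<rho>"
  have s: "sin \<theta> > 0" using szego_angle_strict[OF \<rho>] by (auto simp: \<theta>_def intro!: sin_gt_zero)
  have c: "\<rho> * cos \<theta> = 1 + ln \<rho>" unfolding \<theta>_def using \<rho> by (intro szego_angle_props) auto
  define D where "D = ln \<rho> / (\<rho>\<^sup>2 * sin \<theta>)"
  have d: "(szego_phase has_real_derivative D - (sin \<theta> + \<rho> * (cos \<theta> * D))) (at \<rho>)"
    unfolding szego_phase_def[abs_def] D_def \<theta>_def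
    by (auto intro!: derivative_eq_intros szego_angle_deriv[OF \<rho>])
  have "ln \<rho> < 0" using \<rho>0 \<rho> by simp
  hence "D < 0" using s \<rho>0 by (simp add: D_def divide_neg_pos)
  moreover have "0 \<le> 1 - \<rho> * cos \<theta>" using c \<open>ln \<rho> < 0\<close> by simp
  hence "D * (1 - \<rho> * cos \<theta>) \<le> 0" using \<open>D < 0\<close> by (simp add: mult_nonpos_nonneg)
  moreover have "D - (sin \<theta> + \<rho> * (cos \<theta> * D)) = D * (1 - \<rho> * cos \<theta>) - sin \<theta>"
    by (simp add: algebra_simps)
  ultimately have "D - (sin \<theta> + \<rho> * (cos \<theta> * D)) < 0" using s by linarith
  with d show "\<exists>y. DERIV szego_phase \<rho> :> y \<and> y < 0" by blast
next
  show "continuous_on {\<rho>1..\<rho>2} szego_phase"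
    by (rule continuous_on_subset[OF continuous_on_szego_phase]) (use assms in auto)
qed

text \<open>On the mirror image of the arc in the real axis the argument of \<open>\<zeta>\<close> is \<open>\<pi>\<close> minus this sum, so
  the bound keeps the zeros there out of the sector \<open>arg \<zeta> \<le> \<pi>/2 - 1/e\<close>.\<close>
lemma szego_sum_less:
  assumes "exp (-1) < \<rho>" "\<rho> \<le> 1"
  shows "szego_angle \<rho> + \<rho> * sin (szego_angle \<rho>) < pi / 2 + exp (-1)"
proof -
  let ?f = "\<lambda>\<rho>. szego_angle \<rho> + \<rho> * sin (szego_angle \<rho>)"
  have "?f \<rho> < ?f (exp (-1))"
  proof (rule DERIV_neg_imp_decreasing_open[OF assms(1)])
    fix t assume "exp (-1) < t" "t < \<rho>"
    hence t: "exp (-1) < t" "t < 1" using assms by auto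
    have t0: "t > 0" using t(1) exp_gt_zero[of "-1::real"] by linarith
    define \<theta> where "\<theta> = szego_angle t"
    have s: "sin \<theta> > 0" using szego_angle_strict[OF t] by (auto simp: \<theta>_def intro!: sin_gt_zero)
    have c: "t * cos \<theta> = 1 + ln t" unfolding \<theta>_def using t by (intro szego_angle_props) auto
    define D where "D = ln t / (t\<^sup>2 * sin \<theta>)"
    have d: "(?f has_real_derivative D + (sin \<theta> + t * (cos \<theta> * D))) (at t)"
      unfolding D_def \<theta>_def
      by (auto intro!: derivative_eq_intros szego_angle_deriv[OF t])
    \<comment> \<open>Clearing the positive denominator leaves, with
      \<open>c = t cos \<theta> = 1 + ln t\<close>, the sum of \<open>(c - 1)(c + 1)\<close> and
      \<open>t^2 - c^2\<close>.\<close>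
    have "t\<^sup>2 * sin \<theta> * (D + (sin \<theta> + t * (cos \<theta> * D))) = ln t * (1 + t * cos \<theta>) + (t * sin \<theta>)\<^sup>2"
      using s t0 by (simp add: D_def field_simps power2_eq_square)
    also have "(t * sin \<theta>)\<^sup>2 = t\<^sup>2 - (t * cos \<theta>)\<^sup>2"
      by (simp add: power_mult_distrib sin_squared_eq algebra_simps)
    also have "ln t * (1 + t * cos \<theta>) + (t\<^sup>2 - (t * cos \<theta>)\<^sup>2) = t\<^sup>2 - 1"
      unfolding c by (simp add: power2_eq_square algebra_simps)
    also have "\<dots> < 0" using t t0 by (simp add: power_less_one_iff)
    finally have "D + (sin \<theta> + t * (cos \<theta> * D)) < 0"
      using s t0 by (simp add: mult_less_0_iff)
    with d show "\<exists>y. DERIV ?f t :> y \<and> y < 0" by blast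
  next
    show "continuous_on {exp (-1)..\<rho>} ?f"
      by (intro continuous_intros continuous_on_subset[OF continuous_on_szego_angle]) (use assms in auto)
  qed
  thus ?thesis by (simp add: szego_angle_endpoints)
qed

lemma szego_phase_surj:
  assumes "0 \<le> \<phi>" "\<phi> \<le> pi / 2 - 1 / exp 1"
  obtains \<rho> where "exp (-1) \<le> \<rho>" "\<rho> \<le> 1" "szego_phase \<rho> = \<phi>"
  using IVT2'[of szego_phase 1 \<phi> "exp (-1)"] assms continuous_on_szego_phase szego_phase_endpoints
  by auto

lemma szego_phase_range:
  assumes "exp (-1) \<le> \<rho>" "\<rho> \<le> 1"
  shows "0 \<le> szego_phase \<rho>" "szego_phase \<rho> \<le> pi / 2 - 1 / exp 1"
  using szego_phase_strict_antimono[of \<rho> 1] szego_phase_strict_antimono[of "exp (-1)" \<rho>] assms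
    szego_phase_endpoints by (cases "\<rho> = 1"; cases "\<rho> = exp (-1)"; simp)+

lemma zeta_map_image_BC: "zeta_map ` BC = cis ` {0 .. pi / 2 - 1 / exp 1}"
proof -
  have "szego_phase ` {exp (-1)..1} = {0 .. pi / 2 - 1 / exp 1}"
  proof safe
    fix \<phi> assume "\<phi> \<in> {0 .. pi / 2 - 1 / exp 1}"
    then obtain \<rho> where "exp (-1) \<le> \<rho>" "\<rho> \<le> 1" "szego_phase \<rho> = \<phi>" using szego_phase_surj by auto
    thus "\<phi> \<in> szego_phase ` {exp (-1)..1}" by auto
  qed (use szego_phase_range in auto)
  moreover have "zeta_map ` BC = cis ` szego_phase ` {exp (-1)..1}"
    unfolding BC_eq image_image using zeta_map_arc_point by (intro image_cong) auto
  ultimately show ?thesis by simp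
qed

lemma BC_arc:
  "\<exists>g. arc g \<and> path_image g = BC \<and> pathstart g = - \<i> / of_real pi
     \<and> pathfinish g = of_real (1 / (pi * exp 1))"
proof -
  \<comment> \<open>The radius runs down from 1 at B to \<open>1/e\<close> at C; injectivity of the
    path follows from \<open>norm (arc_point \<rho>) = \<rho> / pi\<close>.\<close>
  define h where "h = (\<lambda>t::real. 1 + t * (exp (-1) - 1))"
  define g where "g = arc_point \<circ> h"
  have e: "exp (-1) < (1::real)" by simp
  have h: "h ` {0..1} = {exp (-1)..1}"
  proof -
    have "h = linepath 1 (exp (-1))" by (auto simp: h_def linepath_def algebra_simps)
    hence "h ` {0..1} = closed_segment 1 (exp (-1))" using path_image_linepath by (metis path_image_def)
    thus ?thesis using e by (simp add: closed_segment_eq_real_ivl)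
  qed
  have inj: "inj_on arc_point {exp (-1)..1}"
  proof (rule inj_onI)
    fix s t assume st: "s \<in> {exp (-1)..1}" "t \<in> {exp (-1)..1}" "arc_point s = arc_point t"
    have "s > 0" "t > 0" using st szego_ratio_bounds(1) by auto
    thus "s = t" using norm_arc_point[of s] norm_arc_point[of t] unfolding st(3) by auto
  qed
  have injh: "inj_on h {0..1}" using e by (intro inj_onI) (simp add: h_def)
  have "inj_on g {0..1}" unfolding g_def by (rule comp_inj_on[OF injh]) (simp only: h inj)
  moreover have "continuous_on {0..1} h" unfolding h_def by (intro continuous_intros)
  hence "continuous_on {0..1} g"
    unfolding g_def by (rule continuous_on_compose) (simp only: h continuous_on_arc_point)
  ultimately have "arc g" by (simp add: arc_def path_def)
  moreover have "path_image g = BC"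
    unfolding path_image_def g_def image_comp[symmetric] h BC_eq ..
  moreover have "pathstart g = - \<i> / of_real pi"
  proof -
    have "pathstart g = arc_point 1" by (simp add: pathstart_def g_def h_def)
    thus ?thesis by (simp add: arc_point_def szego_point_def szego_angle_endpoints complex_eq_iff Re_divide Im_divide power2_eq_square)
  qed
  moreover have "pathfinish g = of_real (1 / (pi * exp 1))"
  proof -
    have "pathfinish g = arc_point (exp (-1))" by (simp add: pathfinish_def g_def h_def)
    also have "\<dots> = of_real (exp (-1) / pi)"
      unfolding arc_point_def szego_point_def szego_angle_endpoints by (simp add: cis_pi_half)
    also have "exp (-1) / pi = 1 / (pi * exp 1)" by (simp add: exp_minus divide_simps)
    finally show ?thesis .
  qed
  ultimately show ?thesis by blast
qed

subsection \<open>Zeros near the arc and its mirror images\<close>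

lemma eventually_nhds_less:
  fixes f :: "complex \<Rightarrow> real"
  assumes "isCont f p"
  shows "f p < c \<Longrightarrow> \<forall>\<^sub>F x in nhds p. f x < c" "c < f p \<Longrightarrow> \<forall>\<^sub>F x in nhds p. c < f x"
proof -
  have "(f \<longlongrightarrow> f p) (nhds p)"
    using assms by (simp add: isCont_def tendsto_at_iff_tendsto_nhds)
  thus "f p < c \<Longrightarrow> \<forall>\<^sub>F x in nhds p. f x < c" "c < f p \<Longrightarrow> \<forall>\<^sub>F x in nhds p. c < f x"
    by (auto dest: order_tendstoD)
qed

lemma eventually_nhds_isCont:
  assumes "\<forall>\<^sub>F y in nhds (f p). P y" "isCont f p"
  shows "\<forall>\<^sub>F x in nhds p. P (f x)"
proof -
  have "filterlim f (nhds (f p)) (nhds p)"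
    using assms(2) by (simp add: isCont_def tendsto_at_iff_tendsto_nhds)
  thus ?thesis using assms(1) by (simp add: filterlim_iff)
qed

lemma isCont_Arg_comp:
  assumes "isCont g p" "g p \<notin> \<real>\<^sub>\<le>\<^sub>0"
  shows "isCont (\<lambda>x. Arg (g x)) p"
  using isCont_o2[OF assms(1) continuous_at_Arg[OF assms(2)]] .

lemma isCont_zeta_map: "isCont g p \<Longrightarrow> isCont (\<lambda>x. zeta_map (g x)) p"
  unfolding zeta_map_def Let_def by (intro continuous_intros)

abbreviation (input) max_phase :: real where "max_phase \<equiv> pi / 2 - 1 / exp 1"

lemma max_phase_bounds: "0 < max_phase" "max_phase < pi / 2"
proof -
  have "exp 1 \<ge> (2::real)" using exp_ge_add_one_self[of 1] by simp
  hence "1 / exp 1 \<le> (1 / 2 :: real)" by (intro divide_left_mono) auto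
  thus "0 < max_phase" using pi_gt3 by linarith
  show "max_phase < pi / 2" by simp
qed

text \<open>For \<open>0 < a\<close> and \<open>b < max_phase\<close> this compact set avoids both
  end points, which lie on the boundary of the strip in the logarithmic coordinate.\<close>

definition phase_preimage :: "real \<Rightarrow> real \<Rightarrow> real set" where
  "phase_preimage a b = {\<rho> \<in> {exp (-1)..1}. a \<le> szego_phase \<rho> \<and> szego_phase \<rho> \<le> b}"

lemma compact_phase_preimage: "compact (phase_preimage a b)"
proof -
  have "closed ({exp (-1)..1} \<inter> szego_phase -` {a..b})"
    by (rule continuous_closed_preimage[OF continuous_on_szego_phase]) auto
  moreover have "phase_preimage a b = {exp (-1)..1} \<inter> ({exp (-1)..1} \<inter> szego_phase -` {a..b})"
    by (auto simp: phase_preimage_def)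
  ultimately show ?thesis by (metis compact_Int_closed compact_Icc)
qed

lemma phase_preimage_strict:
  assumes "0 < a" "b < max_phase" "\<rho> \<in> phase_preimage a b"
  shows "exp (-1) < \<rho>" "\<rho> < 1"
proof -
  have "\<rho> \<noteq> 1" "\<rho> \<noteq> exp (-1)"
    using assms szego_phase_endpoints unfolding phase_preimage_def by auto
  thus "exp (-1) < \<rho>" "\<rho> < 1" using assms by (auto simp: phase_preimage_def)
qed

definition log_point :: "real \<Rightarrow> complex" where
  "log_point \<rho> = Complex (ln \<rho>) (szego_angle \<rho>)"

lemma exp_log_point: "\<rho> > 0 \<Longrightarrow> exp (log_point \<rho>) = szego_point \<rho>"
  by (simp add: log_point_def szego_point_def exp_eq_polar)

lemma szego_log_log_point:
  assumes "exp (-1) \<le> \<rho>" "\<rho> \<le> 1"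
  shows "szego_log (log_point \<rho>) = \<i> * of_real (szego_phase \<rho>)"
  using szego_angle_props[OF assms] szego_ratio_bounds(1)[OF assms]
  by (simp add: szego_log_def exp_log_point complex_eq_iff szego_point_parts)
     (simp add: log_point_def szego_phase_def)

lemma log_curve:
  assumes "0 < a" "b < max_phase"
  defines "K \<equiv> log_point ` phase_preimage a b"
  shows "compact K" "K \<subseteq> log_strip 0"
    and "\<And>\<phi>. a \<le> \<phi> \<Longrightarrow> \<phi> \<le> b \<Longrightarrow> \<exists>u\<in>K. szego_log u = \<i> * of_real \<phi>"
proof -
  have "continuous_on {exp (-1)..1} log_point"
    unfolding log_point_def Complex_eq
    by (intro continuous_intros continuous_on_szego_angle) (use szego_ratio_bounds(1) in force)
  hence "continuous_on (phase_preimage a b) log_point"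
    by (rule continuous_on_subset) (auto simp: phase_preimage_def)
  thus "compact K" unfolding K_def by (intro compact_continuous_image compact_phase_preimage)
  show "K \<subseteq> log_strip 0"
  proof
    fix u assume "u \<in> K"
    then obtain \<rho> where \<rho>: "\<rho> \<in> phase_preimage a b" "u = log_point \<rho>" by (auto simp: K_def)
    note s = phase_preimage_strict[OF assms(1,2) \<rho>(1)]
    have \<rho>0: "\<rho> > 0" using s(1) exp_gt_zero[of "-1::real"] by linarith
    have "ln (exp (-1)) < ln \<rho>" using s \<rho>0 by (subst ln_less_cancel_iff) auto
    thus "u \<in> log_strip 0"
      using szego_angle_strict[OF s] s \<rho>0 by (simp add: \<rho>(2) log_point_def log_strip_def)
  qed
  fix \<phi> assume \<phi>: "a \<le> \<phi>" "\<phi> \<le> b"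
  then obtain \<rho> where \<rho>: "exp (-1) \<le> \<rho>" "\<rho> \<le> 1" "szego_phase \<rho> = \<phi>"
    using szego_phase_surj[of \<phi>] assms by auto
  hence "\<rho> \<in> phase_preimage a b" using \<phi> by (auto simp: phase_preimage_def)
  thus "\<exists>u\<in>K. szego_log u = \<i> * of_real \<phi>"
    using szego_log_log_point[OF \<rho>(1,2)] \<rho>(3) by (auto simp: K_def)
qed

abbreviation (input) num_zeros :: "nat \<Rightarrow> (complex \<Rightarrow> bool) \<Rightarrow> nat" where
  "num_zeros n P \<equiv> card {x. poly (euler_poly_scaled n) x = 0 \<and> P x}"

lemma num_zeros_arc:
  assumes ab: "0 < a" "b < max_phase"
    and P: "\<And>\<rho>. \<rho> \<in> phase_preimage a b \<Longrightarrow> \<forall>\<^sub>F x in nhds (arc_point \<rho>). P x"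
  shows "\<forall>\<^sub>F n in sequentially. real n * (b - a) / (2 * pi) - 1 \<le> real (num_zeros n P)"
proof (rule card_zeros_near_curve[OF log_curve[OF ab]])
  fix u assume "u \<in> log_point ` phase_preimage a b"
  then obtain \<rho> where \<rho>: "\<rho> \<in> phase_preimage a b" "u = log_point \<rho>" by auto
  hence "\<rho> > 0" using szego_ratio_bounds(1) by (auto simp: phase_preimage_def)
  thus "\<forall>\<^sub>F x in nhds (exp u / (of_real pi * \<i>)). P x"
    using P[OF \<rho>(1)] by (simp add: \<rho>(2) exp_log_point arc_point_def)
qed

text \<open>Conjugation symmetry does not reach this arc from \<open>BC\<close>, and the Euler
  polynomials are symmetric about 1/2, not 0. But \<open>x \<mapsto> -cnj x\<close> conjugates
  \<open>z\<close>, and strip and \<open>szego_log\<close> respect conjugation, so the argument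
  applies to the conjugate curve with phases in \<open>[-b, -a]\<close>.\<close>

lemma num_zeros_arc_left:
  assumes ab: "0 < a" "b < max_phase"
    and P: "\<And>\<rho>. \<rho> \<in> phase_preimage a b \<Longrightarrow> \<forall>\<^sub>F x in nhds (arc_point \<rho>). P (- cnj x)"
  shows "\<forall>\<^sub>F n in sequentially. real n * (b - a) / (2 * pi) - 1 \<le> real (num_zeros n P)"
proof -
  note K = log_curve[OF ab]
  have "\<forall>\<^sub>F n in sequentially. real n * (- a - - b) / (2 * pi) - 1 \<le> real (num_zeros n P)"
  proof (rule card_zeros_near_curve)
    show "compact (cnj ` log_point ` phase_preimage a b)"
      by (intro compact_continuous_image K continuous_intros)
    show "cnj ` log_point ` phase_preimage a b \<subseteq> log_strip 0"
      using K(2) by (auto simp: log_strip_def)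
    fix \<phi> assume "- b \<le> \<phi>" "\<phi> \<le> - a"
    with K(3)[of "- \<phi>"] obtain u where u: "u \<in> log_point ` phase_preimage a b" "szego_log u = - (\<i> * of_real \<phi>)"
      by auto
    have "szego_log (cnj u) = cnj (szego_log u)" by (simp add: szego_log_def exp_cnj)
    hence "szego_log (cnj u) = \<i> * of_real \<phi>" using u(2) by simp
    thus "\<exists>u\<in>cnj ` log_point ` phase_preimage a b. szego_log u = \<i> * of_real \<phi>" using u(1) by blast
  next
    fix u assume "u \<in> cnj ` log_point ` phase_preimage a b"
    then obtain \<rho> where \<rho>: "\<rho> \<in> phase_preimage a b" "u = cnj (log_point \<rho>)" by auto
    hence "\<rho> > 0" using szego_ratio_bounds(1) by (auto simp: phase_preimage_def)
    hence e: "exp u / (of_real pi * \<i>) = - cnj (arc_point \<rho>)"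
      by (simp add: \<rho>(2) exp_cnj[symmetric] exp_log_point arc_point_def)
    have "\<forall>\<^sub>F x in nhds (- cnj (arc_point \<rho>)). P (- cnj (- cnj x))"
    proof (rule eventually_nhds_isCont[where f = "\<lambda>x. - cnj x" and P = "\<lambda>x. P (- cnj x)"])
      show "\<forall>\<^sub>F y in nhds (- cnj (- cnj (arc_point \<rho>))). P (- cnj y)" using P[OF \<rho>(1)] by simp
    qed (intro continuous_intros)
    thus "\<forall>\<^sub>F x in nhds (exp u / (of_real pi * \<i>)). P x" unfolding e by simp
  qed
  thus ?thesis by (simp add: algebra_simps)
qed

lemma num_zeros_arc_cnj:
  assumes ab: "0 < a" "b < max_phase"
    and P: "\<And>\<rho>. \<rho> \<in> phase_preimage a b \<Longrightarrow> \<forall>\<^sub>F x in nhds (arc_point \<rho>). P (cnj x)"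
  shows "\<forall>\<^sub>F n in sequentially. real n * (b - a) / (2 * pi) - 1 \<le> real (num_zeros n P)"
  using num_zeros_arc[where P = "\<lambda>x. P (cnj x)", OF ab P] by (simp add: card_euler_zeros_cnj)

text \<open>Since \<open>-x\<close> is the conjugate of \<open>-cnj x\<close>, this is the left arc
  combined with the conjugation symmetry of the zeros.\<close>

lemma num_zeros_arc_neg:
  assumes ab: "0 < a" "b < max_phase"
    and P: "\<And>\<rho>. \<rho> \<in> phase_preimage a b \<Longrightarrow> \<forall>\<^sub>F x in nhds (arc_point \<rho>). P (- x)"
  shows "\<forall>\<^sub>F n in sequentially. real n * (b - a) / (2 * pi) - 1 \<le> real (num_zeros n P)"
  using num_zeros_arc_left[where P = "\<lambda>x. P (cnj x)", OF ab] P by (simp add: card_euler_zeros_cnj)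

section \<open>Distinct zeros against zeros with multiplicity\<close>

lemma num_zeros_le_zero_count: "num_zeros n P \<le> zero_count n P"
proof -
  have "{x. poly (euler_poly_scaled n) x = 0 \<and> P x} = set_mset (filter_mset P (proots (euler_poly_scaled n)))"
    using euler_poly_scaled_nonzero by auto
  also have "card \<dots> \<le> zero_count n P"
  proof -
    have "card (set_mset M) \<le> size M" for M :: "complex multiset"
      by (induction M) (auto simp: card_insert_if)
    thus ?thesis unfolding zero_count_def .
  qed
  finally show ?thesis .
qed

lemma zero_count_compl: "zero_count n P + zero_count n (\<lambda>x. \<not> P x) = n"
proof -
  have "zero_count n P + zero_count n (\<lambda>x. \<not> P x) = size (proots (euler_poly_scaled n))"
    unfolding zero_count_def size_union[symmetric] multiset_partition[symmetric] ..
  also have "\<dots> = n" by (simp add: size_proots_complex degree_euler_poly_scaled)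
  finally show ?thesis .
qed

lemma num_zeros_add:
  assumes "\<And>x. P x \<Longrightarrow> Q x \<Longrightarrow> False"
  shows "num_zeros n P + num_zeros n Q = num_zeros n (\<lambda>x. P x \<or> Q x)"
proof -
  have U: "{x. poly (euler_poly_scaled n) x = 0 \<and> (P x \<or> Q x)}
     = {x. poly (euler_poly_scaled n) x = 0 \<and> P x} \<union> {x. poly (euler_poly_scaled n) x = 0 \<and> Q x}"
    by auto
  have D: "{x. poly (euler_poly_scaled n) x = 0 \<and> P x} \<inter> {x. poly (euler_poly_scaled n) x = 0 \<and> Q x} = {}"
    using assms by blast
  show ?thesis
    unfolding U card_Un_disjoint[OF finite_euler_roots finite_euler_roots D] ..
qed

lemma num_zeros_mono:
  assumes "\<And>x. P x \<Longrightarrow> Q x"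
  shows "num_zeros n P \<le> num_zeros n Q"
  by (intro card_mono finite_euler_roots) (use assms in auto)

lemma arc_point_quadrant:
  assumes "exp (-1) < \<rho>" "\<rho> < 1"
  shows "Re (arc_point \<rho>) > 0" "Im (arc_point \<rho>) < 0"
proof -
  have "\<rho> > 0" using assms(1) exp_gt_zero[of "-1::real"] by linarith
  moreover have "sin (szego_angle \<rho>) > 0" "cos (szego_angle \<rho>) > 0"
    using szego_angle_strict[OF assms] by (auto intro!: sin_gt_zero cos_gt_zero_pi)
  ultimately show "Re (arc_point \<rho>) > 0" "Im (arc_point \<rho>) < 0" by (auto simp: arc_point_parts)
qed

lemma Arg_zeta_arc_point:
  assumes "exp (-1) \<le> \<rho>" "\<rho> \<le> 1"
  shows "Arg (zeta_map (arc_point \<rho>)) = szego_phase \<rho>"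
proof -
  have "szego_phase \<rho> \<in> {- pi<..pi}"
    using szego_phase_range[OF assms] max_phase_bounds pi_gt_zero unfolding greaterThanAtMost_iff by linarith
  thus ?thesis by (simp only: zeta_map_arc_point[OF assms] Arg_cis)
qed

lemma Im_zeta_arc_point_pos:
  assumes "exp (-1) < \<rho>" "\<rho> < 1"
  shows "Im (zeta_map (arc_point \<rho>)) > 0"
proof -
  have "szego_phase 1 < szego_phase \<rho>" "szego_phase \<rho> \<le> max_phase"
    using assms by (intro szego_phase_strict_antimono szego_phase_range; simp)+
  hence "0 < szego_phase \<rho>" "szego_phase \<rho> < pi"
    unfolding szego_phase_endpoints using max_phase_bounds by linarith+
  thus ?thesis using assms by (simp add: zeta_map_arc_point sin_gt_zero)
qed

lemma zeta_map_neg_cnj: "zeta_map (- cnj x) = cnj (zeta_map x)"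
  by (simp add: zeta_map_def Let_def exp_cnj)

lemma zeta_map_cnj_arc_point:
  assumes "exp (-1) < \<rho>" "\<rho> < 1"
  shows "max_phase < Arg (zeta_map (cnj (arc_point \<rho>)))" "Im (zeta_map (cnj (arc_point \<rho>))) > 0"
proof -
  have \<rho>: "\<rho> > 0" using assms(1) exp_gt_zero[of "-1::real"] by linarith
  define \<theta> where "\<theta> = szego_angle \<rho>"
  \<comment> \<open>The argument of \<open>\<zeta>\<close> on the upper right arc. It is principal
    because \<open>t < pi\<close>, and \<open>szego_sum_less\<close> makes it exceed
    \<open>pi - (pi/2 + 1/e) = max_phase\<close>.\<close>
  define t where "t = pi - (\<theta> + \<rho> * sin \<theta>)"
  have z: "of_real pi * \<i> * cnj (arc_point \<rho>) = - cnj (szego_point \<rho>)"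
    by (simp add: arc_point_def)
  have "- cnj (szego_point \<rho>) = of_real \<rho> * cis (pi - \<theta>)"
    by (simp add: szego_point_def \<theta>_def complex_eq_iff)
  moreover have "exp (1 + cnj (szego_point \<rho>)) = of_real (exp (1 + \<rho> * cos \<theta>)) * cis (- (\<rho> * sin \<theta>))"
    by (simp add: exp_eq_polar szego_point_parts \<theta>_def)
  moreover have "zeta_map (cnj (arc_point \<rho>)) = - cnj (szego_point \<rho>) * exp (1 + cnj (szego_point \<rho>))"
    unfolding zeta_map_def z Let_def by simp
  ultimately have "zeta_map (cnj (arc_point \<rho>)) = of_real (\<rho> * exp (1 + \<rho> * cos \<theta>)) * (cis (pi - \<theta>) * cis (- (\<rho> * sin \<theta>)))"
    by (simp only: of_real_mult mult_ac)
  also have "cis (pi - \<theta>) * cis (- (\<rho> * sin \<theta>)) = cis t" by (simp add: cis_mult t_def algebra_simps)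
  finally have zeta: "zeta_map (cnj (arc_point \<rho>)) = rcis (\<rho> * exp (1 + \<rho> * cos \<theta>)) t"
    by (simp add: rcis_def)
  have t1: "t > max_phase"
    using szego_sum_less[of \<rho>] assms by (simp add: t_def \<theta>_def exp_minus inverse_eq_divide)
  have "\<theta> > 0" "\<theta> < pi / 2" unfolding \<theta>_def using szego_angle_strict[OF assms] .
  hence "\<theta> + \<rho> * sin \<theta> > 0" using \<rho> by (intro add_pos_pos mult_pos_pos sin_gt_zero) auto
  hence t2: "t < pi" by (simp add: t_def)
  have pos: "\<rho> * exp (1 + \<rho> * cos \<theta>) > 0" using \<rho> by simp
  have t3: "t > 0" using t1 max_phase_bounds by linarith
  show "max_phase < Arg (zeta_map (cnj (arc_point \<rho>)))"
    unfolding zeta using t1 t2 t3 pos by (subst Arg_rcis) auto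
  show "Im (zeta_map (cnj (arc_point \<rho>))) > 0"
    unfolding zeta using pos t2 t3 by (simp add: sin_gt_zero)
qed

lemma norm_BC_ge:
  assumes "b \<in> BC"
  shows "norm b \<ge> 1 / (pi * exp 1)"
  using BC_subset_arc_point(1)[OF assms] by (simp add: exp_minus field_simps)

lemma infdist_BC_ge:
  assumes "\<And>b. b \<in> BC \<Longrightarrow> d \<le> dist x b"
  shows "d \<le> infdist x BC"
  unfolding infdist_notempty[OF BC_nonempty] using assms by (intro cINF_greatest BC_nonempty)

text \<open>The coordinates of \<open>x\<close> and of points of \<open>BC\<close> have opposite
  signs, so a point of \<open>BC\<close> is at least as far from \<open>x\<close> as from the
  origin.\<close>

lemma infdist_BC_opposite:
  assumes "Re x \<le> 0" "Im x \<ge> 0"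
  shows "infdist x BC \<ge> 1 / (pi * exp 1)"
proof (rule infdist_BC_ge)
  fix b assume b: "b \<in> BC"
  hence "Re b \<ge> 0" "Im b \<le> 0" by (auto simp: BC_def)
  hence "(Re b)\<^sup>2 \<le> (Re x - Re b)\<^sup>2" "(Im b)\<^sup>2 \<le> (Im x - Im b)\<^sup>2"
    using assms by (auto simp flip: abs_le_square_iff)
  hence "norm b \<le> dist x b" by (simp add: dist_norm cmod_def)
  with norm_BC_ge[OF b] show "1 / (pi * exp 1) \<le> dist x b" by linarith
qed

subsection \<open>Exhausting all zeros\<close>

lemma total_mass: "4 * max_phase / (2 * pi) + 2 / (pi * exp 1) = 1"
proof -
  have "4 * max_phase / (2 * pi) = 1 - 2 / (pi * exp 1)"
    by (simp add: diff_divide_distrib right_diff_distrib mult.commute)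
  thus ?thesis by simp
qed

text \<open>On the positive real axis \<open>arg \<zeta> = pi/2 - pi x\<close>. This keeps the real
  zeros near C out of every sector considered.\<close>

lemma Arg_zeta_real:
  fixes x :: real
  assumes "0 < x" "x < 1 / (pi * exp 1)"
  shows "max_phase < Arg (zeta_map (of_real x))"
proof -
  have px: "pi * x < 1 / exp 1" using assms by (simp add: field_simps)
  have z: "of_real pi * \<i> * of_real x = of_real (pi * x) * cis (pi / 2)"
    by (simp add: cis_pi_half)
  have "exp (1 - of_real pi * \<i> * of_real x) = of_real (exp 1) * cis (- (pi * x))"
    by (simp add: exp_eq_polar)
  hence "zeta_map (of_real x) = of_real (pi * x * exp 1) * (cis (pi / 2) * cis (- (pi * x)))"
    unfolding zeta_map_def Let_def by (simp only: z[symmetric]) (simp add: z cis_pi_half)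
  also have "\<dots> = rcis (pi * x * exp 1) (pi / 2 - pi * x)"
    by (simp only: cis_mult rcis_def add_uminus_conv_diff)
  finally have zeta: "zeta_map (of_real x) = rcis (pi * x * exp 1) (pi / 2 - pi * x)" .
  have "0 < pi * x" "0 < pi * x * exp 1" using assms by simp_all
  moreover have "pi / 2 - pi * x > 0" using px max_phase_bounds by linarith
  ultimately have "pi / 2 - pi * x \<in> {- pi<..pi}" "0 < pi * x * exp 1"
    unfolding greaterThanAtMost_iff using pi_gt_zero by linarith+
  hence "Arg (zeta_map (of_real x)) = pi / 2 - pi * x"
    unfolding zeta by (rule Arg_rcis)
  thus ?thesis using px by linarith
qed

lemma arc_point_Arg_nhds:
  assumes "exp (-1) < \<rho>" "\<rho> < 1"
  shows "szego_phase \<rho> < c \<Longrightarrow> \<forall>\<^sub>F x in nhds (arc_point \<rho>). Arg (zeta_map x) < c"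
    and "c < szego_phase \<rho> \<Longrightarrow> \<forall>\<^sub>F x in nhds (arc_point \<rho>). c < Arg (zeta_map x)"
proof -
  have "zeta_map (arc_point \<rho>) \<notin> \<real>\<^sub>\<le>\<^sub>0"
    using Im_zeta_arc_point_pos[OF assms] by (auto simp: complex_nonpos_Reals_iff)
  hence "isCont (\<lambda>x. Arg (zeta_map x)) (arc_point \<rho>)"
    by (intro isCont_Arg_comp isCont_zeta_map continuous_ident)
  from eventually_nhds_less[OF this]
  show "szego_phase \<rho> < c \<Longrightarrow> \<forall>\<^sub>F x in nhds (arc_point \<rho>). Arg (zeta_map x) < c"
    "c < szego_phase \<rho> \<Longrightarrow> \<forall>\<^sub>F x in nhds (arc_point \<rho>). c < Arg (zeta_map x)"
    using assms by (simp_all add: Arg_zeta_arc_point)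
qed

lemma arc_point_quadrant_nhds:
  assumes "exp (-1) < \<rho>" "\<rho> < 1"
  shows "\<forall>\<^sub>F x in nhds (arc_point \<rho>). Re x > 0 \<and> Im x < 0"
proof (rule eventually_conj)
  show "\<forall>\<^sub>F x in nhds (arc_point \<rho>). Re x > 0" "\<forall>\<^sub>F x in nhds (arc_point \<rho>). Im x < 0"
    using arc_point_quadrant[OF assms] by (intro eventually_nhds_less continuous_Re continuous_Im continuous_ident; simp)+
qed

lemma arc_point_near_BC:
  assumes "exp (-1) \<le> \<rho>" "\<rho> \<le> 1" "\<epsilon> > 0"
  shows "\<forall>\<^sub>F x in nhds (arc_point \<rho>). infdist x BC < \<epsilon>"
  by (rule eventually_nhds_less(1)) (use assms arc_point_in_BC in \<open>auto intro!: continuous_intros\<close>)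

text \<open>The passage from lower to upper bounds: distinct zeros outside \<open>R\<close> are
  subtracted from the total \<open>n\<close>.\<close>

lemma zero_count_upper:
  assumes "\<And>x. P x \<Longrightarrow> \<not> R x"
  shows "real (zero_count n R) \<le> real n - real (num_zeros n P)"
proof -
  have "num_zeros n P \<le> zero_count n (\<lambda>x. \<not> R x)"
    using num_zeros_mono[of P "\<lambda>x. \<not> R x" n] num_zeros_le_zero_count[of n "\<lambda>x. \<not> R x"] assms
    by (meson order_trans)
  thus ?thesis using zero_count_compl[of n R] by linarith
qed

lemma split_num_zeros_5:
  assumes "\<And>x. P1 x \<Longrightarrow> Re x > 0 \<and> Im x < 0" "\<And>x. P2 x \<Longrightarrow> Re x < 0 \<and> Im x < 0"
    "\<And>x. P3 x \<Longrightarrow> Re x > 0 \<and> Im x > 0" "\<And>x. P4 x \<Longrightarrow> Re x < 0 \<and> Im x > 0"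
    "\<And>x. P5 x \<Longrightarrow> Im x = 0"
  shows "num_zeros n (\<lambda>x. P1 x \<or> P2 x \<or> P3 x \<or> P4 x \<or> P5 x)
    = num_zeros n P1 + num_zeros n P2 + num_zeros n P3 + num_zeros n P4 + num_zeros n P5"
proof -
  have "num_zeros n P4 + num_zeros n P5 = num_zeros n (\<lambda>x. P4 x \<or> P5 x)"
    by (rule num_zeros_add) (use assms in fastforce)
  moreover have "num_zeros n P3 + num_zeros n (\<lambda>x. P4 x \<or> P5 x) = num_zeros n (\<lambda>x. P3 x \<or> P4 x \<or> P5 x)"
    by (rule num_zeros_add) (use assms in fastforce)
  moreover have "num_zeros n P2 + num_zeros n (\<lambda>x. P3 x \<or> P4 x \<or> P5 x) = num_zeros n (\<lambda>x. P2 x \<or> P3 x \<or> P4 x \<or> P5 x)"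
    by (rule num_zeros_add) (use assms in fastforce)
  moreover have "num_zeros n P1 + num_zeros n (\<lambda>x. P2 x \<or> P3 x \<or> P4 x \<or> P5 x)
      = num_zeros n (\<lambda>x. P1 x \<or> P2 x \<or> P3 x \<or> P4 x \<or> P5 x)"
    by (rule num_zeros_add) (use assms in fastforce)
  ultimately show ?thesis by linarith
qed

lemma sector_count_lower:
  assumes ab: "0 \<le> \<alpha>" "\<beta> \<le> max_phase" and e: "0 < \<epsilon>" and h: "0 < \<eta>"
  shows "\<forall>\<^sub>F n in sequentially. real n * ((\<beta> - \<alpha>) / (2 * pi) - 4 * \<eta>) - 8
     \<le> real (zero_count n (\<lambda>x. infdist x BC < \<epsilon> \<and> \<alpha> \<le> Arg (zeta_map x) \<and> Arg (zeta_map x) \<le> \<beta>))"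
proof -
  let ?R = "\<lambda>x. infdist x BC < \<epsilon> \<and> \<alpha> \<le> Arg (zeta_map x) \<and> Arg (zeta_map x) \<le> \<beta>"
  have "\<forall>\<^sub>F n in sequentially. real n * ((\<beta> - \<eta>) - (\<alpha> + \<eta>)) / (2 * pi) - 1 \<le> real (num_zeros n ?R)"
  proof (rule num_zeros_arc)
    show a: "0 < \<alpha> + \<eta>" and b: "\<beta> - \<eta> < max_phase" using ab h by linarith+
    fix \<rho> assume r: "\<rho> \<in> phase_preimage (\<alpha> + \<eta>) (\<beta> - \<eta>)"
    note s = phase_preimage_strict[OF a b r]
    have "\<alpha> < szego_phase \<rho>" "szego_phase \<rho> < \<beta>" using r h by (auto simp: phase_preimage_def)
    with arc_point_near_BC[of \<rho>, OF _ _ e] arc_point_Arg_nhds(1)[OF s, of \<beta>] arc_point_Arg_nhds(2)[OF s, of \<alpha>] s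
    have "\<forall>\<^sub>F x in nhds (arc_point \<rho>). infdist x BC < \<epsilon> \<and> Arg (zeta_map x) < \<beta> \<and> \<alpha> < Arg (zeta_map x)"
      by (simp add: eventually_conj_iff)
    thus "\<forall>\<^sub>F x in nhds (arc_point \<rho>). ?R x" by (rule eventually_mono) auto
  qed
  thus ?thesis
  proof eventually_elim
    case (elim n)
    have "real n * ((\<beta> - \<eta>) - (\<alpha> + \<eta>)) / (2 * pi) = real n * ((\<beta> - \<alpha>) / (2 * pi)) - real n * (\<eta> / pi)"
      by (simp add: field_simps)
    moreover have "\<eta> / pi \<le> 4 * \<eta>" using h pi_gt3 mult_mono[of 1 "4 * pi" \<eta> \<eta>] by (simp add: divide_le_eq mult_ac)
    hence "real n * (\<eta> / pi) \<le> real n * (4 * \<eta>)" by (rule mult_left_mono) simp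
    ultimately show ?case
      using elim num_zeros_le_zero_count[of n ?R] by (simp add: right_diff_distrib)
  qed
qed

text \<open>Zeros outside the sector are counted from below: the rest of the arc
  (\<open>P1a\<close>, \<open>P1b\<close>); the left arc, where \<open>\<zeta>\<close> is conjugated
  and its argument negative; the upper right arc and the positive real segment, where the argument
  exceeds \<open>max_phase\<close>; and the closed second quadrant, too far from \<open>BC\<close>.
  Together with the sector they have mass 1.\<close>

lemma sector_count_upper:
  assumes ab: "0 \<le> \<alpha>" "\<alpha> < \<beta>" "\<beta> \<le> max_phase" and e: "\<epsilon> < 1 / (pi * exp 1)"
    and h: "0 < \<eta>" "\<eta> < 1 / (pi * exp 1)"
  shows "\<forall>\<^sub>F n in sequentially.
     real (zero_count n (\<lambda>x. infdist x BC < \<epsilon> \<and> \<alpha> \<le> Arg (zeta_map x) \<and> Arg (zeta_map x) \<le> \<beta>))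
     \<le> real n * ((\<beta> - \<alpha>) / (2 * pi) + 4 * \<eta>) + 8"
proof -
  let ?R = "\<lambda>x. infdist x BC < \<epsilon> \<and> \<alpha> \<le> Arg (zeta_map x) \<and> Arg (zeta_map x) \<le> \<beta>"
  define r where "r = 1 / (pi * exp 1) - \<eta>"
  define P1a where "P1a = (\<lambda>x. Re x > 0 \<and> Im x < 0 \<and> Arg (zeta_map x) < \<alpha>)"
  define P1b where "P1b = (\<lambda>x. Re x > 0 \<and> Im x < 0 \<and> \<beta> < Arg (zeta_map x))"
  define P2 where "P2 = (\<lambda>x. Re x < 0 \<and> Im x < 0 \<and> Im (zeta_map x) < 0)"
  define P3 where "P3 = (\<lambda>x. Re x > 0 \<and> Im x > 0 \<and> max_phase < Arg (zeta_map x))"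
  define P4 where "P4 = (\<lambda>x. Re x < 0 \<and> Im x > 0)"
  define P5 where "P5 = (\<lambda>x. Im x = 0 \<and> \<bar>Re x\<bar> \<le> r)"
  \<comment> \<open>For \<open>\<alpha> < 2 \<eta>\<close> the phase interval is empty and the bound
    negative, hence harmless.\<close>
  have N1a: "\<forall>\<^sub>F n in sequentially. real n * ((\<alpha> - \<eta>) - \<eta>) / (2 * pi) - 1 \<le> real (num_zeros n P1a)"
  proof (rule num_zeros_arc)
    show b: "\<alpha> - \<eta> < max_phase" using ab h by linarith
    fix \<rho> assume \<rho>: "\<rho> \<in> phase_preimage \<eta> (\<alpha> - \<eta>)"
    note s = phase_preimage_strict[OF h(1) b \<rho>]
    have "szego_phase \<rho> < \<alpha>" using \<rho> h by (auto simp: phase_preimage_def)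
    from arc_point_Arg_nhds(1)[OF s this] arc_point_quadrant_nhds[OF s]
    show "\<forall>\<^sub>F x in nhds (arc_point \<rho>). P1a x" unfolding P1a_def by eventually_elim auto
  qed fact
  have N1b: "\<forall>\<^sub>F n in sequentially. real n * ((max_phase - \<eta>) - (\<beta> + \<eta>)) / (2 * pi) - 1 \<le> real (num_zeros n P1b)"
  proof (rule num_zeros_arc)
    show a: "0 < \<beta> + \<eta>" and b: "max_phase - \<eta> < max_phase" using ab h by linarith+
    fix \<rho> assume \<rho>: "\<rho> \<in> phase_preimage (\<beta> + \<eta>) (max_phase - \<eta>)"
    note s = phase_preimage_strict[OF a b \<rho>]
    have "\<beta> < szego_phase \<rho>" using \<rho> h by (auto simp: phase_preimage_def)
    from arc_point_Arg_nhds(2)[OF s this] arc_point_quadrant_nhds[OF s]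
    show "\<forall>\<^sub>F x in nhds (arc_point \<rho>). P1b x" unfolding P1b_def by eventually_elim auto
  qed
  have b: "max_phase - \<eta> < max_phase" using h by linarith
  have N2: "\<forall>\<^sub>F n in sequentially. real n * ((max_phase - \<eta>) - \<eta>) / (2 * pi) - 1 \<le> real (num_zeros n P2)"
  proof (rule num_zeros_arc_left[OF h(1) b])
    fix \<rho> assume \<rho>: "\<rho> \<in> phase_preimage \<eta> (max_phase - \<eta>)"
    note s = phase_preimage_strict[OF h(1) b \<rho>]
    have "isCont (\<lambda>x. Im (zeta_map x)) (arc_point \<rho>)"
      by (intro continuous_Im isCont_zeta_map continuous_ident)
    from eventually_nhds_less(2)[OF this Im_zeta_arc_point_pos[OF s]] arc_point_quadrant_nhds[OF s]
    show "\<forall>\<^sub>F x in nhds (arc_point \<rho>). P2 (- cnj x)"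
      unfolding P2_def by eventually_elim (auto simp: zeta_map_neg_cnj)
  qed
  have N3: "\<forall>\<^sub>F n in sequentially. real n * ((max_phase - \<eta>) - \<eta>) / (2 * pi) - 1 \<le> real (num_zeros n P3)"
  proof (rule num_zeros_arc_cnj[OF h(1) b])
    fix \<rho> assume \<rho>: "\<rho> \<in> phase_preimage \<eta> (max_phase - \<eta>)"
    note s = phase_preimage_strict[OF h(1) b \<rho>]
    have "isCont (\<lambda>x. Arg (zeta_map (cnj x))) (arc_point \<rho>)"
      using zeta_map_cnj_arc_point(2)[OF s]
      by (intro isCont_Arg_comp isCont_zeta_map continuous_intros) (auto simp: complex_nonpos_Reals_iff)
    from eventually_nhds_less(2)[OF this zeta_map_cnj_arc_point(1)[OF s]] arc_point_quadrant_nhds[OF s]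
    show "\<forall>\<^sub>F x in nhds (arc_point \<rho>). P3 (cnj x)"
      unfolding P3_def by eventually_elim auto
  qed
  have N4: "\<forall>\<^sub>F n in sequentially. real n * ((max_phase - \<eta>) - \<eta>) / (2 * pi) - 1 \<le> real (num_zeros n P4)"
  proof (rule num_zeros_arc_neg[OF h(1) b])
    fix \<rho> assume \<rho>: "\<rho> \<in> phase_preimage \<eta> (max_phase - \<eta>)"
    note s = phase_preimage_strict[OF h(1) b \<rho>]
    from arc_point_quadrant_nhds[OF s]
    show "\<forall>\<^sub>F x in nhds (arc_point \<rho>). P4 (- x)"
      unfolding P4_def by eventually_elim auto
  qed
  have N5: "\<forall>\<^sub>F n in sequentially. 2 * r * real n - 3 \<le> real (num_zeros n P5)"
    unfolding P5_def by (rule card_real_zeros) (use h in \<open>auto simp: r_def\<close>)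
  let ?P = "\<lambda>x. (P1a x \<or> P1b x) \<or> P2 x \<or> P3 x \<or> P4 x \<or> P5 x"
  have out: "\<not> ?R x" if "?P x" for x
  proof -
    have far: "\<not> ?R x" if "Re x \<le> 0" "Im x \<ge> 0"
      using infdist_BC_opposite[OF that] e by linarith
    have "\<not> ?R x" if "P5 x" 
    proof (cases "Re x \<le> 0")
      case False
      have "x = of_real (Re x)" using that by (simp add: P5_def complex_eq_iff)
      moreover have "max_phase < Arg (zeta_map (of_real (Re x)))"
        by (rule Arg_zeta_real) (use False that h in \<open>auto simp: P5_def r_def\<close>)
      ultimately have "max_phase < Arg (zeta_map x)" by metis
      thus ?thesis using ab by linarith
    qed (use far that in \<open>auto simp: P5_def\<close>)
    moreover have "\<not> ?R x" if "P2 x" using that ab Arg_neg_iff[of "zeta_map x"] by (auto simp: P2_def)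
    moreover have "\<not> ?R x" if "P3 x" using that ab unfolding P3_def by linarith
    moreover have "\<not> ?R x" if "P4 x" using that far by (auto simp: P4_def)
    moreover have "\<not> ?R x" if "P1a x \<or> P1b x" using that by (auto simp: P1a_def P1b_def)
    ultimately show ?thesis using that by blast
  qed
  have disj: "num_zeros n ?P = num_zeros n P1a + num_zeros n P1b + num_zeros n P2 + num_zeros n P3
      + num_zeros n P4 + num_zeros n P5" for n
  proof -
    have "num_zeros n P1a + num_zeros n P1b = num_zeros n (\<lambda>x. P1a x \<or> P1b x)"
      by (rule num_zeros_add) (use ab in \<open>auto simp: P1a_def P1b_def\<close>)
    thus ?thesis
      by (subst split_num_zeros_5) (auto simp: P1a_def P1b_def P2_def P3_def P4_def P5_def)
  qed
  \<comment> \<open>The five arcs lose 1 each and the real segment 3, which accounts for the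
    constant 8.\<close>
  have arith: "N - (p1 + p2 + p3 + p4 + p5 + p6) \<le> N - (a + b + 3 * c + d) + 8"
    if "a - 1 \<le> p1" "b - 1 \<le> p2" "c - 1 \<le> p3" "c - 1 \<le> p4" "c - 1 \<le> p5" "d - 3 \<le> p6"
    for N a b c d p1 p2 p3 p4 p5 p6 :: real
    using that by linarith
  show ?thesis using N1a N1b N2 N3 N4 N5
  proof eventually_elim
    case (elim n)
    have "real (zero_count n ?R) \<le> real n - real (num_zeros n ?P)"
      by (rule zero_count_upper) (rule out)
    also have "\<dots> \<le> real n - (real n * ((\<alpha> - \<eta>) - \<eta>) / (2 * pi) + real n * ((max_phase - \<eta>) - (\<beta> + \<eta>)) / (2 * pi)
       + 3 * (real n * ((max_phase - \<eta>) - \<eta>) / (2 * pi)) + 2 * r * real n) + 8"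
      unfolding disj of_nat_add by (rule arith[OF elim])
    also have "\<dots> = real n * (1 - 4 * max_phase / (2 * pi) - 2 / (pi * exp 1) + (\<beta> - \<alpha>) / (2 * pi)
        + (5 / pi) * \<eta> + 2 * \<eta>) + 8"
      unfolding r_def by (simp add: field_simps)
    also have "\<dots> = real n * ((\<beta> - \<alpha>) / (2 * pi) + ((5 / pi) * \<eta> + 2 * \<eta>)) + 8"
    proof -
      have "1 - 4 * max_phase / (2 * pi) - 2 / (pi * exp 1) = 0" using total_mass by linarith
      thus ?thesis by (simp only: add_0 add.assoc)
    qed
    \<comment> \<open>Ten cut-offs by \<open>\<eta>\<close> cost
      \<open>10 \<eta> / (2 \<pi>) \<le> 2 \<eta>\<close>, the shortened real segment another
      \<open>2 \<eta>\<close>.\<close>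
    also have "\<dots> \<le> real n * ((\<beta> - \<alpha>) / (2 * pi) + 4 * \<eta>) + 8"
    proof -
      have "5 / pi * \<eta> \<le> 2 * \<eta>" using h pi_gt3 by (intro mult_right_mono) (auto simp: divide_le_eq)
      thus ?thesis by (intro add_mono mult_left_mono) auto
    qed
    finally show ?case .
  qed
qed


section \<open>Passage to the limits\<close>

lemma ratio_tendsto_of_linear_bounds:
  fixes f :: "nat \<Rightarrow> real"
  assumes "\<eta>0 > 0"
    and "\<And>\<eta>. 0 < \<eta> \<Longrightarrow> \<eta> < \<eta>0 \<Longrightarrow> \<forall>\<^sub>F n in sequentially. real n * (c - 4 * \<eta>) - 8 \<le> f n"
    and "\<And>\<eta>. 0 < \<eta> \<Longrightarrow> \<eta> < \<eta>0 \<Longrightarrow> \<forall>\<^sub>F n in sequentially. f n \<le> real n * (c + 4 * \<eta>) + 8"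
  shows "(\<lambda>n. f n / real n) \<longlonglongrightarrow> c"
proof (rule tendstoI)
  fix e :: real assume e: "e > 0"
  define \<eta> where "\<eta> = min (e / 8) (\<eta>0 / 2)"
  have h: "0 < \<eta>" "\<eta> < \<eta>0" "4 * \<eta> \<le> e / 2" using e assms(1) by (auto simp: \<eta>_def)
  have "(\<lambda>n. 8 / real n) \<longlonglongrightarrow> 0" by real_asymp
  hence "\<forall>\<^sub>F n in sequentially. 8 / real n < e / 2" using e order_tendstoD(2) half_gt_zero by blast
  with assms(2)[OF h(1,2)] assms(3)[OF h(1,2)] eventually_gt_at_top[of 0]
  show "\<forall>\<^sub>F n in sequentially. dist (f n / real n) c < e"
  proof eventually_elim
    case (elim n)
    have "f n / real n \<le> (real n * (c + 4 * \<eta>) + 8) / real n" using elim by (intro divide_right_mono) auto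
    also have "\<dots> = c + 4 * \<eta> + 8 / real n" using elim(3) by (simp add: add_divide_distrib)
    finally have 1: "f n / real n < c + e" using elim(4) h(3) by linarith
    have "c - 4 * \<eta> - 8 / real n = (real n * (c - 4 * \<eta>) - 8) / real n"
      using elim(3) by (simp add: diff_divide_distrib)
    also have "\<dots> \<le> f n / real n" using elim by (intro divide_right_mono) auto
    finally have "c - e < f n / real n" using elim(4) h(3) by linarith
    with 1 show ?case by (simp add: dist_real_def abs_less_iff)
  qed
qed

lemma sector_count_tendsto:
  assumes "0 \<le> \<alpha>" "\<alpha> < \<beta>" "\<beta> \<le> max_phase" "0 < \<epsilon>" "\<epsilon> < 1 / (pi * exp 1)"
  shows "(\<lambda>n. real (zero_count n (\<lambda>x. infdist x BC < \<epsilon> \<and>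
      \<alpha> \<le> Arg (zeta_map x) \<and> Arg (zeta_map x) \<le> \<beta>)) / real n) \<longlonglongrightarrow> (\<beta> - \<alpha>) / (2 * pi)"
  by (rule ratio_tendsto_of_linear_bounds[of "1 / (pi * exp 1)"])
     (use assms in \<open>auto intro!: sector_count_lower sector_count_upper\<close>)

lemma zero_count_mono:
  assumes "\<And>x. P x \<Longrightarrow> Q x"
  shows "zero_count n P \<le> zero_count n Q"
proof -
  have "size (filter_mset P M) \<le> size (filter_mset Q M)" for M
    using assms by (induction M) auto
  thus ?thesis unfolding zero_count_def .
qed

lemma neighbourhood_count_lower:
  assumes "0 < \<epsilon>" "0 < \<eta>"
  shows "\<forall>\<^sub>F n in sequentially. real n * (max_phase / (2 * pi) - 4 * \<eta>) - 8
     \<le> real (zero_count n (\<lambda>x. infdist x BC < \<epsilon>))"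
  using sector_count_lower[of 0 max_phase, OF order_refl order_refl assms]
proof eventually_elim
  case (elim n)
  have "zero_count n (\<lambda>x. infdist x BC < \<epsilon> \<and> 0 \<le> Arg (zeta_map x) \<and> Arg (zeta_map x) \<le> max_phase)
      \<le> zero_count n (\<lambda>x. infdist x BC < \<epsilon>)" by (rule zero_count_mono) auto
  with elim show ?case by (simp only: diff_zero)
qed

text \<open>Without a sector, zeros of the mirror arcs adjoining B and C do lie near
  \<open>BC\<close>. Only the parts of these arcs cut off by \<open>\<eta>\<close> are removed; they
  have a positive distance from \<open>BC\<close>, and \<open>\<epsilon>0\<close> must be smaller
  than it.\<close>

lemma neighbourhood_count_upper:
  assumes h: "0 < \<eta>" "\<eta> < 1 / (pi * exp 1)"
  shows "\<exists>\<epsilon>0>0. \<forall>\<epsilon><\<epsilon>0. \<forall>\<^sub>F n in sequentially.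
    real (zero_count n (\<lambda>x. infdist x BC < \<epsilon>)) \<le> real n * (max_phase / (2 * pi) + 4 * \<eta>) + 8"
proof -
  define r where "r = 1 / (pi * exp 1) - \<eta>"
  have b: "max_phase - \<eta> < max_phase" using h by linarith
  define J where "J = phase_preimage \<eta> (max_phase - \<eta>)"
  \<comment> \<open>A margin from both axes, by compactness. The left arc is then at least
    \<open>d\<close> to the left of \<open>BC\<close>, and the upper right one at least
    \<open>d\<close> above it.\<close>
  have "\<exists>d>0. \<forall>\<rho>\<in>J. d < Re (arc_point \<rho>) \<and> d < - Im (arc_point \<rho>)"
  proof (cases "J = {}")
    case False
    have cont: "continuous_on J arc_point"
      by (rule continuous_on_subset[OF continuous_on_arc_point]) (auto simp: J_def phase_preimage_def)
    have J: "compact J" unfolding J_def by (rule compact_phase_preimage)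
    obtain s where s: "s \<in> J" "\<And>\<rho>. \<rho> \<in> J \<Longrightarrow> Re (arc_point s) \<le> Re (arc_point \<rho>)"
      using continuous_attains_inf[OF J False continuous_on_Re[OF cont]] by blast
    obtain t where t: "t \<in> J" "\<And>\<rho>. \<rho> \<in> J \<Longrightarrow> - Im (arc_point t) \<le> - Im (arc_point \<rho>)"
      using continuous_attains_inf[OF J False continuous_on_minus[OF continuous_on_Im[OF cont]]] by blast
    have q: "Re (arc_point \<rho>) > 0 \<and> - Im (arc_point \<rho>) > 0" if "\<rho> \<in> J" for \<rho>
      using arc_point_quadrant phase_preimage_strict[OF h(1) b that[unfolded J_def]] by simp
    define d where "d = min (Re (arc_point s)) (- Im (arc_point t)) / 2"
    have "d > 0" using q[OF s(1)] q[OF t(1)] by (simp add: d_def)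
    moreover have "d < Re (arc_point \<rho>) \<and> d < - Im (arc_point \<rho>)" if "\<rho> \<in> J" for \<rho>
      using s(2)[OF that] t(2)[OF that] \<open>d > 0\<close> by (auto simp: d_def min_def split: if_splits)
    ultimately show ?thesis by blast
  qed (auto intro: exI[of _ 1])
  then obtain d where d: "d > 0" "\<And>\<rho>. \<rho> \<in> J \<Longrightarrow> d < Re (arc_point \<rho>)"
     "\<And>\<rho>. \<rho> \<in> J \<Longrightarrow> d < - Im (arc_point \<rho>)" by blast
  have far2: "infdist x BC \<ge> d" if "Re x < - d" for x
  proof (rule infdist_BC_ge)
    fix y assume "y \<in> BC"
    hence "d \<le> \<bar>Re (x - y)\<bar>" using that by (auto simp: BC_def)
    thus "d \<le> dist x y" using abs_Re_le_cmod[of "x - y"] by (simp add: dist_norm)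
  qed
  have far3: "infdist x BC \<ge> d" if "Im x > d" for x
  proof (rule infdist_BC_ge)
    fix y assume "y \<in> BC"
    hence "d \<le> \<bar>Im (x - y)\<bar>" using that by (auto simp: BC_def)
    thus "d \<le> dist x y" using abs_Im_le_cmod[of "x - y"] by (simp add: dist_norm)
  qed
  have far5: "infdist x BC \<ge> \<eta>" if "Im x = 0" "\<bar>Re x\<bar> \<le> r" for x
  proof (rule infdist_BC_ge)
    fix y assume "y \<in> BC"
    hence "1 / (pi * exp 1) \<le> norm y" by (rule norm_BC_ge)
    moreover have "norm x = \<bar>Re x\<bar>" using that(1) by (simp add: cmod_def)
    ultimately show "\<eta> \<le> dist x y"
      using that(2) norm_triangle_ineq2[of y x] unfolding r_def dist_norm norm_minus_commute[of x y] by linarith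
  qed
  have "0 < min (min d \<eta>) (1 / (pi * exp 1))" using d h by simp
  moreover have "\<forall>\<^sub>F n in sequentially.
    real (zero_count n (\<lambda>x. infdist x BC < \<epsilon>)) \<le> real n * (max_phase / (2 * pi) + 4 * \<eta>) + 8"
    if "\<epsilon> < min (min d \<eta>) (1 / (pi * exp 1))" for \<epsilon>
  proof -
    have e: "\<epsilon> < d" "\<epsilon> < \<eta>" "\<epsilon> < 1 / (pi * exp 1)" using that by auto
    define P2 where "P2 = (\<lambda>x. Re x < - d \<and> Im x < 0)"
    define P3 where "P3 = (\<lambda>x. Re x > 0 \<and> Im x > d)"
    define P4 where "P4 = (\<lambda>x. Re x < 0 \<and> Im x > 0)"
    define P5 where "P5 = (\<lambda>x. Im x = 0 \<and> \<bar>Re x\<bar> \<le> r)"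
    have quad: "\<forall>\<^sub>F x in nhds (arc_point \<rho>). d < Re x \<and> Im x < - d" if "\<rho> \<in> J" for \<rho>
    proof (rule eventually_conj)
      show "\<forall>\<^sub>F x in nhds (arc_point \<rho>). d < Re x" "\<forall>\<^sub>F x in nhds (arc_point \<rho>). Im x < - d"
        using d(2,3)[OF that] by (intro eventually_nhds_less continuous_Re continuous_Im continuous_ident; linarith)+
    qed
    have N2: "\<forall>\<^sub>F n in sequentially. real n * ((max_phase - \<eta>) - \<eta>) / (2 * pi) - 1 \<le> real (num_zeros n P2)"
    proof (rule num_zeros_arc_left[OF h(1) b], fold J_def)
      fix \<rho> assume "\<rho> \<in> J"
      from quad[OF this] show "\<forall>\<^sub>F x in nhds (arc_point \<rho>). P2 (- cnj x)"
        by eventually_elim (use d(1) in \<open>auto simp: P2_def\<close>)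
    qed
    have N3: "\<forall>\<^sub>F n in sequentially. real n * ((max_phase - \<eta>) - \<eta>) / (2 * pi) - 1 \<le> real (num_zeros n P3)"
    proof (rule num_zeros_arc_cnj[OF h(1) b], fold J_def)
      fix \<rho> assume "\<rho> \<in> J"
      from quad[OF this] show "\<forall>\<^sub>F x in nhds (arc_point \<rho>). P3 (cnj x)"
        by eventually_elim (use d(1) in \<open>auto simp: P3_def\<close>)
    qed
    have N4: "\<forall>\<^sub>F n in sequentially. real n * ((max_phase - \<eta>) - \<eta>) / (2 * pi) - 1 \<le> real (num_zeros n P4)"
    proof (rule num_zeros_arc_neg[OF h(1) b], fold J_def)
      fix \<rho> assume "\<rho> \<in> J"
      from quad[OF this] show "\<forall>\<^sub>F x in nhds (arc_point \<rho>). P4 (- x)"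
        by eventually_elim (use d(1) in \<open>auto simp: P4_def\<close>)
    qed
    have N5: "\<forall>\<^sub>F n in sequentially. 2 * r * real n - 3 \<le> real (num_zeros n P5)"
      unfolding P5_def by (rule card_real_zeros) (use h in \<open>auto simp: r_def\<close>)
    \<comment> \<open>\<open>False\<close> fills the slot of the lower right quadrant: nothing near
      \<open>BC\<close> itself is removed.\<close>
    let ?P = "\<lambda>x. False \<or> P2 x \<or> P3 x \<or> P4 x \<or> P5 x"
    have out: "\<not> infdist x BC < \<epsilon>" if "?P x" for x
      using that far2[of x] far3[of x] far5[of x] infdist_BC_opposite[of x] e
      by (auto simp: P2_def P3_def P4_def P5_def not_less intro: order_trans[OF less_imp_le])
    have disj: "num_zeros n ?P = num_zeros n P2 + num_zeros n P3 + num_zeros n P4 + num_zeros n P5" for n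
      by (subst split_num_zeros_5) (use d(1) in \<open>auto simp: P2_def P3_def P4_def P5_def\<close>)
    have arith: "N - (p3 + p4 + p5 + p6) \<le> N - (3 * c + d) + 8"
      if "c - 1 \<le> p3" "c - 1 \<le> p4" "c - 1 \<le> p5" "d - 3 \<le> p6" for N c d p3 p4 p5 p6 :: real
      using that by linarith
    show ?thesis using N2 N3 N4 N5
    proof eventually_elim
      case (elim n)
      have "real (zero_count n (\<lambda>x. infdist x BC < \<epsilon>)) \<le> real n - real (num_zeros n ?P)"
        by (rule zero_count_upper) (rule out)
      also have "\<dots> \<le> real n - (3 * (real n * ((max_phase - \<eta>) - \<eta>) / (2 * pi)) + 2 * r * real n) + 8"
        unfolding disj of_nat_add by (rule arith[OF elim])
      also have "\<dots> = real n * (1 - 4 * max_phase / (2 * pi) - 2 / (pi * exp 1) + max_phase / (2 * pi)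
          + (3 / pi) * \<eta> + 2 * \<eta>) + 8"
        unfolding r_def by (simp add: field_simps)
      also have "\<dots> = real n * (max_phase / (2 * pi) + ((3 / pi) * \<eta> + 2 * \<eta>)) + 8"
      proof -
        have "1 - 4 * max_phase / (2 * pi) - 2 / (pi * exp 1) = 0" using total_mass by linarith
        thus ?thesis by (simp only: add_0 add.assoc)
      qed
      also have "\<dots> \<le> real n * (max_phase / (2 * pi) + 4 * \<eta>) + 8"
      proof -
        have "3 / pi * \<eta> \<le> 2 * \<eta>" using h pi_gt3 by (intro mult_right_mono) (auto simp: divide_le_eq)
        thus ?thesis by (intro add_mono mult_left_mono) auto
      qed
      finally show ?case .
    qed
  qed
  ultimately show ?thesis by blast
qed

lemma extreme_ratio_bounds:
  fixes f :: "nat \<Rightarrow> nat"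
  shows "(\<And>\<eta>. \<eta> > 0 \<Longrightarrow> \<forall>\<^sub>F n in sequentially. real n * (c - 4 * \<eta>) - 8 \<le> real (f n))
      \<Longrightarrow> ereal c \<le> liminf (\<lambda>n. ereal (real (f n) / real n))"
    and "\<eta> > 0 \<Longrightarrow> \<forall>\<^sub>F n in sequentially. real (f n) \<le> real n * (c + 4 * \<eta>) + 8
      \<Longrightarrow> limsup (\<lambda>n. ereal (real (f n) / real n)) \<le> ereal (c + 5 * \<eta>)"
proof -
  have small: "\<forall>\<^sub>F n in sequentially. 8 / real n < \<eta>" if "\<eta> > 0" for \<eta> :: real
  proof -
    have "(\<lambda>n. 8 / real n) \<longlonglongrightarrow> 0" by real_asymp
    thus ?thesis using that by (rule order_tendstoD(2))
  qed
  {
    assume low: "\<And>\<eta>. \<eta> > 0 \<Longrightarrow> \<forall>\<^sub>F n in sequentially. real n * (c - 4 * \<eta>) - 8 \<le> real (f n)"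
    show "ereal c \<le> liminf (\<lambda>n. ereal (real (f n) / real n))"
    proof (rule dense_le)
      fix y assume "y < ereal c"
      then obtain t where t: "y < ereal t" "t < c" using ereal_dense2 ereal_less_eq by force
      define \<eta> where "\<eta> = (c - t) / 5"
      have h: "\<eta> > 0" using t by (simp add: \<eta>_def)
      have "\<forall>\<^sub>F n in sequentially. ereal t \<le> ereal (real (f n) / real n)"
        using low[OF h] small[OF h] eventually_gt_at_top[of 0]
      proof eventually_elim
        case (elim n)
        have "5 * \<eta> = c - t" by (simp add: \<eta>_def)
        hence "t \<le> c - 4 * \<eta> - 8 / real n" using elim(2) by linarith
        also have "\<dots> = (real n * (c - 4 * \<eta>) - 8) / real n"
          using elim(3) by (simp add: diff_divide_distrib)
        also have "\<dots> \<le> real (f n) / real n" using elim by (intro divide_right_mono) auto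
        finally show ?case by simp
      qed
      hence "ereal t \<le> liminf (\<lambda>n. ereal (real (f n) / real n))" by (rule Liminf_bounded)
      with t(1) show "y \<le> liminf (\<lambda>n. ereal (real (f n) / real n))" by (meson less_imp_le order_trans)
    qed
  }
  assume h: "\<eta> > 0" and up: "\<forall>\<^sub>F n in sequentially. real (f n) \<le> real n * (c + 4 * \<eta>) + 8"
  have "\<forall>\<^sub>F n in sequentially. ereal (real (f n) / real n) \<le> ereal (c + 5 * \<eta>)"
    using up small[OF h] eventually_gt_at_top[of 0]
  proof eventually_elim
    case (elim n)
    have "real (f n) / real n \<le> (real n * (c + 4 * \<eta>) + 8) / real n" using elim by (intro divide_right_mono) auto
    also have "\<dots> = c + 4 * \<eta> + 8 / real n" using elim(3) by (simp add: add_divide_distrib)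
    finally show ?case using elim(2) by simp
  qed
  thus "limsup (\<lambda>n. ereal (real (f n) / real n)) \<le> ereal (c + 5 * \<eta>)" by (rule Limsup_bounded)
qed

text \<open>The lower bound for the liminf holds for every \<open>\<epsilon> > 0\<close>, the upper
  bound for the limsup only as \<open>\<epsilon>\<close> tends to 0;
  \<open>liminf \<le> limsup\<close> transfers each to the other quantity.\<close>

lemma neighbourhood_fraction:
  defines "ratio \<equiv> (\<lambda>\<epsilon> n. ereal (real (zero_count n (\<lambda>x. infdist x BC < \<epsilon>)) / real n))"
  shows "((\<lambda>\<epsilon>. limsup (ratio \<epsilon>)) \<longlongrightarrow> ereal (max_phase / (2 * pi))) (at_right 0)"
    and "((\<lambda>\<epsilon>. liminf (ratio \<epsilon>)) \<longlongrightarrow> ereal (max_phase / (2 * pi))) (at_right 0)"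
proof -
  let ?c = "max_phase / (2 * pi)"
  have low: "ereal ?c \<le> liminf (ratio \<epsilon>)" if "\<epsilon> > 0" for \<epsilon>
    unfolding ratio_def by (rule extreme_ratio_bounds(1)) (rule neighbourhood_count_lower[OF that])
  have le: "liminf (ratio \<epsilon>) \<le> limsup (ratio \<epsilon>)" for \<epsilon>
    by (rule Liminf_le_Limsup) simp
  have pos: "\<forall>\<^sub>F \<epsilon> in at_right (0::real). \<epsilon> > 0" by (rule eventually_at_right_less)
  have up: "\<forall>\<^sub>F \<epsilon> in at_right 0. limsup (ratio \<epsilon>) < y" if y: "ereal ?c < y" for y
  proof -
    obtain t where t: "?c < t" "ereal t < y" using ereal_dense2[OF y] by auto
    define k :: real where "k = 1 / (pi * exp 1)"
    define m where "m = ?c"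
    define \<eta> where "\<eta> = min ((t - m) / 5) (k / 2)"
    have "k > 0" "m < t" using t(1) by (simp_all add: k_def m_def)
    hence "0 < \<eta>" "\<eta> < k" "m + 5 * \<eta> \<le> t" by (auto simp: \<eta>_def min_def field_simps)
    hence h: "0 < \<eta>" "\<eta> < 1 / (pi * exp 1)" and ht: "?c + 5 * \<eta> \<le> t"
      unfolding k_def m_def by simp_all
    obtain \<epsilon>0 where \<epsilon>0: "\<epsilon>0 > 0" "\<And>\<epsilon>. \<epsilon> < \<epsilon>0 \<Longrightarrow> \<forall>\<^sub>F n in sequentially.
        real (zero_count n (\<lambda>x. infdist x BC < \<epsilon>)) \<le> real n * (?c + 4 * \<eta>) + 8"
      using neighbourhood_count_upper[OF h] by blast
    have "\<forall>\<^sub>F \<epsilon> in at_right 0. \<epsilon> < \<epsilon>0"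
      using \<epsilon>0(1) by (auto simp: eventually_at_right_field)
    thus ?thesis
    proof eventually_elim
      case (elim \<epsilon>)
      have "limsup (ratio \<epsilon>) \<le> ereal (?c + 5 * \<eta>)"
        unfolding ratio_def by (rule extreme_ratio_bounds(2)[OF h(1) \<epsilon>0(2)[OF elim]])
      also have "\<dots> \<le> ereal t" using ht by simp
      finally show ?case using t(2) by (rule le_less_trans)
    qed
  qed
  show "((\<lambda>\<epsilon>. limsup (ratio \<epsilon>)) \<longlongrightarrow> ereal ?c) (at_right 0)"
  proof (rule order_tendstoI)
    fix y assume y: "y < ereal ?c"
    from pos show "\<forall>\<^sub>F \<epsilon> in at_right 0. y < limsup (ratio \<epsilon>)"
    proof eventually_elim
      case (elim \<epsilon>)
      show ?case using y order_trans[OF low[OF elim] le] by (rule less_le_trans)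
    qed
  qed (rule up)
  show "((\<lambda>\<epsilon>. liminf (ratio \<epsilon>)) \<longlongrightarrow> ereal ?c) (at_right 0)"
  proof (rule order_tendstoI)
    fix y assume y: "y < ereal ?c"
    from pos show "\<forall>\<^sub>F \<epsilon> in at_right 0. y < liminf (ratio \<epsilon>)"
    proof eventually_elim
      case (elim \<epsilon>)
      show ?case using y low[OF elim] by (rule less_le_trans)
    qed
  next
    fix y assume "ereal ?c < y"
    from up[OF this] show "\<forall>\<^sub>F \<epsilon> in at_right 0. liminf (ratio \<epsilon>) < y"
    proof eventually_elim
      case (elim \<epsilon>)
      show ?case using le elim by (rule le_less_trans)
    qed
  qed
qed

theorem theorem1:
  shows "(\<exists>g. arc g \<and> path_image g = BC \<and> pathstart g = - \<i> / of_real pi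
           \<and> pathfinish g = of_real (1 / (pi * exp 1)))
    \<and> zeta_map ` BC = cis ` {0 .. pi / 2 - 1 / exp 1}
    \<and> (\<forall>\<alpha> \<beta>. 0 \<le> \<alpha> \<and> \<alpha> < \<beta> \<and> \<beta> \<le> pi / 2 - 1 / exp 1 \<longrightarrow>
        (\<forall>\<^sub>F \<epsilon> in at_right (0::real).
          (\<lambda>n. real (zero_count n (\<lambda>x. infdist x BC < \<epsilon> \<and>
                   \<alpha> \<le> Arg (zeta_map x) \<and> Arg (zeta_map x) \<le> \<beta>)) / real n)
            \<longlonglongrightarrow> (\<beta> - \<alpha>) / (2 * pi)))
    \<and> (pi / 2 - 1 / exp 1) / (2 * pi) = 1 / 4 - 1 / (2 * pi * exp 1)
    \<and> ((\<lambda>\<epsilon>. limsup (\<lambda>n. ereal (real (zero_count n (\<lambda>x. infdist x BC < \<epsilon>)) / real n)))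
          \<longlongrightarrow> ereal (1 / 4 - 1 / (2 * pi * exp 1))) (at_right (0::real))
    \<and> ((\<lambda>\<epsilon>. liminf (\<lambda>n. ereal (real (zero_count n (\<lambda>x. infdist x BC < \<epsilon>)) / real n)))
          \<longlongrightarrow> ereal (1 / 4 - 1 / (2 * pi * exp 1))) (at_right (0::real))"
proof (intro conjI)
  have c: "max_phase / (2 * pi) = 1 / 4 - 1 / (2 * pi * exp 1)"
    by (simp add: diff_divide_distrib mult.commute)
  show "(pi / 2 - 1 / exp 1) / (2 * pi) = 1 / 4 - 1 / (2 * pi * exp 1)" by (rule c)
  note lim = neighbourhood_fraction[unfolded c]
  show "((\<lambda>\<epsilon>. limsup (\<lambda>n. ereal (real (zero_count n (\<lambda>x. infdist x BC < \<epsilon>)) / real n)))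
          \<longlongrightarrow> ereal (1 / 4 - 1 / (2 * pi * exp 1))) (at_right (0::real))" by (rule lim(1))
  show "((\<lambda>\<epsilon>. liminf (\<lambda>n. ereal (real (zero_count n (\<lambda>x. infdist x BC < \<epsilon>)) / real n)))
          \<longlongrightarrow> ereal (1 / 4 - 1 / (2 * pi * exp 1))) (at_right (0::real))" by (rule lim(2))
  show "\<forall>\<alpha> \<beta>. 0 \<le> \<alpha> \<and> \<alpha> < \<beta> \<and> \<beta> \<le> pi / 2 - 1 / exp 1 \<longrightarrow>
        (\<forall>\<^sub>F \<epsilon> in at_right (0::real).
          (\<lambda>n. real (zero_count n (\<lambda>x. infdist x BC < \<epsilon> \<and>
                   \<alpha> \<le> Arg (zeta_map x) \<and> Arg (zeta_map x) \<le> \<beta>)) / real n)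
            \<longlonglongrightarrow> (\<beta> - \<alpha>) / (2 * pi))"
  proof (intro allI impI)
    fix \<alpha> \<beta> :: real
    assume ab: "0 \<le> \<alpha> \<and> \<alpha> < \<beta> \<and> \<beta> \<le> pi / 2 - 1 / exp 1"
    \<comment> \<open>The distance \<open>1/(\<pi>e)\<close> of \<open>BC\<close> from the origin is
      small enough: it excludes the second quadrant, and the other zeros are sorted out by
      \<open>arg \<zeta>\<close>.\<close>
    have "\<forall>\<^sub>F \<epsilon> in at_right (0::real). 0 < \<epsilon> \<and> \<epsilon> < 1 / (pi * exp 1)"
      by (auto simp: eventually_at_right_field intro!: exI[of _ "1 / (pi * exp 1)"])
    thus "\<forall>\<^sub>F \<epsilon> in at_right (0::real).
          (\<lambda>n. real (zero_count n (\<lambda>x. infdist x BC < \<epsilon> \<and>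
                   \<alpha> \<le> Arg (zeta_map x) \<and> Arg (zeta_map x) \<le> \<beta>)) / real n)
            \<longlonglongrightarrow> (\<beta> - \<alpha>) / (2 * pi)"
      by eventually_elim (use ab in \<open>intro sector_count_tendsto; linarith\<close>)
  qed
qed (rule BC_arc zeta_map_image_BC)+

end
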